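(* Let $\mathcal G$ be an $S^1$-bundle gerbe $P\rightrightarrows X$ over a smooth manifold $M$ with connection $\gamma$, let $\tau\in\Omega^2(M)$, let $B$ be a curving for $\gamma$ with resulting 3-curvature $\chi$, and let $B'=B+\pi^*\tau$, a curving for $\gamma$ with resulting 3-curvature $\chi+d\tau$. Let $\mathsf G:\mathbb X(\mathcal G)\dashrightarrow\mathbb A(M,\chi)$ and $\mathsf G':\mathbb X(\mathcal G)\dashrightarrow\mathbb A(M,\chi+d\tau)$ be the invertible butterflies determined by $(\gamma,B)$ and $(\gamma,B')$ respectively (see context), and let $\mathsf{id}_\tau:\mathbb A(M,\chi)\to\mathbb A(M,\chi+d\tau)$ be the isomorphism of Lie 2-algebras given by the identity chain map with chain homotopy $(x_1,x_2)\mapsto\iota_{x_2}\iota_{x_1}\tau$. Then the triangle formed by $\mathsf G$, $\mathsf G'$ and $\mathsf{id}_\tau$ 2-commutes: there is an isomorphism of butterflies between $\mathsf{id}_\tau\circ\mathsf G$ and $\mathsf G'$.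
   Context: **Lie 2-algebras.** A Lie 2-algebra $V$ consists of a linear map $\partial:V_1\to V_0$ of real vector spaces, a skew bilinear bracket $V_0\times V_0\to V_0$, a bilinear bracket $V_0\times V_1\to V_1$ (with $[a,x]:=-[x,a]$), and an alternating trilinear Jacobiator $J:V_0^3\to V_1$, such that $\partial[x,a]=[x,\partial a]$, $[\partial a,b]=[a,\partial b]$, $\partial J(x,y,z)=[x,[y,z]]+[y,[z,x]]+[z,[x,y]]$, $J(x,y,\partial a)=[x,[y,a]]+[y,[a,x]]+[a,[x,y]]$, and $\sum_i(-1)^{i+1}[x_i,J(\dots\widehat{x_i}\dots)]+\sum_{i<j}(-1)^{i+j}J([x_i,x_j],\dots\widehat{x_i}\dots\widehat{x_j}\dots)=0$ for $x_1,\dots,x_4\in V_0$. It is strict if $J=0$. **Morphisms.** A morphism $f:V\to W$ is a chain map $(f_0,f_1)$ with a skew bilinear $f_2:V_0\times V_0\to W_1$ (chain homotopy) such that $\partial f_2(x,y)=f_0[x,y]-[f_0x,f_0y]$, $f_2(x,\partial a)=f_1[x,a]-[f_0x,f_1a]$, and $f_1J_V(x,y,z)-J_W(f_0x,f_0y,f_0z)=\sum_{\rm cyc}\big([f_0x,f_2(y,z)]+f_2(x,[y,z])\big)$. **Butterflies.** A butterfly $V\dashrightarrow W$ is a vector space $E$ with a skew bilinear bracket and linear maps $\kappa:V_1\to E$, $\lambda:W_1\to E$, $\sigma:E\to V_0$, $\rho:E\to W_0$ such that $\sigma\kappa=\partial_V$, $\rho\lambda=\partial_W$, $\rho\kappa=0$,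 $\sigma\lambda=0$; the sequence $0\to W_1\xrightarrow{\lambda}E\xrightarrow{\sigma}V_0\to0$ is exact; $\sigma$ and $\rho$ preserve brackets; $[e,\lambda(w)]=\lambda[\rho(e),w]$ and $[e,\kappa(v)]=\kappa[\sigma(e),v]$; and $[e_1,[e_2,e_3]]+[e_2,[e_3,e_1]]+[e_3,[e_1,e_2]]=\lambda J_W(\rho e_1,\rho e_2,\rho e_3)+\kappa J_V(\sigma e_1,\sigma e_2,\sigma e_3)$. It is invertible if also $0\to V_1\xrightarrow{\kappa}E\xrightarrow{\rho}W_0\to0$ is exact. An isomorphism (2-morphism) of butterflies $E\Rightarrow E'$ is a bracket-preserving linear isomorphism commuting with all structure maps. The composite of $E:V\dashrightarrow W$ and $E':W\dashrightarrow U$ is $E'\circ E=(E\times_{W_0}E')/\{(\lambda_E(w),\kappa_{E'}(w)):w\in W_1\}$ (fibre product of $\rho_E$ and $\sigma_{E'}$), with componentwise bracket, $\kappa(v)=(\kappa_E(v),0)$, $\lambda(u)=(0,\lambda_{E'}(u))$, $\sigma=\sigma_E$, $\rho=\rho_{E'}$. A morphism $f:V\to W$ is regarded as the butterfly $W_1\oplus V_0$ with $\kappa(v)=(-f_1(v),\partial v)$, $\lambda(w)=(w,0)$, $\sigma(w,x)=x$, $\rho(w,x)=\partial w+f_0(x)$, and bracket $[(w,x),(w',x')]=([f_0x,w']-[f_0x',w]+[\partial w,w']-f_2(x,x'),[x,x'])$. **Bundle gerbes.** An $S^1$-bundle gerbe $\mathcal G$ over $M$ consists of a surjective submersion $\pi:X\to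 M$, a Lie groupoid $P\rightrightarrows X$ (source $s$, target $t$; product $p\cdot q$ defined when $s(p)=t(q)$; unit map $\epsilon:X\to P$), a morphism of Lie groupoids over $\mathrm{id}_X$ from $P$ to the submersion groupoid $X\times_MX\rightrightarrows X$, and a left $S^1$-action on $P$ making $P\to X\times_MX$ a principal $S^1$-bundle with $(zp)\cdot(wq)=(zw)(p\cdot q)$. The simplicial differential is $\delta\omega=s^*\omega-t^*\omega$ for $\omega\in\Omega^\bullet(X)$ and $\delta\omega=\mathrm{pr}_1^*\omega-m^*\omega+\mathrm{pr}_2^*\omega$ for $\omega\in\Omega^\bullet(P)$, $m$ the multiplication. A connection on $\mathcal G$ is a principal connection 1-form $\gamma\in\Omega^1(P)$ (real-valued) with $\delta\gamma=0$. A curving for $\gamma$ is $B\in\Omega^2(X)$ with $\delta B=d\gamma$. The 3-curvature is the $\chi\in\Omega^3(M)$ with $\pi^*\chi=dB$. **Multiplicative vector fields.** A multiplicative vector field on $P\rightrightarrows X$ is a pair $(\mathbf x,\mathbf p)\in\mathfrak X(X)\times\mathfrak X(P)$ forming a functor from $P\rightrightarrows X$ to $TP\rightrightarrows TX$; such an $\mathbf x$ projects to a vector field $x$ on $M$. Let $A_P=\ker ds|_X$ be the Lie algebroid. For $a\in\Gamma(A_P)$ put $\mathbf a=dt(a)$, $\overrightarrow a(p)=dR_p(a(t(p)))$, $\overleftarrow a(p)=d(L_p\circ i)(a(s(p)))$ ($i$ = inversion), $\bar{\mathbf a}=\overrightarrow a+\overleftarrow a$, and $\mathsf v_a=\epsilon^*(\iota_{\overrightarrow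 a}\gamma)$. $\mathbb X(\mathcal G)$ is the strict Lie 2-algebra with degree-1 part $\Gamma(A_P)$, degree-0 part $\mathbb X(\mathcal G)_0$ the multiplicative vector fields, differential $a\mapsto(\mathbf a,\bar{\mathbf a})$, componentwise Lie bracket in degree 0, and $[(\mathbf x,\mathbf p),a]=[\mathbf p,\overrightarrow a]|_X$. **The Atiyah Lie 2-algebra $\mathbb A(M,\chi)$**: complex $C^\infty(M)\to\mathfrak X(M)$ with zero differential, Lie bracket of vector fields in degree 0, $[x,f]=L_xf$, Jacobiator $-\iota_{x_3}\iota_{x_2}\iota_{x_1}\chi$. **The butterfly $\mathsf G$ determined by $(\gamma,B)$**: $G=\{(\mathbf x,\mathbf p,g)\in\mathbb X(\mathcal G)_0\times C^\infty(X):\delta g=\iota_{\mathbf p}\gamma\}$, bracket $[(\mathbf x,\mathbf p,g),(\mathbf z,\mathbf r,h)]=([\mathbf x,\mathbf z],[\mathbf p,\mathbf r],L_{\mathbf x}h-L_{\mathbf z}g-\iota_{\mathbf z}\iota_{\mathbf x}B)$; $\sigma(\mathbf x,\mathbf p,g)=(\mathbf x,\mathbf p)$; $\rho(\mathbf x,\mathbf p,g)=x$; $\lambda(f)=(0,0,\pi^*f)$; $\kappa(a)=(\mathbf a,\bar{\mathbf a},-\mathsf v_a)$. The butterfly $\mathsf G'$ is obtained by replacing $B$ with $B'$. *)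

theory Defs
  imports
    "HOL-Analysis.Analysis"
    "HOL-Library.Function_Algebras"
    "HOL-Algebra.AbelCoset"
    "HOL-Algebra.Module"
begin

text \<open>
  Conventions used throughout.
  \<^item> A manifold lives on a subset of a type.  Functions, vector fields and forms on it are total
    HOL functions that vanish outside their domain, so that equality of such objects
    is equality of HOL functions.
  \<^item> All vector spaces are real. Concrete ones are carried by subspaces of a
    \<^class>\<open>real_vector\<close> type; function spaces become such types by the pointwise operations.
\<close>

instantiation "fun" :: (type, real_vector) real_vector
begin

definition scaleR_fun :: "real \<Rightarrow> ('a \<Rightarrow> 'b) \<Rightarrow> 'a \<Rightarrow> 'b"
  where "scaleR_fun c f = (\<lambda>x. c *\<^sub>R f x)"

instance
  by standard (simp_all add: scaleR_fun_def fun_eq_iff algebra_simps)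

end


section \<open>Smooth manifolds\<close>

text \<open>
  The space \<open>\<real>\<^sup>n\<close> is \<^const>\<open>Euclidean_space\<close> \<open>n\<close>, the sequences supported on \<open>{..<n}\<close>; the case
  \<open>n = 0\<close> is allowed.  A function is \<open>C\<^sup>k\<close> if all iterated partial derivatives of order at
  most \<open>k\<close> exist and are continuous.
\<close>

definition partial_deriv :: "nat \<Rightarrow> ((nat \<Rightarrow> real) \<Rightarrow> real) \<Rightarrow> (nat \<Rightarrow> real) \<Rightarrow> real"
  where "partial_deriv i f u = deriv (\<lambda>t. f (u(i := t))) (u i)"

primrec Ck_on :: "nat \<Rightarrow> nat \<Rightarrow> (nat \<Rightarrow> real) set \<Rightarrow> ((nat \<Rightarrow> real) \<Rightarrow> real) \<Rightarrow> bool"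
  where
    "Ck_on n 0 S f \<longleftrightarrow>
       continuous_map (subtopology (Euclidean_space n) S) euclideanreal f"
  | "Ck_on n (Suc k) S f \<longleftrightarrow>
       continuous_map (subtopology (Euclidean_space n) S) euclideanreal f \<and>
       (\<forall>i<n. (\<forall>u\<in>S. (\<lambda>t. f (u(i := t))) field_differentiable at (u i)) \<and>
              Ck_on n k S (partial_deriv i f))"

definition Cinf_on :: "nat \<Rightarrow> (nat \<Rightarrow> real) set \<Rightarrow> ((nat \<Rightarrow> real) \<Rightarrow> real) \<Rightarrow> bool"
  where "Cinf_on n S f \<longleftrightarrow> (\<forall>k. Ck_on n k S f)"

type_synonym 'a chart = "'a set \<times> ('a \<Rightarrow> nat \<Rightarrow> real)"

record 'a mfd =
  pts :: "'a set"
  mdim :: nat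
  atlas :: "'a chart set"

definition chart_inv :: "'a chart \<Rightarrow> (nat \<Rightarrow> real) \<Rightarrow> 'a"
  where "chart_inv c = the_inv_into (fst c) (snd c)"

definition mtop :: "'a mfd \<Rightarrow> 'a topology"
  where "mtop M = topology (\<lambda>W. W \<subseteq> pts M \<and>
    (\<forall>(U, \<phi>)\<in>atlas M. openin (Euclidean_space (mdim M)) (\<phi> ` (U \<inter> W))))"

definition smooth_compatible :: "nat \<Rightarrow> 'a chart \<Rightarrow> 'a chart \<Rightarrow> bool"
  where "smooth_compatible n c d \<longleftrightarrow>
    openin (Euclidean_space n) (snd c ` (fst c \<inter> fst d)) \<and>
    (\<forall>i<n. Cinf_on n (snd c ` (fst c \<inter> fst d)) (\<lambda>u. snd d (chart_inv c u) i))"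

definition smooth_manifold :: "'a mfd \<Rightarrow> bool"
  where "smooth_manifold M \<longleftrightarrow>
    (\<Union>(U, \<phi>)\<in>atlas M. U) = pts M \<and>
    (\<forall>(U, \<phi>)\<in>atlas M. inj_on \<phi> U) \<and>
    (\<forall>c\<in>atlas M. \<forall>d\<in>atlas M. smooth_compatible (mdim M) c d) \<and>
    Hausdorff_space (mtop M) \<and> second_countable (mtop M)"

definition smooth_on :: "'a mfd \<Rightarrow> 'a set \<Rightarrow> ('a \<Rightarrow> real) \<Rightarrow> bool"
  where "smooth_on M W f \<longleftrightarrow>
    (\<forall>c\<in>atlas M. Cinf_on (mdim M) (snd c ` (fst c \<inter> W)) (\<lambda>u. f (chart_inv c u)))"

definition smooth_at :: "'a mfd \<Rightarrow> 'a \<Rightarrow> ('a \<Rightarrow> real) \<Rightarrow> bool"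
  where "smooth_at M p f \<longleftrightarrow> (\<exists>W. openin (mtop M) W \<and> p \<in> W \<and> smooth_on M W f)"

definition smooth_functions :: "'a mfd \<Rightarrow> ('a \<Rightarrow> real) set"
  where "smooth_functions M = {f. smooth_on M (pts M) f \<and> (\<forall>p. p \<notin> pts M \<longrightarrow> f p = 0)}"

definition smooth_map :: "'a mfd \<Rightarrow> 'b mfd \<Rightarrow> ('a \<Rightarrow> 'b) \<Rightarrow> bool"
  where "smooth_map M N F \<longleftrightarrow>
    continuous_map (mtop M) (mtop N) F \<and>
    (\<forall>c\<in>atlas M. \<forall>d\<in>atlas N. \<forall>i<mdim N.
       Cinf_on (mdim M) (snd c ` {p \<in> fst c. F p \<in> fst d})
         (\<lambda>u. snd d (F (chart_inv c u)) i))"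

definition diffeomorphism :: "'a mfd \<Rightarrow> 'b mfd \<Rightarrow> ('a \<Rightarrow> 'b) \<Rightarrow> bool"
  where "diffeomorphism M N F \<longleftrightarrow> smooth_map M N F \<and>
    (\<exists>G. smooth_map N M G \<and> (\<forall>p\<in>pts M. G (F p) = p) \<and> (\<forall>q\<in>pts N. F (G q) = q))"

definition open_submfd :: "'a mfd \<Rightarrow> 'a set \<Rightarrow> 'a mfd"
  where "open_submfd M W =
    \<lparr>pts = pts M \<inter> W, mdim = mdim M, atlas = {(U \<inter> W, \<phi>) |U \<phi>. (U, \<phi>) \<in> atlas M}\<rparr>"

definition prod_mfd :: "'a mfd \<Rightarrow> 'b mfd \<Rightarrow> ('a \<times> 'b) mfd"
  where "prod_mfd M N =
    \<lparr>pts = pts M \<times> pts N, mdim = mdim M + mdim N,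
     atlas = {(U \<times> V, \<lambda>(p, q) i. if i < mdim M then \<phi> p i else \<psi> q (i - mdim M))
               |U \<phi> V \<psi>. (U, \<phi>) \<in> atlas M \<and> (V, \<psi>) \<in> atlas N}\<rparr>"

definition maximal_atlas :: "'a mfd \<Rightarrow> 'a chart set"
  where "maximal_atlas M = {c. openin (mtop M) (fst c) \<and> inj_on (snd c) (fst c) \<and>
    smooth_compatible (mdim M) c c \<and>
    (\<forall>d\<in>atlas M. smooth_compatible (mdim M) c d \<and> smooth_compatible (mdim M) d c)}"

text \<open>
  The submanifold structure on a \<open>k\<close>-dimensional embedded submanifold \<open>S\<close>, given by the slice
  charts, i.e. the charts \<open>\<phi>\<close> of the ambient manifold that map \<open>U \<inter> S\<close> onto \<open>\<phi>(U) \<inter> \<real>\<^sup>k\<close>.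
\<close>

definition submfd :: "'a mfd \<Rightarrow> 'a set \<Rightarrow> nat \<Rightarrow> 'a mfd"
  where "submfd M S k =
    \<lparr>pts = S, mdim = k,
     atlas = {(U \<inter> S, \<phi>) |U \<phi>. (U, \<phi>) \<in> maximal_atlas M \<and>
                \<phi> ` (U \<inter> S) = {u \<in> \<phi> ` U. \<forall>i\<ge>k. u i = 0}}\<rparr>"

definition real_line :: "real mfd"
  where "real_line = \<lparr>pts = UNIV, mdim = 1, atlas = {(UNIV, \<lambda>t i. if i = 0 then t else 0)}\<rparr>"

text \<open>The circle group \<open>S\<^sup>1 \<subseteq> \<complex>\<close>; the chart with index \<open>a\<close> sends \<^term>\<open>cis t\<close> to \<open>t\<close> for \<open>\<bar>t - a\<bar> < \<pi>\<close>.\<close>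

definition circle :: "complex mfd"
  where "circle =
    \<lparr>pts = sphere 0 1, mdim = 1,
     atlas = {(cis ` {a - pi<..<a + pi}, \<lambda>z i. if i = 0 then a + Arg (z * cis (- a)) else 0) |a. True}\<rparr>"


section \<open>Tangent vectors, vector fields and submersions\<close>

text \<open>
  A tangent vector at \<open>p\<close> is the velocity of a smooth curve through \<open>p\<close>, as an operator on the
  functions that are smooth near \<open>p\<close>; it is set to \<open>0\<close> on all other functions.
\<close>

type_synonym 'a tvec = "('a \<Rightarrow> real) \<Rightarrow> real"
type_synonym 'a vfield = "'a \<Rightarrow> 'a tvec"

definition velocity :: "'a mfd \<Rightarrow> (real \<Rightarrow> 'a) \<Rightarrow> 'a tvec"
  where "velocity M c = (\<lambda>f. if smooth_at M (c 0) f then deriv (\<lambda>t. f (c t)) 0 else 0)"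

definition tangent :: "'a mfd \<Rightarrow> 'a \<Rightarrow> 'a tvec set"
  where "tangent M p =
    {velocity M c |c e. e > 0 \<and> smooth_map (open_submfd real_line {-e<..<e}) M c \<and> c 0 = p}"

text \<open>\<open>dmap N F p\<close> is the tangent map of \<open>F\<close> at \<open>p\<close>, where \<open>F\<close> takes values in \<open>N\<close>.\<close>

definition dmap :: "'b mfd \<Rightarrow> ('a \<Rightarrow> 'b) \<Rightarrow> 'a \<Rightarrow> 'a tvec \<Rightarrow> 'b tvec"
  where "dmap N F p v = (\<lambda>f. if smooth_at N (F p) f then v (\<lambda>q. f (F q)) else 0)"

definition surjective_submersion :: "'a mfd \<Rightarrow> 'b mfd \<Rightarrow> ('a \<Rightarrow> 'b) \<Rightarrow> bool"
  where "surjective_submersion M N F \<longleftrightarrow>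
    smooth_map M N F \<and> F ` pts M = pts N \<and>
    (\<forall>p\<in>pts M. dmap N F p ` tangent M p = tangent N (F p))"

text \<open>
  The fibre product of \<open>F : M \<rightarrow> Z\<close> and \<open>G : N \<rightarrow> Z\<close>, one of which is a submersion, as an embedded
  submanifold of \<open>M \<times> N\<close>.
\<close>

definition fibre_product :: "'a mfd \<Rightarrow> 'b mfd \<Rightarrow> 'c mfd \<Rightarrow> ('a \<Rightarrow> 'c) \<Rightarrow> ('b \<Rightarrow> 'c) \<Rightarrow> ('a \<times> 'b) mfd"
  where "fibre_product M N Z F G =
    submfd (prod_mfd M N) {(p, q). p \<in> pts M \<and> q \<in> pts N \<and> F p = G q}
      (mdim M + mdim N - mdim Z)"

text \<open>Smooth vector fields along \<open>F : N \<rightarrow> M\<close>, i.e. smooth sections of \<open>F\<^sup>*TM\<close>.\<close>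

definition vfields_along :: "'a mfd \<Rightarrow> 'b mfd \<Rightarrow> ('a \<Rightarrow> 'b) \<Rightarrow> ('a \<Rightarrow> 'b tvec) set"
  where "vfields_along N M F =
    {a. (\<forall>q\<in>pts N. a q \<in> tangent M (F q)) \<and> (\<forall>q. q \<notin> pts N \<longrightarrow> a q = 0) \<and>
        (\<forall>W f. openin (mtop M) W \<and> smooth_on M W f \<longrightarrow>
               smooth_on N {q \<in> pts N. F q \<in> W} (\<lambda>q. a q f))}"

definition vfields :: "'a mfd \<Rightarrow> 'a vfield set"
  where "vfields M = vfields_along M M (\<lambda>p. p)"

definition lie_deriv :: "'a vfield \<Rightarrow> ('a \<Rightarrow> real) \<Rightarrow> 'a \<Rightarrow> real"
  where "lie_deriv x f = (\<lambda>p. x p f)"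

definition lie_bracket :: "'a mfd \<Rightarrow> 'a vfield \<Rightarrow> 'a vfield \<Rightarrow> 'a vfield"
  where "lie_bracket M x y =
    (\<lambda>p f. if p \<in> pts M \<and> smooth_at M p f then x p (lie_deriv y f) - y p (lie_deriv x f) else 0)"


section \<open>Differential forms\<close>

type_synonym 'a form = "'a \<Rightarrow> 'a tvec list \<Rightarrow> real"

definition forms :: "'a mfd \<Rightarrow> nat \<Rightarrow> 'a form set"
  where "forms M k = {\<omega>.
    (\<forall>p vs. \<not> (p \<in> pts M \<and> length vs = k \<and> set vs \<subseteq> tangent M p) \<longrightarrow> \<omega> p vs = 0) \<and>
    (\<forall>p\<in>pts M. \<forall>vs i v w r. length vs = k \<and> set vs \<subseteq> tangent M p \<and> i < k \<and>
       v \<in> tangent M p \<and> w \<in> tangent M p \<longrightarrow>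
       \<omega> p (vs[i := r *\<^sub>R v + w]) = r * \<omega> p (vs[i := v]) + \<omega> p (vs[i := w])) \<and>
    (\<forall>p vs. \<not> distinct vs \<longrightarrow> \<omega> p vs = 0) \<and>
    (\<forall>xs. length xs = k \<and> set xs \<subseteq> vfields M \<longrightarrow>
       (\<lambda>p. \<omega> p (map (\<lambda>x. x p) xs)) \<in> smooth_functions M)}"

definition contract :: "'a vfield \<Rightarrow> 'a form \<Rightarrow> 'a form"
  where "contract x \<omega> = (\<lambda>p vs. \<omega> p (x p # vs))"

definition form0_fun :: "'a form \<Rightarrow> 'a \<Rightarrow> real"
  where "form0_fun \<omega> = (\<lambda>p. \<omega> p [])"

definition pullback :: "'a mfd \<Rightarrow> 'b mfd \<Rightarrow> ('a \<Rightarrow> 'b) \<Rightarrow> 'b form \<Rightarrow> 'a form"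
  where "pullback M N F \<omega> = (\<lambda>p vs.
    if p \<in> pts M \<and> set vs \<subseteq> tangent M p then \<omega> (F p) (map (dmap N F p) vs) else 0)"

definition pullback_fun :: "'a mfd \<Rightarrow> ('a \<Rightarrow> 'b) \<Rightarrow> ('b \<Rightarrow> real) \<Rightarrow> 'a \<Rightarrow> real"
  where "pullback_fun M F f = (\<lambda>p. if p \<in> pts M then f (F p) else 0)"

definition omit :: "nat \<Rightarrow> 'a list \<Rightarrow> 'a list"
  where "omit i xs = take i xs @ drop (Suc i) xs"

text \<open>The exterior derivative of a \<open>k\<close>-form, characterised by the invariant (Koszul) formula.\<close>

definition ext_deriv :: "'a mfd \<Rightarrow> nat \<Rightarrow> 'a form \<Rightarrow> 'a form"
  where "ext_deriv M k \<omega> = (THE \<eta>. \<eta> \<in> forms M (Suc k) \<and>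
    (\<forall>xs. length xs = Suc k \<and> set xs \<subseteq> vfields M \<longrightarrow> (\<forall>p\<in>pts M.
      \<eta> p (map (\<lambda>x. x p) xs) =
        (\<Sum>i\<le>k. (-1) ^ i * lie_deriv (xs ! i) (\<lambda>q. \<omega> q (map (\<lambda>x. x q) (omit i xs))) p) +
        (\<Sum>j\<le>k. \<Sum>i<j. (-1) ^ (i + j) *
            \<omega> p (map (\<lambda>x. x p) (lie_bracket M (xs ! i) (xs ! j) # omit i (omit j xs)))))))"


section \<open>Lie groupoids\<close>

record ('p, 'x) gpd =
  objs :: "'x set"
  arrs :: "'p set"
  src :: "'p \<Rightarrow> 'x"
  tgt :: "'p \<Rightarrow> 'x"
  mlt :: "'p \<Rightarrow> 'p \<Rightarrow> 'p"
  unt :: "'x \<Rightarrow> 'p"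
  ginv :: "'p \<Rightarrow> 'p"

definition groupoid :: "('p, 'x) gpd \<Rightarrow> bool"
  where "groupoid G \<longleftrightarrow>
    (\<forall>p\<in>arrs G. src G p \<in> objs G \<and> tgt G p \<in> objs G) \<and>
    (\<forall>p\<in>arrs G. \<forall>q\<in>arrs G. src G p = tgt G q \<longrightarrow>
       mlt G p q \<in> arrs G \<and> src G (mlt G p q) = src G q \<and> tgt G (mlt G p q) = tgt G p) \<and>
    (\<forall>p\<in>arrs G. \<forall>q\<in>arrs G. \<forall>r\<in>arrs G. src G p = tgt G q \<and> src G q = tgt G r \<longrightarrow>
       mlt G (mlt G p q) r = mlt G p (mlt G q r)) \<and>
    (\<forall>x\<in>objs G. unt G x \<in> arrs G \<and> src G (unt G x) = x \<and> tgt G (unt G x) = x) \<and>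
    (\<forall>p\<in>arrs G. mlt G (unt G (tgt G p)) p = p \<and> mlt G p (unt G (src G p)) = p) \<and>
    (\<forall>p\<in>arrs G. ginv G p \<in> arrs G \<and> src G (ginv G p) = tgt G p \<and> tgt G (ginv G p) = src G p \<and>
       mlt G p (ginv G p) = unt G (tgt G p) \<and> mlt G (ginv G p) p = unt G (src G p))"

definition gpd_functor ::
  "('p, 'x) gpd \<Rightarrow> ('q, 'y) gpd \<Rightarrow> ('p \<Rightarrow> 'q) \<Rightarrow> ('x \<Rightarrow> 'y) \<Rightarrow> bool"
  where "gpd_functor G H F F0 \<longleftrightarrow>
    (\<forall>x\<in>objs G. F0 x \<in> objs H) \<and>
    (\<forall>p\<in>arrs G. F p \<in> arrs H \<and> src H (F p) = F0 (src G p) \<and> tgt H (F p) = F0 (tgt G p)) \<and>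
    (\<forall>x\<in>objs G. F (unt G x) = unt H (F0 x)) \<and>
    (\<forall>p\<in>arrs G. \<forall>q\<in>arrs G. src G p = tgt G q \<longrightarrow> F (mlt G p q) = mlt H (F p) (F q))"

definition composable :: "'p mfd \<Rightarrow> 'x mfd \<Rightarrow> ('p, 'x) gpd \<Rightarrow> ('p \<times> 'p) mfd"
  where "composable P X G = fibre_product P P X (src G) (tgt G)"

definition lie_groupoid :: "'p mfd \<Rightarrow> 'x mfd \<Rightarrow> ('p, 'x) gpd \<Rightarrow> bool"
  where "lie_groupoid P X G \<longleftrightarrow>
    smooth_manifold P \<and> smooth_manifold X \<and>
    groupoid G \<and> arrs G = pts P \<and> objs G = pts X \<and>
    surjective_submersion P X (src G) \<and> surjective_submersion P X (tgt G) \<and>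
    smooth_map (composable P X G) P (\<lambda>(p, q). mlt G p q) \<and>
    smooth_map X P (unt G) \<and> smooth_map P P (ginv G)"

definition submersion_gpd :: "'x mfd \<Rightarrow> ('x \<Rightarrow> 'm) \<Rightarrow> ('x \<times> 'x, 'x) gpd"
  where "submersion_gpd X \<pi> =
    \<lparr>objs = pts X, arrs = {(x, y). x \<in> pts X \<and> y \<in> pts X \<and> \<pi> x = \<pi> y},
     src = snd, tgt = fst, mlt = (\<lambda>(x, y) (y', z). (x, z)),
     unt = (\<lambda>x. (x, x)), ginv = (\<lambda>(x, y). (y, x))\<rparr>"

text \<open>
  The tangent groupoid \<open>TP \<rightrightarrows> TX\<close>, with tangent vectors paired with their base points.  The product of
  \<open>(p, v)\<close> and \<open>(q, w)\<close> is the image under the tangent of the multiplication of the unique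
  vector tangent to the manifold of composable pairs with components \<open>v\<close> and \<open>w\<close>.
\<close>

definition tangent_gpd ::
  "'p mfd \<Rightarrow> 'x mfd \<Rightarrow> ('p, 'x) gpd \<Rightarrow> ('p \<times> 'p tvec, 'x \<times> 'x tvec) gpd"
  where "tangent_gpd P X G =
    \<lparr>objs = Sigma (pts X) (tangent X), arrs = Sigma (pts P) (tangent P),
     src = (\<lambda>(p, v). (src G p, dmap X (src G) p v)),
     tgt = (\<lambda>(p, v). (tgt G p, dmap X (tgt G) p v)),
     mlt = (\<lambda>(p, v) (q, w). (mlt G p q, dmap P (\<lambda>(p', q'). mlt G p' q') (p, q)
        (THE u. u \<in> tangent (composable P X G) (p, q) \<and>
           dmap P fst (p, q) u = v \<and> dmap P snd (p, q) u = w))),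
     unt = (\<lambda>(x, v). (unt G x, dmap P (unt G) x v)),
     ginv = (\<lambda>(p, v). (ginv G p, dmap P (ginv G) p v))\<rparr>"

definition multiplicative_vfields ::
  "'p mfd \<Rightarrow> 'x mfd \<Rightarrow> ('p, 'x) gpd \<Rightarrow> ('x vfield \<times> 'p vfield) set"
  where "multiplicative_vfields P X G = {(x, p). x \<in> vfields X \<and> p \<in> vfields P \<and>
    gpd_functor G (tangent_gpd P X G) (\<lambda>q. (q, p q)) (\<lambda>y. (y, x y))}"

definition algebroid_sections :: "'p mfd \<Rightarrow> 'x mfd \<Rightarrow> ('p, 'x) gpd \<Rightarrow> ('x \<Rightarrow> 'p tvec) set"
  where "algebroid_sections P X G =
    {a \<in> vfields_along X P (unt G). \<forall>y\<in>pts X. dmap X (src G) (unt G y) (a y) = 0}"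

text \<open>
  Right translation \<open>R\<^sub>p(q) = qp\<close> and \<open>(L\<^sub>p \<circ> i)(q) = pq\<^sup>-\<^sup>1\<close> are defined on source fibres only.  An element
  of \<open>ker ds\<close> at the unit \<open>\<epsilon>(y)\<close> is therefore first regarded as tangent to the fibre \<open>s\<^sup>-\<^sup>1(y)\<close>.
\<close>

definition source_fibre :: "'p mfd \<Rightarrow> 'x mfd \<Rightarrow> ('p, 'x) gpd \<Rightarrow> 'x \<Rightarrow> 'p mfd"
  where "source_fibre P X G y = submfd P {q \<in> pts P. src G q = y} (mdim P - mdim X)"

definition fibre_vec :: "'p mfd \<Rightarrow> 'x mfd \<Rightarrow> ('p, 'x) gpd \<Rightarrow> 'x \<Rightarrow> 'p tvec \<Rightarrow> 'p tvec"
  where "fibre_vec P X G y v =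
    (THE u. u \<in> tangent (source_fibre P X G y) (unt G y) \<and> dmap P (\<lambda>q. q) (unt G y) u = v)"

definition right_field :: "'p mfd \<Rightarrow> 'x mfd \<Rightarrow> ('p, 'x) gpd \<Rightarrow> ('x \<Rightarrow> 'p tvec) \<Rightarrow> 'p vfield"
  where "right_field P X G a = (\<lambda>p. if p \<in> pts P then
    dmap P (\<lambda>q. mlt G q p) (unt G (tgt G p)) (fibre_vec P X G (tgt G p) (a (tgt G p))) else 0)"

definition left_field :: "'p mfd \<Rightarrow> 'x mfd \<Rightarrow> ('p, 'x) gpd \<Rightarrow> ('x \<Rightarrow> 'p tvec) \<Rightarrow> 'p vfield"
  where "left_field P X G a = (\<lambda>p. if p \<in> pts P then
    dmap P (\<lambda>q. mlt G p (ginv G q)) (unt G (src G p)) (fibre_vec P X G (src G p) (a (src G p))) else 0)"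

definition anchor :: "'x mfd \<Rightarrow> ('p, 'x) gpd \<Rightarrow> ('x \<Rightarrow> 'p tvec) \<Rightarrow> 'x vfield"
  where "anchor X G a = (\<lambda>y. if y \<in> pts X then dmap X (tgt G) (unt G y) (a y) else 0)"


section \<open>Bundle gerbes\<close>

definition principal_circle_bundle ::
  "'p mfd \<Rightarrow> 'y mfd \<Rightarrow> ('p \<Rightarrow> 'y) \<Rightarrow> (complex \<Rightarrow> 'p \<Rightarrow> 'p) \<Rightarrow> bool"
  where "principal_circle_bundle P Y pr act \<longleftrightarrow>
    smooth_map P Y pr \<and> smooth_map (prod_mfd circle P) P (\<lambda>(z, p). act z p) \<and>
    (\<forall>p\<in>pts P. act 1 p = p) \<and>
    (\<forall>z\<in>pts circle. \<forall>w\<in>pts circle. \<forall>p\<in>pts P. act z (act w p) = act (z * w) p) \<and>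
    (\<forall>z\<in>pts circle. \<forall>p\<in>pts P. pr (act z p) = pr p) \<and>
    (\<forall>y\<in>pts Y. \<exists>V \<theta>. openin (mtop Y) V \<and> y \<in> V \<and>
       diffeomorphism (open_submfd P {p \<in> pts P. pr p \<in> V}) (prod_mfd (open_submfd Y V) circle)
         (\<lambda>p. (pr p, \<theta> p)) \<and>
       (\<forall>p\<in>pts P. pr p \<in> V \<longrightarrow> (\<forall>z\<in>pts circle. \<theta> (act z p) = z * \<theta> p)))"

record ('m, 'x, 'p) gerbe =
  gM :: "'m mfd"
  gX :: "'x mfd"
  gP :: "'p mfd"
  gproj :: "'x \<Rightarrow> 'm"
  ggpd :: "('p, 'x) gpd"
  gmor :: "'p \<Rightarrow> 'x \<times> 'x"
  gact :: "complex \<Rightarrow> 'p \<Rightarrow> 'p"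

definition bundle_gerbe :: "('m, 'x, 'p) gerbe \<Rightarrow> bool"
  where "bundle_gerbe \<G> \<longleftrightarrow>
    (let M = gM \<G>; X = gX \<G>; P = gP \<G>; \<pi> = gproj \<G>; G = ggpd \<G>; act = gact \<G>;
         XX = fibre_product X X M \<pi> \<pi>
     in smooth_manifold M \<and> smooth_manifold X \<and> surjective_submersion X M \<pi> \<and>
        lie_groupoid P X G \<and>
        gpd_functor G (submersion_gpd X \<pi>) (gmor \<G>) (\<lambda>y. y) \<and> smooth_map P XX (gmor \<G>) \<and>
        principal_circle_bundle P XX (gmor \<G>) act \<and>
        (\<forall>z\<in>pts circle. \<forall>w\<in>pts circle. \<forall>p\<in>pts P. \<forall>q\<in>pts P. src G p = tgt G q \<longrightarrow>
           mlt G (act z p) (act w q) = act (z * w) (mlt G p q)))"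

definition simplicial_diff_fun :: "('m, 'x, 'p) gerbe \<Rightarrow> ('x \<Rightarrow> real) \<Rightarrow> 'p \<Rightarrow> real"
  where "simplicial_diff_fun \<G> g =
    pullback_fun (gP \<G>) (src (ggpd \<G>)) g - pullback_fun (gP \<G>) (tgt (ggpd \<G>)) g"

definition simplicial_diff_X :: "('m, 'x, 'p) gerbe \<Rightarrow> 'x form \<Rightarrow> 'p form"
  where "simplicial_diff_X \<G> \<omega> =
    pullback (gP \<G>) (gX \<G>) (src (ggpd \<G>)) \<omega> - pullback (gP \<G>) (gX \<G>) (tgt (ggpd \<G>)) \<omega>"

definition simplicial_diff_P :: "('m, 'x, 'p) gerbe \<Rightarrow> 'p form \<Rightarrow> ('p \<times> 'p) form"
  where "simplicial_diff_P \<G> \<omega> =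
    (let P = gP \<G>; P2 = composable P (gX \<G>) (ggpd \<G>)
     in pullback P2 P fst \<omega> - pullback P2 P (\<lambda>(p, q). mlt (ggpd \<G>) p q) \<omega> + pullback P2 P snd \<omega>)"

text \<open>
  The Lie algebra of \<open>S\<^sup>1\<close> is identified with \<open>\<real>\<close> so that the exponential map is \<^const>\<open>cis\<close>.
\<close>

definition principal_connection :: "'p mfd \<Rightarrow> (complex \<Rightarrow> 'p \<Rightarrow> 'p) \<Rightarrow> 'p form \<Rightarrow> bool"
  where "principal_connection P act \<gamma> \<longleftrightarrow>
    \<gamma> \<in> forms P 1 \<and>
    (\<forall>z\<in>pts circle. pullback P P (act z) \<gamma> = \<gamma>) \<and>
    (\<forall>p\<in>pts P. \<gamma> p [velocity P (\<lambda>t. act (cis t) p)] = 1)"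

definition gerbe_connection :: "('m, 'x, 'p) gerbe \<Rightarrow> 'p form \<Rightarrow> bool"
  where "gerbe_connection \<G> \<gamma> \<longleftrightarrow>
    principal_connection (gP \<G>) (gact \<G>) \<gamma> \<and> simplicial_diff_P \<G> \<gamma> = 0"

definition curving :: "('m, 'x, 'p) gerbe \<Rightarrow> 'p form \<Rightarrow> 'x form \<Rightarrow> bool"
  where "curving \<G> \<gamma> B \<longleftrightarrow>
    B \<in> forms (gX \<G>) 2 \<and> simplicial_diff_X \<G> B = ext_deriv (gP \<G>) 1 \<gamma>"

definition three_curvature :: "('m, 'x, 'p) gerbe \<Rightarrow> 'x form \<Rightarrow> 'm form \<Rightarrow> bool"
  where "three_curvature \<G> B H \<longleftrightarrow>
    H \<in> forms (gM \<G>) 3 \<and> pullback (gX \<G>) (gM \<G>) (gproj \<G>) H = ext_deriv (gX \<G>) 2 B"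


section \<open>Lie 2-algebras and butterflies\<close>

text \<open>
  These records hold the structure maps.  Composition and isomorphism of butterflies refer to the
  structure maps only, so the equational and exactness axioms do not enter below.
  Vector spaces are given by \<^type>\<open>module\<close> records; their multiplicative fields are irrelevant.
  \<open>br01\<close> is the bracket \<open>V\<^sub>0 \<times> V\<^sub>1 \<rightarrow> V\<^sub>1\<close>.
\<close>

record ('v1, 'v0) lie2 =
  deg1 :: "(real, 'v1) module"
  deg0 :: "(real, 'v0) module"
  bdry :: "'v1 \<Rightarrow> 'v0"
  br0 :: "'v0 \<Rightarrow> 'v0 \<Rightarrow> 'v0"
  br01 :: "'v0 \<Rightarrow> 'v1 \<Rightarrow> 'v1"
  jac :: "'v0 \<Rightarrow> 'v0 \<Rightarrow> 'v0 \<Rightarrow> 'v1"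

record ('v1, 'v0, 'w1, 'w0) lie2_mor =
  mor0 :: "'v0 \<Rightarrow> 'w0"
  mor1 :: "'v1 \<Rightarrow> 'w1"
  mor2 :: "'v0 \<Rightarrow> 'v0 \<Rightarrow> 'w1"

record ('e, 'v1, 'v0, 'w1, 'w0) bfly =
  bspace :: "(real, 'e) module"
  bbr :: "'e \<Rightarrow> 'e \<Rightarrow> 'e"
  bkappa :: "'v1 \<Rightarrow> 'e"
  blambda :: "'w1 \<Rightarrow> 'e"
  bsigma :: "'e \<Rightarrow> 'v0"
  brho :: "'e \<Rightarrow> 'w0"

definition mk_space :: "'a set \<Rightarrow> 'a \<Rightarrow> ('a \<Rightarrow> 'a \<Rightarrow> 'a) \<Rightarrow> (real \<Rightarrow> 'a \<Rightarrow> 'a) \<Rightarrow> (real, 'a) module"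
  where "mk_space C z ad sm =
    \<lparr>carrier = C, mult = undefined, one = undefined, zero = z, add = ad, smult = sm\<rparr>"

definition subspace_module :: "'a::real_vector set \<Rightarrow> (real, 'a) module"
  where "subspace_module S = mk_space S 0 (+) (*\<^sub>R)"

definition direct_sum :: "(real, 'a) module \<Rightarrow> (real, 'b) module \<Rightarrow> (real, 'a \<times> 'b) module"
  where "direct_sum A B = mk_space (carrier A \<times> carrier B) (\<zero>\<^bsub>A\<^esub>, \<zero>\<^bsub>B\<^esub>)
    (\<lambda>(a, b) (a', b'). (a \<oplus>\<^bsub>A\<^esub> a', b \<oplus>\<^bsub>B\<^esub> b')) (\<lambda>r (a, b). (r \<odot>\<^bsub>A\<^esub> a, r \<odot>\<^bsub>B\<^esub> b))"

definition quotient_space :: "(real, 'a) module \<Rightarrow> 'a set \<Rightarrow> (real, 'a set) module"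
  where "quotient_space A K = mk_space (a_rcosets\<^bsub>A\<^esub> K) K (set_add A)
    (\<lambda>r S. \<Union>a\<in>S. K +>\<^bsub>A\<^esub> (r \<odot>\<^bsub>A\<^esub> a))"

definition butterfly_of_morphism ::
  "('v1, 'v0) lie2 \<Rightarrow> ('w1, 'w0) lie2 \<Rightarrow> ('v1, 'v0, 'w1, 'w0) lie2_mor \<Rightarrow>
   ('w1 \<times> 'v0, 'v1, 'v0, 'w1, 'w0) bfly"
  where "butterfly_of_morphism V W f =
    (let W1 = deg1 W in
     \<lparr>bspace = direct_sum W1 (deg0 V),
      bbr = (\<lambda>(w, x) (w', x').
        ((br01 W (mor0 f x) w' \<ominus>\<^bsub>W1\<^esub> br01 W (mor0 f x') w) \<oplus>\<^bsub>W1\<^esub> br01 W (bdry W w) w'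
           \<ominus>\<^bsub>W1\<^esub> mor2 f x x',
         br0 V x x')),
      bkappa = (\<lambda>v. (\<ominus>\<^bsub>W1\<^esub> mor1 f v, bdry V v)),
      blambda = (\<lambda>w. (w, \<zero>\<^bsub>deg0 V\<^esub>)),
      bsigma = (\<lambda>(w, x). x),
      brho = (\<lambda>(w, x). bdry W w \<oplus>\<^bsub>deg0 W\<^esub> mor0 f x)\<rparr>)"

definition butterfly_fibre_product ::
  "('e, 'v1, 'v0, 'w1, 'w0) bfly \<Rightarrow> ('f, 'w1, 'w0, 'u1, 'u0) bfly \<Rightarrow> (real, 'e \<times> 'f) module"
  where "butterfly_fibre_product E E' = (direct_sum (bspace E) (bspace E'))
    \<lparr>carrier := {(e, e'). e \<in> carrier (bspace E) \<and> e' \<in> carrier (bspace E') \<and> brho E e = bsigma E' e'}\<rparr>"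

text \<open>\<open>butterfly_compose V W U E E'\<close> is the composite of \<open>E : V \<dashrightarrow> W\<close> followed by \<open>E' : W \<dashrightarrow> U\<close>.\<close>

definition butterfly_compose ::
  "('v1, 'v0) lie2 \<Rightarrow> ('w1, 'w0) lie2 \<Rightarrow> ('u1, 'u0) lie2 \<Rightarrow>
   ('e, 'v1, 'v0, 'w1, 'w0) bfly \<Rightarrow> ('f, 'w1, 'w0, 'u1, 'u0) bfly \<Rightarrow>
   (('e \<times> 'f) set, 'v1, 'v0, 'u1, 'u0) bfly"
  where "butterfly_compose V W U E E' =
    (let F = butterfly_fibre_product E E';
         K = (\<lambda>w. (blambda E w, bkappa E' w)) ` carrier (deg1 W)
     in \<lparr>bspace = quotient_space F K,
         bbr = (\<lambda>S T. \<Union>(e, e')\<in>S. \<Union>(d, d')\<in>T. K +>\<^bsub>F\<^esub> (bbr E e d, bbr E' e' d')),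
         bkappa = (\<lambda>v. K +>\<^bsub>F\<^esub> (bkappa E v, \<zero>\<^bsub>bspace E'\<^esub>)),
         blambda = (\<lambda>u. K +>\<^bsub>F\<^esub> (\<zero>\<^bsub>bspace E\<^esub>, blambda E' u)),
         bsigma = (\<lambda>S. the_elem ((\<lambda>(e, e'). bsigma E e) ` S)),
         brho = (\<lambda>S. the_elem ((\<lambda>(e, e'). brho E' e') ` S))\<rparr>)"

definition butterfly_iso ::
  "('v1, 'v0) lie2 \<Rightarrow> ('w1, 'w0) lie2 \<Rightarrow> ('e, 'v1, 'v0, 'w1, 'w0) bfly \<Rightarrow>
   ('f, 'v1, 'v0, 'w1, 'w0) bfly \<Rightarrow> ('e \<Rightarrow> 'f) \<Rightarrow> bool"
  where "butterfly_iso V W E E' \<Phi> \<longleftrightarrow>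
    (let A = bspace E; A' = bspace E' in
     bij_betw \<Phi> (carrier A) (carrier A') \<and>
     (\<forall>e\<in>carrier A. \<forall>d\<in>carrier A. \<Phi> (e \<oplus>\<^bsub>A\<^esub> d) = \<Phi> e \<oplus>\<^bsub>A'\<^esub> \<Phi> d) \<and>
     (\<forall>r. \<forall>e\<in>carrier A. \<Phi> (r \<odot>\<^bsub>A\<^esub> e) = r \<odot>\<^bsub>A'\<^esub> \<Phi> e) \<and>
     (\<forall>e\<in>carrier A. \<forall>d\<in>carrier A. \<Phi> (bbr E e d) = bbr E' (\<Phi> e) (\<Phi> d)) \<and>
     (\<forall>v\<in>carrier (deg1 V). \<Phi> (bkappa E v) = bkappa E' v) \<and>
     (\<forall>w\<in>carrier (deg1 W). \<Phi> (blambda E w) = blambda E' w) \<and>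
     (\<forall>e\<in>carrier A. bsigma E' (\<Phi> e) = bsigma E e \<and> brho E' (\<Phi> e) = brho E e))"


section \<open>The Lie 2-algebras and butterflies attached to a gerbe\<close>

definition atiyah :: "'m mfd \<Rightarrow> 'm form \<Rightarrow> ('m \<Rightarrow> real, 'm vfield) lie2"
  where "atiyah M H =
    \<lparr>deg1 = subspace_module (smooth_functions M), deg0 = subspace_module (vfields M),
     bdry = (\<lambda>f. 0), br0 = lie_bracket M, br01 = lie_deriv,
     jac = (\<lambda>x1 x2 x3. - form0_fun (contract x3 (contract x2 (contract x1 H))))\<rparr>"

definition id_shift :: "'m form \<Rightarrow> ('m \<Rightarrow> real, 'm vfield, 'm \<Rightarrow> real, 'm vfield) lie2_mor"
  where "id_shift \<tau> =
    \<lparr>mor0 = (\<lambda>x. x), mor1 = (\<lambda>f. f), mor2 = (\<lambda>x1 x2. form0_fun (contract x2 (contract x1 \<tau>)))\<rparr>"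

definition gerbe_lie2 :: "('m, 'x, 'p) gerbe \<Rightarrow> ('x \<Rightarrow> 'p tvec, 'x vfield \<times> 'p vfield) lie2"
  where "gerbe_lie2 \<G> =
    (let P = gP \<G>; X = gX \<G>; G = ggpd \<G> in
     \<lparr>deg1 = subspace_module (algebroid_sections P X G),
      deg0 = subspace_module (multiplicative_vfields P X G),
      bdry = (\<lambda>a. (anchor X G a, right_field P X G a + left_field P X G a)),
      br0 = (\<lambda>(x, p) (z, r). (lie_bracket X x z, lie_bracket P p r)),
      br01 = (\<lambda>(x, p) a y. if y \<in> pts X then lie_bracket P p (right_field P X G a) (unt G y) else 0),
      jac = (\<lambda>_ _ _. 0)\<rparr>)"

definition projected_vfield :: "('m, 'x, 'p) gerbe \<Rightarrow> 'x vfield \<Rightarrow> 'm vfield"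
  where "projected_vfield \<G> x =
    (THE x'. x' \<in> vfields (gM \<G>) \<and>
       (\<forall>y\<in>pts (gX \<G>). dmap (gM \<G>) (gproj \<G>) y (x y) = x' (gproj \<G> y)))"

definition vert_fun :: "('m, 'x, 'p) gerbe \<Rightarrow> 'p form \<Rightarrow> ('x \<Rightarrow> 'p tvec) \<Rightarrow> 'x \<Rightarrow> real"
  where "vert_fun \<G> \<gamma> a = pullback_fun (gX \<G>) (unt (ggpd \<G>))
    (form0_fun (contract (right_field (gP \<G>) (gX \<G>) (ggpd \<G>) a) \<gamma>))"

definition gerbe_butterfly ::
  "('m, 'x, 'p) gerbe \<Rightarrow> 'p form \<Rightarrow> 'x form \<Rightarrow>
   ('x vfield \<times> 'p vfield \<times> ('x \<Rightarrow> real), 'x \<Rightarrow> 'p tvec, 'x vfield \<times> 'p vfield,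
    'm \<Rightarrow> real, 'm vfield) bfly"
  where "gerbe_butterfly \<G> \<gamma> B =
    (let P = gP \<G>; X = gX \<G>; G = ggpd \<G> in
     \<lparr>bspace = subspace_module {(x, p, g). (x, p) \<in> multiplicative_vfields P X G \<and>
        g \<in> smooth_functions X \<and> simplicial_diff_fun \<G> g = form0_fun (contract p \<gamma>)},
      bbr = (\<lambda>(x, p, g) (z, r, h). (lie_bracket X x z, lie_bracket P p r,
        lie_deriv x h - lie_deriv z g - form0_fun (contract z (contract x B)))),
      bkappa = (\<lambda>a. (anchor X G a, right_field P X G a + left_field P X G a, - vert_fun \<G> \<gamma> a)),
      blambda = (\<lambda>f. (0, 0, pullback_fun X (gproj \<G>) f)),
      bsigma = (\<lambda>(x, p, g). (x, p)),
      brho = (\<lambda>(x, p, g). projected_vfield \<G> x)\<rparr>)"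

end

theory Submission
  imports Defs
begin

text \<open>
  An element of \<open>id\<^sub>\<tau> \<circ> G\<close> is represented by \<open>((x, p, g), (f, v))\<close> with \<open>v\<close> the projection of \<open>x\<close>, modulo
  \<open>((0, 0, \<pi>\<^sup>*w), (-w, 0))\<close>, and the isomorphism sends it to \<open>(x, p, g + \<pi>\<^sup>*f)\<close>.  The bracket is
  preserved because \<open>x(\<pi>\<^sup>*f) = \<pi>\<^sup>*(v f)\<close>, the two terms \<open>\<tau>(v, v')\<close> and \<open>\<pi>\<^sup>*\<tau>(x, x')\<close> cancelling the difference
  of \<open>B\<close> and \<open>B'\<close>.  Surjectivity needs that a multiplicative vector field projects to a smooth vector
  field on \<open>M\<close>: any two points of a fibre of \<open>\<pi>\<close> are joined by an arrow of \<open>P\<close>, so the projection is well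
  defined pointwise, and it is smooth since \<open>\<pi>\<close> has smooth local sections.  These sections are built
  from a scalar implicit function theorem by straightening one coordinate of \<open>\<pi>\<close> at a time.
\<close>

section \<open>Functions of class \<open>C\<^sup>k\<close> on open subsets of \<open>\<real>\<^sup>n\<close>\<close>

text \<open>Three encodings shape the argument. Smoothness on \<open>Rn n\<close> means iterated
  partial derivatives of functions of sequences, so the calculus is built from one-variable facts:
  boxes, mean values along one coordinate, and a strictly monotone equation solved by intermediate
  values. Tangent vectors are velocities of curves acting on functions, with default value 0 on
  functions that are not smooth at the base point; identities between them therefore carry
  smoothness conditions, while surjectivity of d\<pi> hands back a curve whose coordinate velocities
  form a column of a right inverse of the Jacobian. The projection of a multiplicative field is a
  definite description, so \<open>brho\<close> has no usable value until a smooth projection is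
  known to exist uniquely; both the bracket and surjectivity depend on this. Finally, the arrow
  between two points of a fibre comes from the inverse of a local trivialization, whose value is
  controlled only at points of the underlying topological space; this is why the topology of a
  trivial circle bundle is computed explicitly.\<close>

abbreviation Rn :: "nat \<Rightarrow> (nat \<Rightarrow> real) set"
  where "Rn n \<equiv> {u. \<forall>i\<ge>n. u i = 0}"

section \<open>Topology of R^n through coordinate boxes\<close>

lemma openin_Rn_iff: "openin (Euclidean_space n) S \<longleftrightarrow> (\<exists>T. open T \<and> S = T \<inter> Rn n)"
  by (simp add: Euclidean_space_def openin_subtopology euclidean_product_topology)

lemma openin_Rn_subset: "openin (Euclidean_space n) S \<Longrightarrow> S \<subseteq> Rn n"
  by (auto simp: openin_Rn_iff)

lemma openin_Rn_Rn: "openin (Euclidean_space n) (Rn n)"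
  using openin_topspace[of "Euclidean_space n"] by (simp add: topspace_Euclidean_space)

lemma continuous_map_Rn_iff:
  assumes "S \<subseteq> Rn n"
  shows "continuous_map (subtopology (Euclidean_space n) S) euclideanreal f \<longleftrightarrow> continuous_on S f"
proof -
  have "subtopology (Euclidean_space n) S = top_of_set S"
    using assms
    by (simp add: Euclidean_space_def euclidean_product_topology subtopology_subtopology Int_absorb1)
  then show ?thesis by simp
qed

lemma openin_Rn_vimage:
  assumes "open T" "continuous_on (Rn n) g"
  shows "openin (Euclidean_space n) {u \<in> Rn n. g u \<in> T}"
proof -
  obtain A where "open A" "A \<inter> Rn n = g -` T \<inter> Rn n"
    using continuous_on_open_invariant[THEN iffD1, rule_format, OF assms(2,1)] by blast
  then show ?thesis unfolding openin_Rn_iff by (intro exI[of _ A]) auto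
qed

lemma openin_Rn_preimage:
  assumes S: "openin (Euclidean_space n) S" and g: "continuous_on S g" and T: "open T"
  shows "openin (Euclidean_space n) {u \<in> S. g u \<in> T}"
proof -
  obtain A where A: "open A" "A \<inter> S = g -` T \<inter> S"
    using continuous_on_open_invariant[THEN iffD1, rule_format, OF g T] by blast
  obtain B where B: "open B" "S = B \<inter> Rn n"
    using S by (auto simp: openin_Rn_iff)
  have "{u \<in> S. g u \<in> T} = (A \<inter> B) \<inter> Rn n" using A B by auto
  then show ?thesis using A B unfolding openin_Rn_iff by blast
qed

lemma continuous_on_coordinate [continuous_intros]:
  "continuous_on S (\<lambda>u. u i :: 'b::topological_space)"
  by (rule continuous_on_subset[OF continuous_on_product_coordinates]) simp

lemma openin_Rn_box:
  "openin (Euclidean_space n) {v \<in> Rn n. \<forall>i<n. \<bar>v i - u i\<bar> < r}"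
proof -
  have "open {v::nat\<Rightarrow>real. \<forall>i<n. \<bar>v i - u i\<bar> < r}"
  proof -
    have "open (\<Inter>i<n. {v::nat\<Rightarrow>real. \<bar>v i - u i\<bar> < r})"
      by (intro open_INT ballI open_Collect_less continuous_intros finite_lessThan)
    also have "(\<Inter>i<n. {v::nat\<Rightarrow>real. \<bar>v i - u i\<bar> < r}) = {v. \<forall>i<n. \<bar>v i - u i\<bar> < r}"
      by auto
    finally show ?thesis .
  qed
  then show ?thesis unfolding openin_Rn_iff by blast
qed

text \<open>Points of \<open>Rn n\<close> agree from coordinate n on, so only finitely many of the
  radii supplied by the product topology matter and their minimum is positive. These boxes play the
  role of metric balls in all later epsilon arguments.\<close>

lemma openin_Rn_contains_box:
  assumes "openin (Euclidean_space n) S" "u \<in> S"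
  obtains r where "r > 0" "\<And>v. v \<in> Rn n \<Longrightarrow> (\<And>i. i < n \<Longrightarrow> \<bar>v i - u i\<bar> < r) \<Longrightarrow> v \<in> S"
proof -
  obtain T where T: "open T" "S = T \<inter> Rn n"
    using assms by (auto simp: openin_Rn_iff)
  then have "openin (product_topology (\<lambda>i::nat. euclideanreal) UNIV) T"
    by (simp add: euclidean_product_topology)
  from product_topology_open_contains_basis[OF this, of u]
  obtain X where X: "u \<in> Pi\<^sub>E UNIV X" "\<And>i. open (X i)" "Pi\<^sub>E UNIV X \<subseteq> T"
    using assms T by auto
  have "\<forall>i. \<exists>e>0. \<forall>t. \<bar>t - u i\<bar> < e \<longrightarrow> t \<in> X i"
  proof
    fix i
    show "\<exists>e>0. \<forall>t. \<bar>t - u i\<bar> < e \<longrightarrow> t \<in> X i"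
      using X(1,2) by (auto simp: open_dist dist_real_def)
  qed
  then obtain e where e: "\<And>i. e i > 0" "\<And>i t. \<bar>t - u i\<bar> < e i \<Longrightarrow> t \<in> X i"
    by metis
  \<comment> \<open>The inserted 1 keeps the set nonempty when n = 0.\<close>
  define r where "r = Min (insert 1 (e ` {..<n}))"
  have r: "r > 0" "\<And>i. i < n \<Longrightarrow> r \<le> e i" using e by (auto simp: r_def)
  have "v \<in> S" if "v \<in> Rn n" "\<And>i. i < n \<Longrightarrow> \<bar>v i - u i\<bar> < r" for v
  proof -
    have "v i \<in> X i" for i
    proof (cases "i < n")
      case True then show ?thesis using e that r by (meson less_le_trans)
    next
      case False
      then have "v i = u i" using that assms T by auto
      then show ?thesis using X by auto
    qed
    then show ?thesis using X(3) T that(1) by auto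
  qed
  then show thesis using r that by blast
qed

lemma continuous_on_Rn_boxD:
  assumes S: "openin (Euclidean_space n) S" and f: "continuous_on S f" and u: "u \<in> S" and "e > 0"
  obtains r where "r > 0"
    "\<And>v. v \<in> Rn n \<Longrightarrow> (\<And>i. i < n \<Longrightarrow> \<bar>v i - u i\<bar> < r) \<Longrightarrow> v \<in> S \<and> \<bar>f v - f u :: real\<bar> < e"
proof -
  have "openin (Euclidean_space n) {v \<in> S. f v \<in> {f u - e<..<f u + e}}"
    by (rule openin_Rn_preimage[OF S f]) simp
  from openin_Rn_contains_box[OF this, of u] u \<open>e > 0\<close>
  obtain r where "r > 0" "\<And>v. v \<in> Rn n \<Longrightarrow> (\<And>i. i < n \<Longrightarrow> \<bar>v i - u i\<bar> < r) \<Longrightarrow>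
      v \<in> {v \<in> S. f v \<in> {f u - e<..<f u + e}}"
    by auto
  then have "v \<in> S \<and> \<bar>f v - f u\<bar> < e" if "v \<in> Rn n" "\<And>i. i < n \<Longrightarrow> \<bar>v i - u i\<bar> < r" for v
    using that by (metis (no_types, lifting) mem_Collect_eq greaterThanLessThan_iff abs_diff_less_iff)
  then show thesis using \<open>r > 0\<close> that by blast
qed

lemma continuous_on_Rn_boxI:
  assumes "S \<subseteq> Rn n"
    and "\<And>u e. u \<in> S \<Longrightarrow> e > 0 \<Longrightarrow>
      \<exists>r>0. \<forall>v\<in>S. (\<forall>i<n. \<bar>v i - u i\<bar> < r) \<longrightarrow> \<bar>f v - f u :: real\<bar> < e"
  shows "continuous_on S f"
  unfolding continuous_on_topological
proof (intro ballI allI impI)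
  fix u B assume u: "u \<in> S" and B: "open B" "f u \<in> B"
  then obtain e where e: "e > 0" "\<And>y. \<bar>y - f u\<bar> < e \<Longrightarrow> y \<in> B"
    by (auto simp: open_dist dist_real_def)
  from assms(2)[OF u e(1)] obtain r where r: "r > 0"
    "\<And>v. v \<in> S \<Longrightarrow> (\<forall>i<n. \<bar>v i - u i\<bar> < r) \<Longrightarrow> \<bar>f v - f u\<bar> < e" by blast
  obtain A where A: "open A" "{v \<in> Rn n. \<forall>i<n. \<bar>v i - u i\<bar> < r} = A \<inter> Rn n"
    using openin_Rn_box[of n u r] by (auto simp: openin_Rn_iff)
  have "u \<in> {v \<in> Rn n. \<forall>i<n. \<bar>v i - u i\<bar> < r}" using u assms(1) r by auto
  then have "u \<in> A" using A(2) by blast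
  moreover have "f v \<in> B" if "v \<in> S" "v \<in> A" for v
  proof -
    have "v \<in> {v \<in> Rn n. \<forall>i<n. \<bar>v i - u i\<bar> < r}" using that A(2) assms(1) by blast
    then show ?thesis using r(2)[OF that(1)] e(2) by auto
  qed
  ultimately show "\<exists>A. open A \<and> u \<in> A \<and> (\<forall>y\<in>S. y \<in> A \<longrightarrow> f y \<in> B)" using A(1) by blast
qed

lemma continuous_on_fun_upd_var:
  "continuous_on S (\<lambda>t. u(i := t) :: 'a \<Rightarrow> 'b::topological_space)"
proof (rule continuous_on_coordinatewise_then_product)
  fix j show "continuous_on S (\<lambda>t. (u(i := t)) j)"
    by (cases "j = i") (simp_all)
qed

lemma openin_Rn_slice:
  assumes "openin (Euclidean_space n) S" "i < n" "u \<in> Rn n"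
  shows "open {t. u(i := t) \<in> S}"
proof -
  obtain T where T: "open T" "S = T \<inter> Rn n"
    using assms by (auto simp: openin_Rn_iff)
  then have "{t. u(i := t) \<in> S} = (\<lambda>t. u(i := t)) -` T" using assms by auto
  then show ?thesis using T continuous_on_fun_upd_var[of UNIV u i]
    by (metis open_vimage)
qed

lemma eventually_slice:
  assumes "openin (Euclidean_space n) S" "i < n" "u \<in> S"
  shows "\<forall>\<^sub>F t in nhds (u i). u(i := t) \<in> S"
proof -
  have "u \<in> Rn n" using assms openin_Rn_subset by blast
  then show ?thesis
    using eventually_nhds_in_open[OF openin_Rn_slice[OF assms(1,2)], of u "u i"] assms(3) by simp
qed

section \<open>Functions of class C^k: locality and closure properties\<close>

lemma Ck_on_continuous: "Ck_on n k S f \<Longrightarrow> openin (Euclidean_space n) S \<Longrightarrow> continuous_on S f"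
  by (cases k) (auto simp: continuous_map_Rn_iff openin_Rn_subset)

lemma Ck_on_Suc_D:
  assumes "Ck_on n (Suc k) S f" "i < n"
  shows "u \<in> S \<Longrightarrow> ((\<lambda>t. f (u(i := t))) has_field_derivative partial_deriv i f u) (at (u i))"
    and "Ck_on n k S (partial_deriv i f)"
  using assms by (auto simp: partial_deriv_def DERIV_deriv_iff_field_differentiable)

text \<open>Since \<open>S\<close> is open, a coordinate line through a point of \<open>S\<close>
  stays in \<open>S\<close> for nearby parameters, so agreement on \<open>S\<close> passes to the
  partial derivatives and the induction can continue with them.\<close>

lemma Ck_on_cong:
  assumes "openin (Euclidean_space n) S" "\<And>u. u \<in> S \<Longrightarrow> f u = g u" "Ck_on n k S f"
  shows "Ck_on n k S g"
  using assms(2,3)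
proof (induction k arbitrary: f g)
  case 0
  then show ?case using openin_Rn_subset[OF assms(1)]
    by (auto simp: continuous_map_Rn_iff cong: continuous_on_cong)
next
  case (Suc k)
  have eq: "\<forall>\<^sub>F t in nhds (u i). f (u(i := t)) = g (u(i := t))" if "u \<in> S" "i < n" for u i
    using eventually_slice[OF assms(1) that(2,1)] by eventually_elim (use Suc in auto)
  have pd: "partial_deriv i f u = partial_deriv i g u" if "u \<in> S" "i < n" for u i
    unfolding partial_deriv_def by (rule deriv_cong_ev[OF eq[OF that] refl])
  show ?case unfolding Ck_on.simps
  proof (intro conjI allI impI ballI)
    show "continuous_map (subtopology (Euclidean_space n) S) euclideanreal g"
      using Suc.prems openin_Rn_subset[OF assms(1)]
      by (auto simp: continuous_map_Rn_iff cong: continuous_on_cong)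
  next
    fix i u assume "i < n" "u \<in> S"
    then have "(\<lambda>t. f (u(i := t))) field_differentiable at (u i)" using Suc.prems by auto
    then show "(\<lambda>t. g (u(i := t))) field_differentiable at (u i)"
      unfolding field_differentiable_def
      using DERIV_cong_ev[OF refl eq[OF \<open>u \<in> S\<close> \<open>i < n\<close>] refl] by blast
  next
    fix i assume "i < n"
    then show "Ck_on n k S (partial_deriv i g)"
      using Suc.IH[of "partial_deriv i f" "partial_deriv i g"] pd Suc.prems by auto
  qed
qed

text \<open>Lets an explicit formula \<open>D\<close>, correct on \<open>S\<close> only, stand in
  for \<open>partial_deriv\<close>; every closure property below is an induction through this
  rule.\<close>

lemma Ck_on_SucI:
  assumes S: "openin (Euclidean_space n) S" and "continuous_on S f"
    and "\<And>i u. i < n \<Longrightarrow> u \<in> S \<Longrightarrow> ((\<lambda>t. f (u(i := t))) has_field_derivative D i u) (at (u i))"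
    and "\<And>i. i < n \<Longrightarrow> Ck_on n k S (D i)"
  shows "Ck_on n (Suc k) S f"
  unfolding Ck_on.simps
proof (intro conjI allI impI ballI)
  show "continuous_map (subtopology (Euclidean_space n) S) euclideanreal f"
    using assms by (simp add: continuous_map_Rn_iff openin_Rn_subset)
next
  fix i u assume "i < n" "u \<in> S"
  then show "(\<lambda>t. f (u(i := t))) field_differentiable at (u i)"
    using assms(3) field_differentiable_def by blast
next
  fix i assume "i < n"
  then show "Ck_on n k S (partial_deriv i f)"
    by (intro Ck_on_cong[OF S _ assms(4)])
      (auto simp: partial_deriv_def intro!: DERIV_imp_deriv[symmetric] assms(3))
qed

lemma Ck_on_subset: "Ck_on n k S f \<Longrightarrow> T \<subseteq> S \<Longrightarrow> Ck_on n k T f"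
  by (induction k arbitrary: f) (auto intro: continuous_map_from_subtopology_mono)

lemma Ck_on_Suc_imp: "Ck_on n (Suc k) S f \<Longrightarrow> Ck_on n k S f"
  by (induction k arbitrary: f) auto

lemma Ck_on_local:
  assumes S: "openin (Euclidean_space n) S"
    and "\<And>u. u \<in> S \<Longrightarrow> \<exists>T. openin (Euclidean_space n) T \<and> u \<in> T \<and> Ck_on n k T f"
  shows "Ck_on n k S f"
  using assms(2)
proof (induction k arbitrary: f)
  \<comment> \<open>Continuity is required at every order, so its locality is settled once for
    arbitrary \<open>f\<close> and used in both induction cases.\<close>
  have cont: "continuous_on S f"
    if loc: "\<And>u. u \<in> S \<Longrightarrow> \<exists>T. openin (Euclidean_space n) T \<and> u \<in> T \<and> continuous_on T f" for f :: "_ \<Rightarrow> real"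
  proof (rule continuous_on_Rn_boxI[OF openin_Rn_subset[OF S]])
    fix u and e :: real assume "u \<in> S" "e > 0"
    with loc obtain T where T: "openin (Euclidean_space n) T" "u \<in> T" "continuous_on T f" by blast
    obtain r where "r > 0" "\<And>v. v \<in> Rn n \<Longrightarrow> (\<And>i. i < n \<Longrightarrow> \<bar>v i - u i\<bar> < r) \<Longrightarrow> v \<in> T \<and> \<bar>f v - f u\<bar> < e"
      by (rule continuous_on_Rn_boxD[OF T(1,3,2) \<open>e > 0\<close>]) blast
    then show "\<exists>r>0. \<forall>v\<in>S. (\<forall>i<n. \<bar>v i - u i\<bar> < r) \<longrightarrow> \<bar>f v - f u\<bar> < e"
      using openin_Rn_subset[OF S] by (intro exI[of _ r]) blast
  qed
  {
    case 0
    have "continuous_on S f"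
      by (rule cont) (metis 0 Ck_on_continuous)
    then show ?case using openin_Rn_subset[OF S] by (simp add: continuous_map_Rn_iff)
  next
    case (Suc k)
    have "continuous_on S f"
      by (rule cont) (metis Suc.prems Ck_on_continuous)
    moreover have "Ck_on n k S (partial_deriv i f)" if "i < n" for i
      by (rule Suc.IH) (metis Suc.prems that Ck_on_Suc_D(2))
    moreover have "((\<lambda>t. f (u(i := t))) has_field_derivative partial_deriv i f u) (at (u i))"
      if "i < n" "u \<in> S" for i u
      using Suc.prems[OF that(2)] Ck_on_Suc_D(1)[OF _ that(1)] by blast
    ultimately show ?case
      by (intro Ck_on_SucI[OF S, where D="\<lambda>i. partial_deriv i f"])
  }
qed

lemma Ck_on_const: "openin (Euclidean_space n) S \<Longrightarrow> Ck_on n k S (\<lambda>_. c)"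
proof (induction k arbitrary: c)
  case (Suc k)
  show ?case by (rule Ck_on_SucI[where D="\<lambda>_ _. 0"]) (use Suc in \<open>auto\<close>)
qed simp

lemma Ck_on_coord: 
  assumes "openin (Euclidean_space n) S"
  shows "Ck_on n k S (\<lambda>u. u j)"
proof (cases k)
  case 0
  then show ?thesis using openin_Rn_subset[OF assms]
    by (simp add: continuous_map_Rn_iff continuous_on_coordinate)
next
  case (Suc k')
  have "((\<lambda>t. (u(i := t)) j) has_field_derivative (if i = j then 1 else 0)) (at (u i))" for u :: "nat \<Rightarrow> real" and i
    by (cases "i = j") auto
  then show ?thesis unfolding Suc
    by (intro Ck_on_SucI[where D="\<lambda>i _. if i = j then 1 else 0"] Ck_on_const assms continuous_on_coordinate)
qed

lemma Ck_on_add: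
  assumes "openin (Euclidean_space n) S" "Ck_on n k S f" "Ck_on n k S g"
  shows "Ck_on n k S (\<lambda>u. f u + g u)"
  using assms(2,3)
proof (induction k arbitrary: f g)
  case 0
  then show ?case using openin_Rn_subset[OF assms(1)]
    by (simp add: continuous_map_Rn_iff continuous_on_add)
next
  case (Suc k)
  show ?case
  proof (rule Ck_on_SucI[where D="\<lambda>i u. partial_deriv i f u + partial_deriv i g u"])
    show "continuous_on S (\<lambda>u. f u + g u)"
      by (intro continuous_on_add Ck_on_continuous[OF _ assms(1)]) (fact Suc.prems)+
  next
    fix i u assume i: "i < n" and u: "u \<in> S"
    show "((\<lambda>t. f (u(i := t)) + g (u(i := t))) has_field_derivative
        partial_deriv i f u + partial_deriv i g u) (at (u i))"
      by (rule DERIV_add[OF Ck_on_Suc_D(1)[OF Suc.prems(1) i u] Ck_on_Suc_D(1)[OF Suc.prems(2) i u]])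
  next
    fix i assume "i < n"
    then show "Ck_on n k S (\<lambda>u. partial_deriv i f u + partial_deriv i g u)"
      by (intro Suc.IH Ck_on_Suc_D(2)[OF Suc.prems(1)] Ck_on_Suc_D(2)[OF Suc.prems(2)])
  qed (fact assms)
qed

lemma Ck_on_mult:
  assumes "openin (Euclidean_space n) S" "Ck_on n k S f" "Ck_on n k S g"
  shows "Ck_on n k S (\<lambda>u. f u * g u)"
  using assms(2,3)
proof (induction k arbitrary: f g)
  case 0
  then show ?case using openin_Rn_subset[OF assms(1)]
    by (simp add: continuous_map_Rn_iff continuous_on_mult)
next
  case (Suc k)
  show ?case
  \<comment> \<open>The product rule keeps undifferentiated factors, so the induction hypothesis
    meets \<open>f\<close> and \<open>g\<close> themselves at one order less.\<close>
  proof (rule Ck_on_SucI[where D="\<lambda>i u. partial_deriv i f u * g u + partial_deriv i g u * f u"])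
    show "continuous_on S (\<lambda>u. f u * g u)"
      by (intro continuous_on_mult Ck_on_continuous[OF _ assms(1)]) (fact Suc.prems)+
  next
    fix i u assume i: "i < n" and u: "u \<in> S"
    show "((\<lambda>t. f (u(i := t)) * g (u(i := t))) has_field_derivative
        partial_deriv i f u * g u + partial_deriv i g u * f u) (at (u i))"
      by (rule DERIV_cong[OF DERIV_mult[OF Ck_on_Suc_D(1)[OF Suc.prems(1) i u]
            Ck_on_Suc_D(1)[OF Suc.prems(2) i u]]]) simp
  next
    fix i assume "i < n"
    then show "Ck_on n k S (\<lambda>u. partial_deriv i f u * g u + partial_deriv i g u * f u)"
      by (intro Ck_on_add Suc.IH assms(1) Ck_on_Suc_D(2)[OF Suc.prems(1)]
           Ck_on_Suc_D(2)[OF Suc.prems(2)] Ck_on_Suc_imp[OF Suc.prems(1)] Ck_on_Suc_imp[OF Suc.prems(2)])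
  qed (use assms in auto)
qed

lemma Ck_on_sum:
  assumes "openin (Euclidean_space n) S" "\<And>j. j \<in> J \<Longrightarrow> Ck_on n k S (f j)"
  shows "Ck_on n k S (\<lambda>u. \<Sum>j\<in>J. f j u)"
  using assms(2)
  by (induction J rule: infinite_finite_induct)
    (auto intro: Ck_on_const Ck_on_add assms(1))

lemma Ck_on_inverse:
  assumes "openin (Euclidean_space n) S" "Ck_on n k S f" "\<And>u. u \<in> S \<Longrightarrow> f u \<noteq> 0"
  shows "Ck_on n k S (\<lambda>u. inverse (f u))"
  using assms(2)
proof (induction k)
  case 0
  then show ?case using openin_Rn_subset[OF assms(1)]
    by (simp add: continuous_map_Rn_iff continuous_on_inverse assms(3))
next
  case (Suc k)
  \<comment> \<open>The derivative of 1/f contains 1/f again; this supplies it one order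
    lower.\<close>
  note IH = Suc.IH[OF Ck_on_Suc_imp[OF Suc.prems]]
  show ?case
  proof (rule Ck_on_SucI[where D="\<lambda>i u. (-1) * (partial_deriv i f u * (inverse (f u) * inverse (f u)))"])
    show "continuous_on S (\<lambda>u. inverse (f u))"
      using assms(3) by (intro continuous_on_inverse Ck_on_continuous[OF Suc.prems assms(1)]) auto
  next
    fix i u assume i: "i < n" and u: "u \<in> S"
    show "((\<lambda>t. inverse (f (u(i := t)))) has_field_derivative
        (-1) * (partial_deriv i f u * (inverse (f u) * inverse (f u)))) (at (u i))"
      by (rule DERIV_cong[OF DERIV_inverse_fun[OF Ck_on_Suc_D(1)[OF Suc.prems(1) i u]]])
        (use assms(3)[OF u] in \<open>simp_all add: power2_eq_square mult_ac\<close>)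
  next
    fix i assume "i < n"
    then show "Ck_on n k S (\<lambda>u. (-1) * (partial_deriv i f u * (inverse (f u) * inverse (f u))))"
      by (intro Ck_on_mult IH assms(1) Ck_on_Suc_D(2)[OF Suc.prems] Ck_on_const)
  qed (use assms in auto)
qed

section \<open>Mean values, increments and the chain rule\<close>

text \<open>The derivative is assumed on the symmetric interval around \<open>a\<close>, the form in
  which a box provides it; the order of \<open>a\<close> and \<open>b\<close> then does not
  matter.\<close>

lemma mean_value_between:
  fixes f :: "real \<Rightarrow> real"
  assumes "\<And>t. \<bar>t - a\<bar> \<le> \<bar>b - a\<bar> \<Longrightarrow> (f has_field_derivative f' t) (at t)"
  obtains s where "\<bar>s - a\<bar> \<le> \<bar>b - a\<bar>" "f b - f a = f' s * (b - a)"
proof -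
  consider "a < b" | "a = b" | "b < a" by linarith
  then show thesis
  proof cases
    case 1
    then obtain s where "a < s" "s < b" "f b - f a = (b - a) * f' s"
      using MVT2[of a b f f'] assms by fastforce
    then show thesis by (intro that[of s]) auto
  next
    case 2
    then show thesis by (intro that[of a]) auto
  next
    case 3
    then obtain s where "b < s" "s < a" "f a - f b = (a - b) * f' s"
      using MVT2[of b a f f'] assms by fastforce
    then show thesis by (intro that[of s]) (auto simp: algebra_simps)
  qed
qed

text \<open>Moving one coordinate at a time and applying the mean value theorem to each step.\<close>

lemma Ck_on_increment:
  assumes f: "Ck_on n (Suc k) S f" and u: "u \<in> Rn n" and v: "v \<in> Rn n"
    and box: "\<And>w. w \<in> Rn n \<Longrightarrow> (\<And>j. j < n \<Longrightarrow> \<bar>w j - u j\<bar> \<le> \<bar>v j - u j\<bar>) \<Longrightarrow> w \<in> S"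
  obtains \<xi> where "\<And>i. \<xi> i \<in> Rn n" "\<And>i j. \<bar>\<xi> i j - u j\<bar> \<le> \<bar>v j - u j\<bar>"
    "f v - f u = (\<Sum>i<n. partial_deriv i f (\<xi> i) * (v i - u i))"
proof -
  define p where "p i = (\<lambda>j. if j < i then v j else u j)" for i
  have pRn: "p i \<in> Rn n" for i using u v by (auto simp: p_def)
  have step: "\<exists>\<xi>. \<xi> \<in> Rn n \<and> (\<forall>j. \<bar>\<xi> j - u j\<bar> \<le> \<bar>v j - u j\<bar>) \<and>
      (i < n \<longrightarrow> f (p (Suc i)) - f (p i) = partial_deriv i f \<xi> * (v i - u i))" for i
  proof (cases "i < n")
    case False
    \<comment> \<open>Indices from n on receive the base point as a dummy, so that one choice
      function covers all i.\<close>
    then show ?thesis using u by (intro exI[of _ u]) auto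
  next
    case True
    \<comment> \<open>Only coordinate i moves, while every other coordinate already equals that of
      \<open>u\<close> or \<open>v\<close>; the whole segment therefore stays in the box where
      \<open>f\<close> is differentiable.\<close>
    have in_box: "\<bar>((p i)(i := t)) j - u j\<bar> \<le> \<bar>v j - u j\<bar>" if "\<bar>t - u i\<bar> \<le> \<bar>v i - u i\<bar>" for t j
      using that by (auto simp: p_def)
    have in_Rn: "(p i)(i := t) \<in> Rn n" for t using pRn[of i] True by auto
    have "((\<lambda>t. f ((p i)(i := t))) has_field_derivative partial_deriv i f ((p i)(i := t))) (at t)"
      if "\<bar>t - u i\<bar> \<le> \<bar>v i - u i\<bar>" for t
    proof -
      have "(p i)(i := t) \<in> S" by (rule box[OF in_Rn in_box[OF that]])
      from Ck_on_Suc_D(1)[OF f True this] show ?thesis by simp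
    qed
    then obtain s where s: "\<bar>s - u i\<bar> \<le> \<bar>v i - u i\<bar>"
      "f ((p i)(i := v i)) - f ((p i)(i := u i)) = partial_deriv i f ((p i)(i := s)) * (v i - u i)"
      by (rule mean_value_between)
    have "(p i)(i := v i) = p (Suc i)" "(p i)(i := u i) = p i"
      by (auto simp: p_def fun_eq_iff less_Suc_eq)
    then show ?thesis using s in_box[OF s(1)] in_Rn
      by (intro exI[of _ "(p i)(i := s)"]) auto
  qed
  then have "\<forall>i. \<exists>\<xi>. \<xi> \<in> Rn n \<and> (\<forall>j. \<bar>\<xi> j - u j\<bar> \<le> \<bar>v j - u j\<bar>) \<and>
      (i < n \<longrightarrow> f (p (Suc i)) - f (p i) = partial_deriv i f \<xi> * (v i - u i))"
    by blast
  from choice[OF this]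
  obtain \<xi> where "\<forall>i. \<xi> i \<in> Rn n \<and> (\<forall>j. \<bar>\<xi> i j - u j\<bar> \<le> \<bar>v j - u j\<bar>) \<and>
      (i < n \<longrightarrow> f (p (Suc i)) - f (p i) = partial_deriv i f (\<xi> i) * (v i - u i))"
    by blast
  then have \<xi>: "\<And>i. \<xi> i \<in> Rn n" "\<And>i j. \<bar>\<xi> i j - u j\<bar> \<le> \<bar>v j - u j\<bar>"
      "\<And>i. i < n \<Longrightarrow> f (p (Suc i)) - f (p i) = partial_deriv i f (\<xi> i) * (v i - u i)"
    by blast+
  have "p n = v" "p 0 = u" using u v by (auto simp: p_def fun_eq_iff)
  then have "f v - f u = (\<Sum>i<n. f (p (Suc i)) - f (p i))"
    using sum_lessThan_telescope[of "\<lambda>i. f (p i)" n] by simp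
  also have "\<dots> = (\<Sum>i<n. partial_deriv i f (\<xi> i) * (v i - u i))"
    by (intro sum.cong) (auto simp: \<xi>(3))
  finally show thesis using that \<xi>(1,2) by blast
qed

text \<open>The coefficients \<open>A i\<close> are partial derivatives at intermediate points. The
  curve need only be continuous at \<open>t0\<close>: besides the chain rule, this serves to
  differentiate an implicit function, where differentiability of the curve is what has to be
  proved.\<close>

lemma Ck_on_increment_curve:
  assumes S: "openin (Euclidean_space n) S" and f: "Ck_on n (Suc k) S f" and u: "c t0 \<in> S"
    and c: "\<And>i. i < n \<Longrightarrow> isCont (\<lambda>t. c t i) t0"
    and cRn: "\<forall>\<^sub>F t in at t0. c t \<in> Rn n"
  obtains A where "\<And>i. i < n \<Longrightarrow> (A i \<longlongrightarrow> partial_deriv i f (c t0)) (at t0)"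
    "\<forall>\<^sub>F t in at t0. f (c t) - f (c t0) = (\<Sum>i<n. A i t * (c t i - c t0 i))"
proof -
  let ?u = "c t0"
  have uRn: "?u \<in> Rn n" using u openin_Rn_subset[OF S] by blast
  obtain r where r: "r > 0" "\<And>v. v \<in> Rn n \<Longrightarrow> (\<And>i. i < n \<Longrightarrow> \<bar>v i - ?u i\<bar> < r) \<Longrightarrow> v \<in> S"
    by (rule openin_Rn_contains_box[OF S u]) blast
  have near: "\<forall>\<^sub>F t in at t0. \<forall>i<n. \<bar>c t i - ?u i\<bar> < d" if "d > 0" for d
  proof -
    have "\<forall>\<^sub>F t in at t0. \<bar>c t i - ?u i\<bar> < d" if "i < n" for i
      using c[OF that] \<open>d > 0\<close> by (auto simp: isCont_def tendsto_iff dist_real_def)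
    then show ?thesis
      using eventually_ball_finite[of "{..<n}" "\<lambda>t i. \<bar>c t i - ?u i\<bar> < d" "at t0"]
      by (simp add: Ball_def)
  qed
  define P where "P t \<xi> \<longleftrightarrow> (\<forall>i. \<xi> i \<in> Rn n) \<and> (\<forall>i j. \<bar>\<xi> i j - ?u j\<bar> \<le> \<bar>c t j - ?u j\<bar>) \<and>
    f (c t) - f ?u = (\<Sum>i<n. partial_deriv i f (\<xi> i) * (c t i - ?u i))" for t and \<xi> :: "nat \<Rightarrow> nat \<Rightarrow> real"
  \<comment> \<open>The intermediate points depend on \<open>t\<close>; the bounds in
    \<open>P\<close> squeeze them towards \<open>c t0\<close>, and continuity of the partial
    derivatives yields the limits of the coefficients.\<close>
  define X where "X t = (SOME \<xi>. P t \<xi>)" for t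
  have X: "\<forall>\<^sub>F t in at t0. P t (X t)"
    using near[OF r(1)] cRn
  proof eventually_elim
    case (elim t)
    have "\<exists>\<xi>. P t \<xi>"
    proof (rule Ck_on_increment[OF f uRn elim(2)])
      fix w assume "w \<in> Rn n" "\<And>j. j < n \<Longrightarrow> \<bar>w j - c t0 j\<bar> \<le> \<bar>c t j - c t0 j\<bar>"
      then show "w \<in> S" using elim(1) by (intro r(2)) (auto intro: le_less_trans)
    qed (unfold P_def, blast)
    then show ?case unfolding X_def by (rule someI_ex)
  qed
  have "((\<lambda>t. partial_deriv i f (X t i)) \<longlongrightarrow> partial_deriv i f ?u) (at t0)" if "i < n" for i
  proof (rule tendstoI)
    fix e :: real assume "e > 0"
    obtain d where d: "d > 0"
      "\<And>v. v \<in> Rn n \<Longrightarrow> (\<And>j. j < n \<Longrightarrow> \<bar>v j - ?u j\<bar> < d) \<Longrightarrow>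
        v \<in> S \<and> \<bar>partial_deriv i f v - partial_deriv i f ?u\<bar> < e"
      by (rule continuous_on_Rn_boxD[OF S Ck_on_continuous[OF Ck_on_Suc_D(2)[OF f \<open>i < n\<close>] S] u \<open>e > 0\<close>])
        blast
    show "\<forall>\<^sub>F t in at t0. dist (partial_deriv i f (X t i)) (partial_deriv i f ?u) < e"
      using X near[OF d(1)]
    proof eventually_elim
      case (elim t)
      have "X t i \<in> Rn n" using elim(1) unfolding P_def by blast
      moreover have "\<bar>X t i j - ?u j\<bar> < d" if "j < n" for j
      proof (rule le_less_trans)
        show "\<bar>X t i j - ?u j\<bar> \<le> \<bar>c t j - ?u j\<bar>" using elim(1) unfolding P_def by blast
      qed (use elim(2) that in blast)
      ultimately show ?case using d(2)[of "X t i"] by (simp add: dist_real_def)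
    qed
  qed
  moreover have "\<forall>\<^sub>F t in at t0. f (c t) - f (c t0) = (\<Sum>i<n. partial_deriv i f (X t i) * (c t i - c t0 i))"
    using X by eventually_elim (simp add: P_def)
  ultimately show thesis by (rule that)
qed

lemma Ck_on_chain_curve:
  assumes S: "openin (Euclidean_space n) S" and f: "Ck_on n (Suc k) S f" and u: "c t0 \<in> S"
    and c: "\<And>i. i < n \<Longrightarrow> ((\<lambda>t. c t i) has_field_derivative c' i) (at t0)"
    and cRn: "\<forall>\<^sub>F t in at t0. c t \<in> Rn n"
  shows "((\<lambda>t. f (c t)) has_field_derivative (\<Sum>i<n. partial_deriv i f (c t0) * c' i)) (at t0)"
proof -
  obtain A where A: "\<And>i. i < n \<Longrightarrow> (A i \<longlongrightarrow> partial_deriv i f (c t0)) (at t0)"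
    "\<forall>\<^sub>F t in at t0. f (c t) - f (c t0) = (\<Sum>i<n. A i t * (c t i - c t0 i))"
    by (rule Ck_on_increment_curve[OF S f u DERIV_isCont[OF c] cRn]) blast+
  have "((\<lambda>t. \<Sum>i<n. A i t * ((c t i - c t0 i) / (t - t0))) \<longlongrightarrow>
      (\<Sum>i<n. partial_deriv i f (c t0) * c' i)) (at t0)"
    by (intro tendsto_sum tendsto_mult A(1)) (use c in \<open>auto simp: has_field_derivative_iff\<close>)
  moreover have "\<forall>\<^sub>F t in at t0. (\<Sum>i<n. A i t * ((c t i - c t0 i) / (t - t0))) =
      (f (c t) - f (c t0)) / (t - t0)"
    using A(2) by eventually_elim (simp add: sum_divide_distrib)
  ultimately show ?thesis
    unfolding has_field_derivative_iff by (rule Lim_transform_eventually)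
qed

text \<open>From index m on the components of \<open>g\<close> are zero on \<open>S\<close>, so
  continuity of the first m makes \<open>g\<close> continuous into the full sequence space.\<close>

lemma openin_Rn_preimage_map:
  assumes S: "openin (Euclidean_space n) S" and T: "openin (Euclidean_space m) T"
    and g: "\<And>j. j < m \<Longrightarrow> continuous_on S (\<lambda>u. g u j)" and gRn: "\<And>u. u \<in> S \<Longrightarrow> g u \<in> Rn m"
  shows "openin (Euclidean_space n) {u \<in> S. g u \<in> T}"
proof -
  have "continuous_on S (\<lambda>u. g u j)" for j
  proof (cases "j < m")
    case False
    then have "continuous_on S (\<lambda>u. g u j) \<longleftrightarrow> continuous_on S (\<lambda>u. 0 :: real)"
      using gRn by (intro continuous_on_cong) auto
    then show ?thesis by simp
  qed (use g in auto)
  then have "continuous_on S g" by (rule continuous_on_coordinatewise_then_product)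
  moreover obtain T' where "open T'" "T = T' \<inter> Rn m" using T by (auto simp: openin_Rn_iff)
  moreover from this have "{u \<in> S. g u \<in> T} = {u \<in> S. g u \<in> T'}" using gRn by auto
  ultimately show ?thesis using openin_Rn_preimage[OF S, of g T'] by simp
qed

lemma continuous_on_Rn_compose:
  assumes T: "openin (Euclidean_space m) T" and f: "continuous_on T f"
    and g: "\<And>j. j < m \<Longrightarrow> continuous_on S (\<lambda>u. g u j)" and gT: "\<And>u. u \<in> S \<Longrightarrow> g u \<in> T"
  shows "continuous_on S (\<lambda>u. f (g u))"
proof -
  have "continuous_on S (\<lambda>u. g u j)" for j
  proof (cases "j < m")
    case False
    then have "continuous_on S (\<lambda>u. g u j) \<longleftrightarrow> continuous_on S (\<lambda>u. 0 :: real)"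
      using gT openin_Rn_subset[OF T] False by (intro continuous_on_cong) (auto dest!: gT)
    then show ?thesis by simp
  qed (use g in auto)
  then have "continuous_on S g" by (rule continuous_on_coordinatewise_then_product)
  then show ?thesis using gT by (intro continuous_on_compose2[OF f]) auto
qed

lemma Ck_on_compose_derivative:
  assumes S: "openin (Euclidean_space n) S" and T: "openin (Euclidean_space m) T"
    and f: "Ck_on m (Suc k) T f" and g: "\<And>j. j < m \<Longrightarrow> Ck_on n (Suc k) S (\<lambda>u. g u j)"
    and gT: "\<And>u. u \<in> S \<Longrightarrow> g u \<in> T" and i: "i < n" and u: "u \<in> S"
  shows "((\<lambda>t. f (g (u(i := t)))) has_field_derivative
    (\<Sum>j<m. partial_deriv j f (g u) * partial_deriv i (\<lambda>u. g u j) u)) (at (u i))"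
proof -
  have "\<forall>\<^sub>F t in at (u i). u(i := t) \<in> S"
    using eventually_slice[OF S i u] by (simp add: eventually_nhds_conv_at)
  then have "\<forall>\<^sub>F t in at (u i). g (u(i := t)) \<in> Rn m"
    by eventually_elim (use gT openin_Rn_subset[OF T] in blast)
  with Ck_on_chain_curve[OF T f, of "\<lambda>t. g (u(i := t))" "u i" "\<lambda>j. partial_deriv i (\<lambda>u. g u j) u"]
  show ?thesis using gT u Ck_on_Suc_D(1)[OF g i u] by simp
qed

text \<open>The induction leaves \<open>f\<close> arbitrary because the chain rule replaces
  \<open>f\<close> by its partial derivatives, still composed with the same
  \<open>g\<close>.\<close>

lemma Ck_on_compose:
  assumes S: "openin (Euclidean_space n) S" and T: "openin (Euclidean_space m) T"
    and "Ck_on m k T f" and "\<And>j. j < m \<Longrightarrow> Ck_on n k S (\<lambda>u. g u j)"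
    and gT: "\<And>u. u \<in> S \<Longrightarrow> g u \<in> T"
  shows "Ck_on n k S (\<lambda>u. f (g u))"
  using assms(3,4)
proof (induction k arbitrary: f)
  case 0
  have "continuous_on S (\<lambda>u. f (g u))"
    by (rule continuous_on_Rn_compose[OF T Ck_on_continuous[OF 0(1) T] Ck_on_continuous[OF 0(2) S] gT])
  then show ?case using openin_Rn_subset[OF S] by (simp add: continuous_map_Rn_iff)
next
  case (Suc k)
  show ?case
  proof (rule Ck_on_SucI[OF S])
    show "continuous_on S (\<lambda>u. f (g u))"
      by (rule continuous_on_Rn_compose[OF T Ck_on_continuous[OF Suc.prems(1) T]
            Ck_on_continuous[OF Suc.prems(2) S] gT])
  next
    fix i u assume "i < n" "u \<in> S"
    then show "((\<lambda>t. f (g (u(i := t)))) has_field_derivative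
        (\<Sum>j<m. partial_deriv j f (g u) * partial_deriv i (\<lambda>u. g u j) u)) (at (u i))"
      by (intro Ck_on_compose_derivative[OF S T Suc.prems gT])
  next
    fix i assume i: "i < n"
    have "Ck_on n k S (\<lambda>u. partial_deriv j f (g u))" if "j < m" for j
      using Suc.IH[OF Ck_on_Suc_D(2)[OF Suc.prems(1) that]] Suc.prems(2) Ck_on_Suc_imp by blast
    moreover have "Ck_on n k S (partial_deriv i (\<lambda>u. g u j))" if "j < m" for j
      using Suc.prems(2)[OF that] Ck_on_Suc_D(2) i by blast
    ultimately show "Ck_on n k S (\<lambda>u. \<Sum>j<m. partial_deriv j f (g u) * partial_deriv i (\<lambda>u. g u j) u)"
      by (intro Ck_on_sum Ck_on_mult S) auto
  qed
qed

section \<open>Implicit functions and local sections\<close>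

lemma Cinf_on_subset: "Cinf_on n S f \<Longrightarrow> T \<subseteq> S \<Longrightarrow> Cinf_on n T f"
  unfolding Cinf_on_def using Ck_on_subset by blast

lemma Cinf_on_cong:
  "openin (Euclidean_space n) S \<Longrightarrow> (\<And>u. u \<in> S \<Longrightarrow> f u = g u) \<Longrightarrow> Cinf_on n S f \<Longrightarrow> Cinf_on n S g"
  unfolding Cinf_on_def using Ck_on_cong by blast

lemma Cinf_on_local:
  assumes "openin (Euclidean_space n) S"
    and "\<And>u. u \<in> S \<Longrightarrow> \<exists>T. openin (Euclidean_space n) T \<and> u \<in> T \<and> Cinf_on n T f"
  shows "Cinf_on n S f"
  unfolding Cinf_on_def
  by (intro allI Ck_on_local[OF assms(1)]) (use assms(2) in \<open>unfold Cinf_on_def, blast\<close>)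

lemma Cinf_on_compose:
  assumes "openin (Euclidean_space n) S" "openin (Euclidean_space m) T"
    and "Cinf_on m T f" "\<And>j. j < m \<Longrightarrow> Cinf_on n S (\<lambda>u. g u j)" "\<And>u. u \<in> S \<Longrightarrow> g u \<in> T"
  shows "Cinf_on n S (\<lambda>u. f (g u))"
  using assms(3,4) unfolding Cinf_on_def
  by (intro allI Ck_on_compose[where f=f and g=g, OF assms(1,2) _ _ assms(5)]) blast+

lemma partial_deriv_cong:
  assumes "openin (Euclidean_space n) S" "\<And>u. u \<in> S \<Longrightarrow> f u = g u" "u \<in> S" "i < n"
  shows "partial_deriv i f u = partial_deriv i g u"
  unfolding partial_deriv_def
proof (rule deriv_cong_ev[OF _ refl])
  show "\<forall>\<^sub>F t in nhds (u i). f (u(i := t)) = g (u(i := t))"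
    using eventually_slice[OF assms(1,4,3)] by eventually_elim (use assms in auto)
qed

lemma partial_deriv_coord: "partial_deriv l (\<lambda>v. v j) u = (if l = j then 1 else 0)"
proof (cases "l = j")
  case True
  then show ?thesis by (simp add: partial_deriv_def)
next
  case False
  then show ?thesis by (simp add: partial_deriv_def)
qed

lemma Ck_on_fun_upd:
  assumes "openin (Euclidean_space n) S" "Ck_on n k S \<phi>"
  shows "Ck_on n k S (\<lambda>v. (v(i := \<phi> v)) j)"
  by (cases "j = i") (use assms Ck_on_coord in auto)

text \<open>Coordinate i of \<open>v\<close> stores the prescribed value of \<open>f\<close>, so
  that \<open>v \<mapsto> v(i := \<phi> v)\<close> is a local inverse of
  \<open>u \<mapsto> u(i := f u)\<close> and repeated applications compose as coordinate changes.
  Existence comes from intermediate values, uniqueness from strict monotonicity in coordinate i. The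
  derivative formula belongs to the conclusion because the rank has to be followed through the
  coordinate change.\<close>

lemma scalar_implicit_function:
  assumes S: "openin (Euclidean_space n) S" and f: "Cinf_on n S f" and u: "u \<in> S" and i: "i < n"
    and nz: "partial_deriv i f u \<noteq> 0"
  obtains W \<phi> where "openin (Euclidean_space n) W" "u(i := f u) \<in> W" "\<phi> (u(i := f u)) = u i"
    "\<And>v. v \<in> W \<Longrightarrow> v(i := \<phi> v) \<in> S" "\<And>v. v \<in> W \<Longrightarrow> f (v(i := \<phi> v)) = v i"
    "Cinf_on n W \<phi>"
    "\<And>l v. l < n \<Longrightarrow> v \<in> W \<Longrightarrow> partial_deriv l \<phi> v =
      (if l = i then 1 else - partial_deriv l f (v(i := \<phi> v))) * inverse (partial_deriv i f (v(i := \<phi> v)))"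
proof -
  have fk: "Ck_on n k S f" for k using f by (simp add: Cinf_on_def)
  have uRn: "u \<in> Rn n" using u openin_Rn_subset[OF S] by blast
  \<comment> \<open>The sign makes \<open>f\<close> times \<sigma> increasing in coordinate i, so
    that both signs of the derivative are treated at once.\<close>
  define \<sigma> where "\<sigma> = sgn (partial_deriv i f u)"
  have \<sigma>: "\<sigma> = 1 \<or> \<sigma> = -1" "\<sigma> * partial_deriv i f u > 0"
    using nz by (auto simp: \<sigma>_def sgn_if)
  obtain r where r: "r > 0" and near_u:
    "\<And>v. v \<in> Rn n \<Longrightarrow> (\<And>j. j < n \<Longrightarrow> \<bar>v j - u j\<bar> < r) \<Longrightarrow>
      v \<in> S \<and> \<bar>partial_deriv i f v - partial_deriv i f u\<bar> < \<sigma> * partial_deriv i f u"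
    by (rule continuous_on_Rn_boxD[OF S Ck_on_continuous[OF Ck_on_Suc_D(2)[OF fk i] S] u \<sigma>(2)]) blast
  have pos: "\<sigma> * partial_deriv i f v > 0" if "v \<in> Rn n" "\<And>j. j < n \<Longrightarrow> \<bar>v j - u j\<bar> < r" for v
    using near_u[of v] that \<sigma> by auto
  \<comment> \<open>Coordinate i is reset before the box condition because it holds a value of
    \<open>f\<close>, which need not be close to \<open>u i\<close>.\<close>
  define R where "R = {v \<in> Rn n. \<forall>j<n. \<bar>(v(i := u i)) j - u j\<bar> < r}"
  have R: "v(i := t) \<in> Rn n" "j < n \<Longrightarrow> \<bar>(v(i := t)) j - u j\<bar> < r"
    if "v \<in> R" "\<bar>t - u i\<bar> < r" for v t j
    using that i by (auto simp: R_def split: if_splits)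
  have RS: "v(i := t) \<in> S" if "v \<in> R" "\<bar>t - u i\<bar> < r" for v t
    using near_u R[OF that] by blast
  have upd_cont: "continuous_on A (\<lambda>v. (v(i := t)) j)" for A t j
    by (cases "j = i") (auto intro: continuous_on_coordinate)
  have Ropen: "openin (Euclidean_space n) R"
  proof -
    have "R = {v \<in> Rn n. v(i := u i) \<in> {v \<in> Rn n. \<forall>j<n. \<bar>v j - u j\<bar> < r}}"
      using i by (auto simp: R_def)
    moreover have "openin (Euclidean_space n)
        {v \<in> Rn n. v(i := u i) \<in> {v \<in> Rn n. \<forall>j<n. \<bar>v j - u j\<bar> < r}}"
      using i by (intro openin_Rn_preimage_map[OF openin_Rn_Rn openin_Rn_box upd_cont]) auto
    ultimately show ?thesis by metis
  qed
  have deriv: "((\<lambda>t. f (v(i := t))) has_field_derivative partial_deriv i f (v(i := t))) (at t)"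
    if "v \<in> R" "\<bar>t - u i\<bar> < r" for v t
    using Ck_on_Suc_D(1)[OF fk i RS[OF that]] by (simp only: fun_upd_upd fun_upd_same)
  have mono: "\<sigma> * f (v(i := s)) < \<sigma> * f (v(i := t))"
    if v: "v \<in> R" and s: "\<bar>s - u i\<bar> < r" and t: "\<bar>t - u i\<bar> < r" and "s < t" for v s t
  proof (rule DERIV_pos_imp_increasing[OF \<open>s < t\<close>, of "\<lambda>t. \<sigma> * f (v(i := t))"])
    fix x assume "s \<le> x" "x \<le> t"
    then have x: "\<bar>x - u i\<bar> < r" using s t by linarith
    show "\<exists>y. ((\<lambda>t. \<sigma> * f (v(i := t))) has_field_derivative y) (at x) \<and> 0 < y"
      using DERIV_cmult[OF deriv[OF v x], of \<sigma>] pos[OF R[OF v x]] by blast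
  qed
  have ivt: "\<exists>t. a \<le> t \<and> t \<le> b \<and> f (v(i := t)) = v i"
    if v: "v \<in> R" and a: "\<bar>a - u i\<bar> < r" and b: "\<bar>b - u i\<bar> < r" and "a \<le> b"
      and "\<sigma> * f (v(i := a)) < \<sigma> * v i" "\<sigma> * v i < \<sigma> * f (v(i := b))" for v a b
  proof -
    have "continuous_on {a..b} (\<lambda>t. \<sigma> * f (v(i := t)))"
    proof (rule DERIV_continuous_on)
      fix x assume "x \<in> {a..b}"
      then have x: "\<bar>x - u i\<bar> < r" using a b by auto
      show "((\<lambda>t. \<sigma> * f (v(i := t))) has_field_derivative \<sigma> * partial_deriv i f (v(i := x))) (at x within {a..b})"
        by (rule has_field_derivative_at_within[OF DERIV_cmult[OF deriv[OF v x]]])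
    qed
    from IVT'[OF _ _ \<open>a \<le> b\<close> this, of "\<sigma> * v i"] that(5,6) \<sigma>(1)
    show ?thesis by fastforce
  qed
  have uniq: "s = t"
    if "v \<in> R" "\<bar>s - u i\<bar> < r" "\<bar>t - u i\<bar> < r" "f (v(i := s)) = f (v(i := t))" for v s t
    using mono[OF that(1-3)] mono[OF that(1,3,2)] that(4) by (cases s t rule: linorder_cases) auto
  \<comment> \<open>Here the target \<open>v i\<close> lies strictly between the values at
    \<open>a\<close> and \<open>b\<close>. This is an open condition on \<open>v\<close>, and it
    traps the solution between \<open>a\<close> and \<open>b\<close>.\<close>
  define Q where "Q a b = {v \<in> R. \<sigma> * f (v(i := a)) < \<sigma> * v i \<and> \<sigma> * v i < \<sigma> * f (v(i := b))}" for a b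
  have Qopen: "openin (Euclidean_space n) (Q a b)" if a: "\<bar>a - u i\<bar> < r" and b: "\<bar>b - u i\<bar> < r" for a b
  proof -
    have c: "continuous_on R (\<lambda>v. f (v(i := t)))" if "\<bar>t - u i\<bar> < r" for t
      by (rule continuous_on_Rn_compose[OF S Ck_on_continuous[OF fk S] upd_cont RS[OF _ that]])
    have "openin (Euclidean_space n)
        {v \<in> R. min (\<sigma> * v i - \<sigma> * f (v(i := a))) (\<sigma> * f (v(i := b)) - \<sigma> * v i) \<in> {0<..}}"
      by (intro openin_Rn_preimage[OF Ropen] continuous_intros c a b)
    moreover have "Q a b =
        {v \<in> R. min (\<sigma> * v i - \<sigma> * f (v(i := a))) (\<sigma> * f (v(i := b)) - \<sigma> * v i) \<in> {0<..}}"
      by (auto simp: Q_def)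
    ultimately show ?thesis by simp
  qed
  \<comment> \<open>Half the radius keeps the closed interval from \<open>a\<close> to
    \<open>b\<close> inside the open range where the derivative has a fixed sign.\<close>
  define a b where "a = u i - r / 2" and "b = u i + r / 2"
  have ab: "\<bar>a - u i\<bar> < r" "\<bar>b - u i\<bar> < r" "a < u i" "u i < b" using r by (auto simp: a_def b_def)
  have near: "\<bar>t - u i\<bar> < r" if "a \<le> t" "t \<le> b" for t
    using that r by (auto simp: a_def b_def abs_less_iff field_simps)
  define \<phi> where "\<phi> v = (SOME t. a \<le> t \<and> t \<le> b \<and> f (v(i := t)) = v i)" for v
  have \<phi>: "a \<le> \<phi> v" "\<phi> v \<le> b" "f (v(i := \<phi> v)) = v i" if "v \<in> Q a b" for v
  proof -
    have "\<exists>t. a \<le> t \<and> t \<le> b \<and> f (v(i := t)) = v i"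
      using that ab by (intro ivt) (auto simp: Q_def)
    from someI_ex[OF this] show "a \<le> \<phi> v" "\<phi> v \<le> b" "f (v(i := \<phi> v)) = v i"
      unfolding \<phi>_def by blast+
  qed
  have QR: "Q a b \<subseteq> R" by (auto simp: Q_def)
  let ?W = "Q a b"
  note W = Qopen[OF ab(1,2)]
  have WRn: "?W \<subseteq> Rn n" by (rule openin_Rn_subset[OF W])
  have \<Psi>S: "v(i := \<phi> v) \<in> S" if "v \<in> ?W" for v
    using RS near \<phi>[OF that] QR that by blast
  have uW: "u(i := f u) \<in> ?W"
  proof -
    have "u \<in> R" "u(i := f u) \<in> R" using uRn r i by (auto simp: R_def)
    then show ?thesis
      using mono[of u a "u i"] mono[of u "u i" b] ab r by (auto simp: Q_def)
  qed
  have \<phi>u: "\<phi> (u(i := f u)) = u i"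
    by (rule uniq[of "u(i := f u)"]) (use uW QR near \<phi>[OF uW] ab in auto)
  have cont: "continuous_on ?W \<phi>"
  proof (rule continuous_on_Rn_boxI[OF WRn])
    fix v and e :: real assume v: "v \<in> ?W" and e: "e > 0"
    let ?t = "\<phi> v"
    have tb: "a < ?t" "?t < b"
      using \<phi>[OF v] v \<sigma>(1) unfolding Q_def by (metis (no_types, lifting) less_irrefl mem_Collect_eq order_le_less)+
    \<comment> \<open>Continuity of \<phi>: strictness in \<open>Q\<close> keeps the solution off
      the endpoints, so it has a smaller interval around it of half-width at most e/2. Then
      \<open>v\<close> lies in the open set \<open>Q a' b'\<close>, and every nearby
      \<open>w\<close> has its unique solution in that same interval.\<close>
    define a' b' where "a' = max a (?t - e / 2)" and "b' = min b (?t + e / 2)"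
    have ab': "a \<le> a'" "a' < ?t" "?t < b'" "b' \<le> b" "?t - e / 2 \<le> a'" "b' \<le> ?t + e / 2"
      using tb e by (auto simp: a'_def b'_def)
    have n': "\<bar>a' - u i\<bar> < r" "\<bar>b' - u i\<bar> < r" "\<bar>?t - u i\<bar> < r"
      using ab' by (auto intro!: near)
    have vQ: "v \<in> Q a' b'"
      using mono[of v a' ?t] mono[of v ?t b'] n' ab' v QR \<phi>(3)[OF v] by (auto simp: Q_def)
    obtain d where d: "d > 0"
      "\<And>w. w \<in> Rn n \<Longrightarrow> (\<And>j. j < n \<Longrightarrow> \<bar>w j - v j\<bar> < d) \<Longrightarrow> w \<in> Q a' b'"
      by (rule openin_Rn_contains_box[OF Qopen[OF n'(1,2)] vQ]) blast
    have "\<bar>\<phi> w - ?t\<bar> < e" if w: "w \<in> ?W" "\<forall>j<n. \<bar>w j - v j\<bar> < d" for w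
    proof -
      have "w \<in> Q a' b'" using d(2) w WRn by blast
      then obtain t where t: "a' \<le> t" "t \<le> b'" "f (w(i := t)) = w i"
        using ivt[of w a' b'] n' ab' by (auto simp: Q_def)
      have "\<phi> w = t"
        by (rule uniq[of w]) (use w QR near \<phi>[OF w(1)] t ab' in auto)
      then show ?thesis using t ab' e by auto
    qed
    then show "\<exists>d>0. \<forall>w\<in>?W. (\<forall>j<n. \<bar>w j - v j\<bar> < d) \<longrightarrow> \<bar>\<phi> w - ?t\<bar> < e" using d(1) by blast
  qed
  have nz': "partial_deriv i f (v(i := \<phi> v)) \<noteq> 0" if "v \<in> ?W" for v
    using pos[of "v(i := \<phi> v)"] R[of v "\<phi> v"] near \<phi>[OF that] QR that by fastforce
  define D where "D l v = (if l = i then 1 else - partial_deriv l f (v(i := \<phi> v))) *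
      inverse (partial_deriv i f (v(i := \<phi> v)))" for l v
  have D: "((\<lambda>t. \<phi> (v(l := t))) has_field_derivative D l v) (at (v l))"
    if l: "l < n" and v: "v \<in> ?W" for l v
  proof -
    \<comment> \<open>Along this lifted coordinate line \<open>f\<close> equals coordinate i of
      \<open>v(l := t)\<close>: it is \<open>t\<close> if l = i and constant otherwise. As \<phi> is
      so far only continuous, the increment formula for continuous curves provides its difference
      quotient.\<close>
    define c where "c t = (v(l := t))(i := \<phi> (v(l := t)))" for t
    have vRn: "v \<in> Rn n" using v WRn by blast
    have cv: "c (v l) = v(i := \<phi> v)" by (simp add: c_def)
    have op: "open {t. v(l := t) \<in> ?W}" by (rule openin_Rn_slice[OF W l vRn])
    have "continuous_on {t. v(l := t) \<in> ?W} (\<lambda>t. \<phi> (v(l := t)))"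
      by (rule continuous_on_compose2[OF cont continuous_on_fun_upd_var]) auto
    then have \<phi>c: "isCont (\<lambda>t. \<phi> (v(l := t))) (v l)"
      using op v by (simp add: continuous_on_eq_continuous_at)
    have cc: "isCont (\<lambda>t. c t j) (v l)" for j
      using \<phi>c by (cases "j = i"; cases "j = l") (auto simp: c_def)
    have evW: "\<forall>\<^sub>F t in at (v l). v(l := t) \<in> ?W"
      using eventually_slice[OF W l v] by (simp add: eventually_nhds_conv_at)
    have evRn: "\<forall>\<^sub>F t in at (v l). c t \<in> Rn n"
      using evW by eventually_elim (use \<Psi>S openin_Rn_subset[OF S] in \<open>unfold c_def, blast\<close>)
    have "c (v l) \<in> S" using \<Psi>S[OF v] cv by simp
    then obtain A where A: "\<And>j. j < n \<Longrightarrow> (A j \<longlongrightarrow> partial_deriv j f (c (v l))) (at (v l))"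
      "\<forall>\<^sub>F t in at (v l). f (c t) - f (c (v l)) = (\<Sum>j<n. A j t * (c t j - c (v l) j))"
      by (rule Ck_on_increment_curve[OF S fk _ cc evRn]) blast
    have Ai: "\<forall>\<^sub>F t in at (v l). A i t \<noteq> 0"
      using tendsto_imp_eventually_ne[OF A(1)[OF i]] nz'[OF v] cv by simp
    have "((\<lambda>t. (if l = i then 1 else - A l t) * inverse (A i t)) \<longlongrightarrow> D l v) (at (v l))"
      unfolding D_def using A(1)[OF l] A(1)[OF i] nz'[OF v] cv
      by (auto intro!: tendsto_intros)
    moreover have "\<forall>\<^sub>F t in at (v l). (if l = i then 1 else - A l t) * inverse (A i t) =
        (\<phi> (v(l := t)) - \<phi> (v(l := v l))) / (t - v l)"
      using A(2) Ai evW eventually_neq_at_within[of "v l"]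
    proof eventually_elim
      case (elim t)
      \<comment> \<open>Only coordinates l and i of \<open>c\<close> move; if they coincide, the
        sole contribution is the increment of \<phi>.\<close>
      have sum: "(\<Sum>j<n. A j t * (c t j - c (v l) j)) =
          (if l = i then 0 else A l t * (t - v l)) + A i t * (\<phi> (v(l := t)) - \<phi> v)"
      proof -
        have "(\<Sum>j<n. A j t * (c t j - c (v l) j)) =
            (\<Sum>j<n. (if j = l then (if l = i then 0 else A l t * (t - v l)) else 0) +
               (if j = i then A i t * (\<phi> (v(l := t)) - \<phi> v) else 0))"
          by (intro sum.cong) (auto simp: c_def)
        also have "\<dots> = (if l = i then 0 else A l t * (t - v l)) + A i t * (\<phi> (v(l := t)) - \<phi> v)"
          using l i by (simp add: sum.distrib)
        finally show ?thesis .
      qed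
      have "f (c t) = (v(l := t)) i" "f (c (v l)) = v i"
        using \<phi>(3)[OF elim(3)] \<phi>(3)[OF v] by (simp_all add: c_def)
      then have "(if l = i then t - v l else 0) =
          (if l = i then 0 else A l t * (t - v l)) + A i t * (\<phi> (v(l := t)) - \<phi> v)"
        using elim(1) unfolding sum by (simp split: if_splits)
      then show ?case using elim(2,4) by (auto simp: field_simps split: if_splits)
    qed
    ultimately show ?thesis
      unfolding has_field_derivative_iff by (rule Lim_transform_eventually)
  qed
  \<comment> \<open>Bootstrapping: the partial derivatives of \<phi> are expressions in \<phi> and
    derivatives of \<open>f\<close>, so class C^k of \<phi> makes them C^k and raises \<phi> to the
    next order.\<close>
  have Ck: "Ck_on n k ?W \<phi>" for k
  proof (induction k)
    case 0
    then show ?case using cont WRn by (simp add: continuous_map_Rn_iff)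
  next
    case (Suc k)
    show ?case
    proof (rule Ck_on_SucI[OF W cont D])
      fix l assume l: "l < n"
      have comp: "Ck_on n k ?W (\<lambda>v. partial_deriv j f (v(i := \<phi> v)))" if "j < n" for j
        by (rule Ck_on_compose[OF W S Ck_on_Suc_D(2)[OF fk that] Ck_on_fun_upd[OF W Suc.IH] \<Psi>S])
      have "Ck_on n k ?W (\<lambda>v. - partial_deriv l f (v(i := \<phi> v)))"
        using Ck_on_mult[OF W Ck_on_const[OF W, of k "-1"] comp[OF l]] by simp
      then have "Ck_on n k ?W (\<lambda>v. if l = i then 1 else - partial_deriv l f (v(i := \<phi> v)))"
        using Ck_on_const[OF W, of k 1] by (cases "l = i") simp_all
      then show "Ck_on n k ?W (D l)"
        unfolding D_def[abs_def]
        by (intro Ck_on_mult[OF W] Ck_on_inverse[OF W comp[OF i] nz'])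
    qed
  qed
  show thesis
  proof (rule that[OF W uW \<phi>u \<Psi>S \<phi>(3)])
    show "Cinf_on n ?W \<phi>" using Ck by (simp add: Cinf_on_def)
    show "partial_deriv l \<phi> v =
      (if l = i then 1 else - partial_deriv l f (v(i := \<phi> v))) * inverse (partial_deriv i f (v(i := \<phi> v)))"
      if "l < n" "v \<in> ?W" for l v
      using DERIV_imp_deriv[OF D[OF that]] by (simp add: partial_deriv_def D_def)
  qed
qed

text \<open>Surjectivity of the b by a Jacobian, encoded by the columns \<open>w\<close> of a right
  inverse. This form transports easily along coordinate changes and matches what a lifted tangent
  vector provides.\<close>

definition full_rank_at ::
  "nat \<Rightarrow> nat \<Rightarrow> ((nat \<Rightarrow> real) \<Rightarrow> nat \<Rightarrow> real) \<Rightarrow> (nat \<Rightarrow> real) \<Rightarrow> bool"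
  where "full_rank_at a b F u \<longleftrightarrow>
    (\<forall>j<b. \<exists>w. \<forall>j'<b. (\<Sum>l<a. partial_deriv l (\<lambda>u. F u j') u * w l) = (if j' = j then 1 else 0))"

text \<open>The map \<open>v \<mapsto> v(i := \<phi> v)\<close> has an invertible differential,
  inverse to that of \<open>u \<mapsto> u(i := G u)\<close>. Carrying a column of the right inverse
  over by the latter and applying the chain rule restores the old values.\<close>

lemma full_rank_at_reparametrize:
  assumes W: "openin (Euclidean_space a) W" and S: "openin (Euclidean_space a) S"
    and H: "\<And>j. j < b \<Longrightarrow> Cinf_on a S (\<lambda>v. H v j)" and full: "full_rank_at a b H s"
    and i: "i < a" and \<phi>: "Cinf_on a W \<phi>" and s': "s' \<in> W" "s'(i := \<phi> s') = s"
    and WS: "\<And>v. v \<in> W \<Longrightarrow> v(i := \<phi> v) \<in> S"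
    and nz: "partial_deriv i G s \<noteq> 0"
    and d\<phi>: "\<And>l. l < a \<Longrightarrow> partial_deriv l \<phi> s' =
      (if l = i then 1 else - partial_deriv l G s) * inverse (partial_deriv i G s)"
  shows "full_rank_at a b (\<lambda>v. H (v(i := \<phi> v))) s'"
  unfolding full_rank_at_def
proof (intro allI impI)
  fix j assume "j < b"
  then obtain w where w: "\<And>j'. j' < b \<Longrightarrow>
      (\<Sum>l<a. partial_deriv l (\<lambda>u. H u j') s * w l) = (if j' = j then 1 else 0)"
    using full unfolding full_rank_at_def by blast
  define dG where "dG = (\<Sum>l<a. partial_deriv l G s * w l)"
  \<comment> \<open>The image of \<open>w\<close> under the differential of
    \<open>u \<mapsto> u(i := G u)\<close>. By \<open>d\<phi>\<close>, the differential of \<phi>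
    sends it back to the old entry \<open>w i\<close>.\<close>
  define w' where "w' = w(i := dG)"
  have dcomp: "partial_deriv l (\<lambda>v. H (v(i := \<phi> v)) j') s' =
      (if l = i then 0 else partial_deriv l (\<lambda>u. H u j') s) +
      partial_deriv i (\<lambda>u. H u j') s * partial_deriv l \<phi> s'" if l: "l < a" and "j' < b" for l j'
  proof -
    have "Ck_on a (Suc 0) S (\<lambda>u. H u j')" "Ck_on a (Suc 0) W \<phi>"
      using H[OF that(2)] \<phi> by (simp_all only: Cinf_on_def)
    note 1 = Ck_on_compose_derivative[where g="\<lambda>v. v(i := \<phi> v)",
        OF W S this(1) Ck_on_fun_upd[OF W this(2)] WS l s'(1)]
    have "partial_deriv l (\<lambda>v. H (v(i := \<phi> v)) j') s' =
        (\<Sum>m<a. partial_deriv m (\<lambda>u. H u j') s * partial_deriv l (\<lambda>v. (v(i := \<phi> v)) m) s')"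
      using DERIV_imp_deriv[OF 1] unfolding partial_deriv_def[of l "\<lambda>v. H (v(i := \<phi> v)) j'"] s'(2) .
    also have "\<dots> = (\<Sum>m<a. (if m = l then if l = i then 0 else partial_deriv l (\<lambda>u. H u j') s else 0) +
        (if m = i then partial_deriv i (\<lambda>u. H u j') s * partial_deriv l \<phi> s' else 0))"
    proof (rule sum.cong[OF refl])
      fix m
      have "partial_deriv l (\<lambda>v. (v(i := \<phi> v)) m) s' =
          (if m = i then partial_deriv l \<phi> s' else if l = m then 1 else 0)"
        by (simp add: partial_deriv_coord)
      then show "partial_deriv m (\<lambda>u. H u j') s * partial_deriv l (\<lambda>v. (v(i := \<phi> v)) m) s' =
        (if m = l then if l = i then 0 else partial_deriv l (\<lambda>u. H u j') s else 0) +
        (if m = i then partial_deriv i (\<lambda>u. H u j') s * partial_deriv l \<phi> s' else 0)"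
        by simp
    qed
    also have "\<dots> = (if l = i then 0 else partial_deriv l (\<lambda>u. H u j') s) +
        partial_deriv i (\<lambda>u. H u j') s * partial_deriv l \<phi> s'"
      using l i by (simp add: sum.distrib)
    finally show ?thesis .
  qed
  have split: "(\<Sum>l<a. h l) = h i + (\<Sum>l\<in>{..<a} - {i}. h l)" for h :: "nat \<Rightarrow> real"
    using i by (simp add: sum.remove)
  have "(\<Sum>l<a. partial_deriv l \<phi> s' * w' l) = w i"
  proof -
    have "(\<Sum>l<a. partial_deriv l \<phi> s' * w' l) = inverse (partial_deriv i G s) * dG -
        (\<Sum>l\<in>{..<a} - {i}. inverse (partial_deriv i G s) * (partial_deriv l G s * w l))"
      using i by (simp add: split d\<phi> w'_def mult_ac flip: sum_negf)
    also have "\<dots> = inverse (partial_deriv i G s) * (partial_deriv i G s * w i)"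
      unfolding dG_def split by (simp add: sum_distrib_left algebra_simps)
    finally show ?thesis using nz by simp
  qed
  then have "(\<Sum>l<a. partial_deriv l (\<lambda>v. H (v(i := \<phi> v)) j') s' * w' l) = (if j' = j then 1 else 0)"
    if "j' < b" for j'
  proof -
    assume *: "(\<Sum>l<a. partial_deriv l \<phi> s' * w' l) = w i"
    have "(\<Sum>l<a. partial_deriv l (\<lambda>v. H (v(i := \<phi> v)) j') s' * w' l) =
        (\<Sum>l<a. (if l = i then 0 else partial_deriv l (\<lambda>u. H u j') s) * w' l) +
        partial_deriv i (\<lambda>u. H u j') s * (\<Sum>l<a. partial_deriv l \<phi> s' * w' l)"
      using that by (simp add: dcomp sum.distrib sum_distrib_left algebra_simps)
    also have "\<dots> = (\<Sum>l\<in>{..<a} - {i}. partial_deriv l (\<lambda>u. H u j') s * w l) +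
        partial_deriv i (\<lambda>u. H u j') s * w i"
      unfolding * by (simp add: split w'_def)
    also have "\<dots> = (if j' = j then 1 else 0)" using w[OF that] by (simp add: split)
    finally show ?thesis .
  qed
  then show "\<exists>w. \<forall>j'<b. (\<Sum>l<a. partial_deriv l (\<lambda>v. H (v(i := \<phi> v)) j') s' * w l) = (if j' = j then 1 else 0)"
    by blast
qed

text \<open>
  After the change of variables \<open>\<Psi>\<close> the first \<open>k\<close> components of \<open>F\<close> are distinct coordinates; full rank of
  \<open>F \<circ> \<Psi>\<close> then provides an unused coordinate in which the next component can be solved for.
\<close>

lemma full_rank_straighten:
  assumes S: "openin (Euclidean_space a) S" and F: "\<And>j. j < b \<Longrightarrow> Cinf_on a S (\<lambda>u. F u j)"
    and u: "u \<in> S" and full: "full_rank_at a b F u" and "k \<le> b"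
  shows "\<exists>W s \<Psi> \<iota>. openin (Euclidean_space a) W \<and> s \<in> W \<and> (\<forall>l<a. Cinf_on a W (\<lambda>v. \<Psi> v l)) \<and>
    (\<forall>v\<in>W. \<Psi> v \<in> S) \<and> \<Psi> s = u \<and> inj_on \<iota> {..<k} \<and> (\<forall>j<k. \<iota> j < a) \<and>
    (\<forall>v\<in>W. \<forall>j<k. F (\<Psi> v) j = v (\<iota> j)) \<and> full_rank_at a b (\<lambda>v. F (\<Psi> v)) s"
  using \<open>k \<le> b\<close>
proof (induction k)
  case 0
  have "\<forall>l<a. Cinf_on a S (\<lambda>v. v l)" by (simp add: Cinf_on_def Ck_on_coord S)
  then show ?case using S u full
    by (intro exI[of _ S] exI[of _ u] exI[of _ "\<lambda>v. v"] exI[of _ "\<lambda>j. j"]) simp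
next
  case (Suc k)
  from Suc.IH[OF Suc_leD[OF Suc.prems]]
  obtain W s \<Psi> \<iota> where W: "openin (Euclidean_space a) W" and s: "s \<in> W"
    and \<Psi>: "\<And>l. l < a \<Longrightarrow> Cinf_on a W (\<lambda>v. \<Psi> v l)" and \<Psi>S: "\<And>v. v \<in> W \<Longrightarrow> \<Psi> v \<in> S"
    and \<Psi>s: "\<Psi> s = u" and \<iota>: "inj_on \<iota> {..<k}" "\<And>j. j < k \<Longrightarrow> \<iota> j < a"
    and F\<Psi>: "\<And>v j. v \<in> W \<Longrightarrow> j < k \<Longrightarrow> F (\<Psi> v) j = v (\<iota> j)"
    and full': "full_rank_at a b (\<lambda>v. F (\<Psi> v)) s"
    by blast
  define G where "G v = F (\<Psi> v) k" for v
  have k: "k < b" using Suc.prems by simp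
  have FC: "Cinf_on a W (\<lambda>v. F (\<Psi> v) j)" if "j < b" for j
    by (rule Cinf_on_compose[where f="\<lambda>u. F u j", OF W S F[OF that] \<Psi> \<Psi>S])
  then have G: "Cinf_on a W G" using k by (simp add: G_def[abs_def])
  obtain w where w: "\<And>j. j < b \<Longrightarrow>
      (\<Sum>l<a. partial_deriv l (\<lambda>v. F (\<Psi> v) j) s * w l) = (if j = k then 1 else 0)"
    using full' k unfolding full_rank_at_def by blast
  \<comment> \<open>Near \<open>s\<close> component j is the coordinate \<iota> j, so its
    differential reads off that entry of \<open>w\<close>; it is 0 because \<open>w\<close> is a
    preimage of the k-th basis vector. An index contributing to component k therefore differs from
    every \<iota> j with j < k.\<close>
  have w0: "w (\<iota> j) = 0" if j: "j < k" for j
  proof -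
    have "partial_deriv l (\<lambda>v. F (\<Psi> v) j) s = (if l = \<iota> j then 1 else 0)" if "l < a" for l
      using partial_deriv_cong[OF W F\<Psi>[OF _ j] s that] by (simp add: partial_deriv_coord)
    then have "(\<Sum>l<a. partial_deriv l (\<lambda>v. F (\<Psi> v) j) s * w l) =
        (\<Sum>l<a. if l = \<iota> j then w l else 0)"
      by (intro sum.cong) auto
    then show ?thesis using w[of j] j k \<iota>(2)[OF j] by simp
  qed
  have "(\<Sum>l<a. partial_deriv l G s * w l) \<noteq> 0"
    using w[OF k] by (simp add: G_def[abs_def])
  then obtain i where i: "i < a" and nz: "partial_deriv i G s \<noteq> 0" and "w i \<noteq> 0"
    by (metis (no_types, lifting) lessThan_iff mult_eq_0_iff sum.neutral)
  then have i\<iota>: "\<iota> j \<noteq> i" if "j < k" for j using w0[OF that] by auto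
  obtain W' \<phi> where W': "openin (Euclidean_space a) W'" "s(i := G s) \<in> W'" "\<phi> (s(i := G s)) = s i"
    "\<And>v. v \<in> W' \<Longrightarrow> v(i := \<phi> v) \<in> W" "\<And>v. v \<in> W' \<Longrightarrow> G (v(i := \<phi> v)) = v i"
    "Cinf_on a W' \<phi>"
    "\<And>l v. l < a \<Longrightarrow> v \<in> W' \<Longrightarrow> partial_deriv l \<phi> v =
      (if l = i then 1 else - partial_deriv l G (v(i := \<phi> v))) * inverse (partial_deriv i G (v(i := \<phi> v)))"
    by (rule scalar_implicit_function[OF W G s i nz]) blast
  let ?s = "s(i := G s)"
  let ?\<Psi> = "\<lambda>v. \<Psi> (v(i := \<phi> v))"
  let ?\<iota> = "\<iota>(k := i)"
  have restore: "?s(i := \<phi> ?s) = s" using W'(3) by simp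
  have upd: "Cinf_on a W' (\<lambda>v. (v(i := \<phi> v)) l)" for l
    using W'(6) Ck_on_fun_upd[OF W'(1)] unfolding Cinf_on_def by blast
  have "\<forall>l<a. Cinf_on a W' (\<lambda>v. ?\<Psi> v l)"
    by (intro allI impI Cinf_on_compose[where g="\<lambda>v. v(i := \<phi> v)", OF W'(1) W \<Psi> upd W'(4)])
  moreover have "full_rank_at a b (\<lambda>v. F (?\<Psi> v)) ?s"
  proof (rule full_rank_at_reparametrize[OF W'(1) W FC full' i W'(6,2) restore W'(4) nz])
    fix l assume "l < a"
    from W'(7)[OF this W'(2)] show "partial_deriv l \<phi> ?s =
        (if l = i then 1 else - partial_deriv l G s) * inverse (partial_deriv i G s)"
      unfolding restore .
  qed
  moreover have "inj_on ?\<iota> {..<Suc k}"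
    using \<iota>(1) i\<iota> by (auto simp: inj_on_def less_Suc_eq; blast)
  \<comment> \<open>The new change of variables alters coordinate i only, which no earlier component
    reads.\<close>
  moreover have "\<forall>v\<in>W'. \<forall>j<Suc k. F (?\<Psi> v) j = v (?\<iota> j)"
  proof (intro ballI allI impI)
    fix v j assume v: "v \<in> W'" and "j < Suc k"
    then consider "j < k" | "j = k" by linarith
    then show "F (?\<Psi> v) j = v (?\<iota> j)"
    proof cases
      case 1
      then show ?thesis using F\<Psi>[OF W'(4)[OF v] 1] i\<iota>[OF 1] by simp
    next
      case 2
      then show ?thesis using W'(5)[OF v] by (simp add: G_def)
    qed
  qed
  moreover have "\<forall>v\<in>W'. ?\<Psi> v \<in> S" using \<Psi>S W'(4) by blast
  moreover have "?\<Psi> ?s = u" unfolding restore by (rule \<Psi>s)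
  moreover have "\<forall>j<Suc k. ?\<iota> j < a" using \<iota>(2) i by (auto simp: less_Suc_eq)
  ultimately show ?case using W'(1,2)
    by (intro exI[of _ W'] exI[of _ ?s] exI[of _ ?\<Psi>] exI[of _ ?\<iota>] conjI)
qed

text \<open>Once all components are distinct coordinates of a parametrization, a section inserts the
  given values into these slots and freezes the remaining ones.\<close>

lemma full_rank_local_section:
  assumes S: "openin (Euclidean_space a) S" and F: "\<And>j. j < b \<Longrightarrow> Cinf_on a S (\<lambda>u. F u j)"
    and u: "u \<in> S" and full: "full_rank_at a b F u" and Fu: "F u \<in> Rn b"
  obtains T \<sigma> where "openin (Euclidean_space b) T" "F u \<in> T"
    "\<And>l. l < a \<Longrightarrow> Cinf_on b T (\<lambda>w. \<sigma> w l)" "\<And>w. w \<in> T \<Longrightarrow> \<sigma> w \<in> S"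
    "\<And>w j. w \<in> T \<Longrightarrow> j < b \<Longrightarrow> F (\<sigma> w) j = w j"
proof -
  from full_rank_straighten[where F=F, OF S F u full order.refl]
  obtain W s \<Psi> \<iota> where W: "openin (Euclidean_space a) W" and s: "s \<in> W"
    and \<Psi>: "\<And>l. l < a \<Longrightarrow> Cinf_on a W (\<lambda>v. \<Psi> v l)" and \<Psi>S: "\<And>v. v \<in> W \<Longrightarrow> \<Psi> v \<in> S"
    and \<Psi>s: "\<Psi> s = u" and \<iota>: "inj_on \<iota> {..<b}" "\<And>j. j < b \<Longrightarrow> \<iota> j < a"
    and F\<Psi>: "\<And>v j. v \<in> W \<Longrightarrow> j < b \<Longrightarrow> F (\<Psi> v) j = v (\<iota> j)"
    by blast
  \<comment> \<open>The free slots keep their values from \<open>s\<close>, so that the section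
    passes through \<open>u\<close> at \<open>F u\<close>.\<close>
  define E where "E w = (\<lambda>l. if l \<in> \<iota> ` {..<b} then w (the_inv_into {..<b} \<iota> l) else s l)"
    for w :: "nat \<Rightarrow> real"
  have E\<iota>: "E w (\<iota> j) = w j" if "j < b" for w j
    using that \<iota>(1) by (auto simp: E_def the_inv_into_f_f)
  have Ek: "Ck_on b k (Rn b) (\<lambda>w. E w l)" for k l
    by (cases "l \<in> \<iota> ` {..<b}") (simp_all add: E_def Ck_on_coord Ck_on_const openin_Rn_Rn)
  have ERn: "E w \<in> Rn a" for w
    using \<iota>(2) s openin_Rn_subset[OF W] by (fastforce simp: E_def)
  define T where "T = {w \<in> Rn b. E w \<in> W}"
  have T: "openin (Euclidean_space b) T" unfolding T_def
    by (rule openin_Rn_preimage_map[OF openin_Rn_Rn W Ck_on_continuous[OF Ek[of 0] openin_Rn_Rn] ERn])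
  have "E (F u) = s"
  proof
    fix l show "E (F u) l = s l"
    proof (cases "l \<in> \<iota> ` {..<b}")
      case True
      then show ?thesis using F\<Psi>[OF s] E\<iota> \<Psi>s by auto
    qed (simp add: E_def)
  qed
  then have "F u \<in> T" using s Fu by (simp add: T_def)
  moreover have "Cinf_on b T (\<lambda>w. \<Psi> (E w) l)" if "l < a" for l
  proof (rule Cinf_on_compose[where f="\<lambda>v. \<Psi> v l" and g=E, OF T W \<Psi>[OF that]])
    show "Cinf_on b T (\<lambda>w. E w j)" for j
      unfolding Cinf_on_def by (intro allI Ck_on_subset[OF Ek]) (auto simp: T_def)
  qed (simp add: T_def)
  moreover have "\<Psi> (E w) \<in> S" if "w \<in> T" for w using that \<Psi>S by (simp add: T_def)
  moreover have "F (\<Psi> (E w)) j = w j" if "w \<in> T" "j < b" for w j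
    using that F\<Psi>[of "E w" j] E\<iota> by (simp add: T_def)
  ultimately show thesis using that[of T "\<lambda>w. \<Psi> (E w)"] T by blast
qed

section \<open>Smooth functions, maps and tangent vectors\<close>

text \<open>Injective charts commute with intersections, which makes the predicate defining
  \<open>mtop\<close> a topology; without this the constant \<open>topology\<close> would give no
  information. Asking for injectivity alone makes the lemma applicable to the fibre product and to
  trivial circle bundles as well.\<close>

lemma openin_mtop_iff:
  assumes inj: "\<And>c. c \<in> atlas M \<Longrightarrow> inj_on (snd c) (fst c)"
  shows "openin (mtop M) W \<longleftrightarrow> W \<subseteq> pts M \<and>
    (\<forall>c\<in>atlas M. openin (Euclidean_space (mdim M)) (snd c ` (fst c \<inter> W)))"
proof -
  let ?L = "\<lambda>W. W \<subseteq> pts M \<and> (\<forall>(U, \<phi>)\<in>atlas M. openin (Euclidean_space (mdim M)) (\<phi> ` (U \<inter> W)))"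
  have "istopology ?L"
    unfolding istopology_def
  proof (intro conjI allI impI)
    fix S T assume ST: "?L S" "?L T"
    have "\<phi> ` (U \<inter> (S \<inter> T)) = \<phi> ` (U \<inter> S) \<inter> \<phi> ` (U \<inter> T)" if "(U, \<phi>) \<in> atlas M" for U \<phi>
      using inj[OF that] by (auto simp: inj_on_def)
    then show "S \<inter> T \<subseteq> pts M"
      "\<forall>(U, \<phi>)\<in>atlas M. openin (Euclidean_space (mdim M)) (\<phi> ` (U \<inter> (S \<inter> T)))"
      using ST by (auto 0 3 intro!: openin_Int)
  next
    fix \<K> assume K: "\<forall>K\<in>\<K>. ?L K"
    have "\<phi> ` (U \<inter> \<Union> \<K>) = (\<Union>K\<in>\<K>. \<phi> ` (U \<inter> K))" for U :: "'a set" and \<phi> :: "'a \<Rightarrow> nat \<Rightarrow> real"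
      by auto
    then show "\<Union> \<K> \<subseteq> pts M" "\<forall>(U, \<phi>)\<in>atlas M. openin (Euclidean_space (mdim M)) (\<phi> ` (U \<inter> \<Union> \<K>))"
      using K by (auto intro!: openin_Union)
  qed
  then have "openin (mtop M) W \<longleftrightarrow> ?L W"
    unfolding mtop_def by (simp add: topology_inverse')
  then show ?thesis by (simp add: case_prod_beta)
qed

lemma chart_inv_chart: "inj_on (snd c) (fst c) \<Longrightarrow> p \<in> fst c \<Longrightarrow> chart_inv c (snd c p) = p"
  by (simp add: chart_inv_def the_inv_into_f_f)

context
  fixes M :: "'a mfd"
  assumes M: "smooth_manifold M"
begin

lemma chart_inj: "c \<in> atlas M \<Longrightarrow> inj_on (snd c) (fst c)"
  using M by (auto simp: smooth_manifold_def)

lemma chart_inverse [simp]: "c \<in> atlas M \<Longrightarrow> p \<in> fst c \<Longrightarrow> chart_inv c (snd c p) = p"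
  by (rule chart_inv_chart[OF chart_inj])

lemma chart_domain_subset: "c \<in> atlas M \<Longrightarrow> fst c \<subseteq> pts M"
  using M unfolding smooth_manifold_def case_prod_beta by blast

lemma chart_at:
  assumes "p \<in> pts M"
  obtains c where "c \<in> atlas M" "p \<in> fst c"
proof -
  have "(\<Union>(U, \<phi>)\<in>atlas M. U) = pts M" using M by (simp add: smooth_manifold_def)
  then show thesis using assms that by fastforce
qed

lemma chart_compatible: "c \<in> atlas M \<Longrightarrow> d \<in> atlas M \<Longrightarrow> smooth_compatible (mdim M) c d"
  using M by (auto simp: smooth_manifold_def)

lemma openin_mtop_manifold:
  "openin (mtop M) W \<longleftrightarrow> W \<subseteq> pts M \<and>
    (\<forall>c\<in>atlas M. openin (Euclidean_space (mdim M)) (snd c ` (fst c \<inter> W)))"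
  by (rule openin_mtop_iff[OF chart_inj])

lemma openin_chart_image:
  "c \<in> atlas M \<Longrightarrow> openin (mtop M) W \<Longrightarrow> openin (Euclidean_space (mdim M)) (snd c ` (fst c \<inter> W))"
  by (simp add: openin_mtop_manifold)

lemma openin_chart_domain: "c \<in> atlas M \<Longrightarrow> openin (mtop M) (fst c)"
  using chart_compatible chart_domain_subset
  by (auto simp: openin_mtop_manifold smooth_compatible_def)

lemma openin_mtop_pts: "openin (mtop M) (pts M)"
  unfolding openin_mtop_manifold
proof (intro conjI ballI)
  fix c assume c: "c \<in> atlas M"
  then show "openin (Euclidean_space (mdim M)) (snd c ` (fst c \<inter> pts M))"
    using openin_chart_image[OF c openin_chart_domain[OF c]] chart_domain_subset[OF c]
    by (simp add: Int_absorb2)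
qed simp

lemma topspace_mtop: "topspace (mtop M) = pts M"
  using openin_mtop_pts openin_subset openin_mtop_manifold[of "topspace (mtop M)"] by fastforce

lemma chart_image_Rn: "c \<in> atlas M \<Longrightarrow> p \<in> fst c \<Longrightarrow> snd c p \<in> Rn (mdim M)"
  using openin_Rn_subset[OF openin_chart_image[OF _ openin_chart_domain]] by blast

lemma smooth_on_cong:
  assumes W: "openin (mtop M) W" and f: "smooth_on M W f" and eq: "\<And>p. p \<in> W \<Longrightarrow> f p = g p"
  shows "smooth_on M W g"
  unfolding smooth_on_def
proof
  fix c assume c: "c \<in> atlas M"
  show "Cinf_on (mdim M) (snd c ` (fst c \<inter> W)) (\<lambda>u. g (chart_inv c u))"
  proof (rule Cinf_on_cong[OF openin_chart_image[OF c W]])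
    show "Cinf_on (mdim M) (snd c ` (fst c \<inter> W)) (\<lambda>u. f (chart_inv c u))"
      using f c by (simp add: smooth_on_def)
  qed (use c eq in auto)
qed

lemma smooth_on_subset: "smooth_on M W f \<Longrightarrow> V \<subseteq> W \<Longrightarrow> smooth_on M V f"
  unfolding smooth_on_def by (meson Cinf_on_subset Int_mono image_mono order_refl)

lemma smooth_on_add:
  assumes "openin (mtop M) W" "smooth_on M W f" "smooth_on M W g"
  shows "smooth_on M W (\<lambda>p. f p + g p)"
  using assms(2,3) unfolding smooth_on_def Cinf_on_def
  by (intro ballI allI Ck_on_add openin_chart_image assms(1)) auto

lemma smooth_on_const: "openin (mtop M) W \<Longrightarrow> smooth_on M W (\<lambda>p. r)"
  unfolding smooth_on_def Cinf_on_def by (intro ballI allI Ck_on_const openin_chart_image)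

lemma smooth_on_mult:
  assumes "openin (mtop M) W" "smooth_on M W f" "smooth_on M W g"
  shows "smooth_on M W (\<lambda>p. f p * g p)"
  using assms(2,3) unfolding smooth_on_def Cinf_on_def
  by (intro ballI allI Ck_on_mult openin_chart_image assms(1)) auto

lemma smooth_on_chart: "d \<in> atlas M \<Longrightarrow> i < mdim M \<Longrightarrow> smooth_on M (fst d) (\<lambda>p. snd d p i)"
  using chart_compatible by (auto simp: smooth_on_def smooth_compatible_def)

lemma smooth_at_add:
  assumes "smooth_at M p f" "smooth_at M p g"
  shows "smooth_at M p (\<lambda>q. f q + g q)"
proof -
  obtain V W where "openin (mtop M) V" "p \<in> V" "smooth_on M V f" "openin (mtop M) W" "p \<in> W" "smooth_on M W g"
    using assms unfolding smooth_at_def by blast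
  then show ?thesis unfolding smooth_at_def
    by (intro exI[of _ "V \<inter> W"] conjI smooth_on_add openin_Int) (auto intro: smooth_on_subset)
qed

lemma smooth_at_cong:
  assumes "\<And>q. q \<in> pts M \<Longrightarrow> f q = g q"
  shows "smooth_at M p f \<longleftrightarrow> smooth_at M p g"
proof -
  have "smooth_on M W f \<longleftrightarrow> smooth_on M W g" if "openin (mtop M) W" for W
  proof -
    have "f p = g p" if "p \<in> W" for p
      using assms openin_mtop_manifold \<open>openin (mtop M) W\<close> that by blast
    then show ?thesis using smooth_on_cong[OF that, of f g] smooth_on_cong[OF that, of g f] by auto
  qed
  then show ?thesis unfolding smooth_at_def by blast
qed

lemma smooth_functions_smooth_at: "f \<in> smooth_functions M \<Longrightarrow> p \<in> pts M \<Longrightarrow> smooth_at M p f"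
  unfolding smooth_functions_def smooth_at_def using openin_mtop_pts by blast

lemma smooth_functions_add: "f \<in> smooth_functions M \<Longrightarrow> g \<in> smooth_functions M \<Longrightarrow> f + g \<in> smooth_functions M"
  using smooth_on_add[OF openin_mtop_pts] by (simp add: smooth_functions_def plus_fun_def)

lemma smooth_functions_zero: "0 \<in> smooth_functions M"
  using smooth_on_const[OF openin_mtop_pts] by (simp add: smooth_functions_def zero_fun_def)

lemma smooth_functions_uminus: "f \<in> smooth_functions M \<Longrightarrow> - f \<in> smooth_functions M"
  using smooth_on_mult[OF openin_mtop_pts smooth_on_const[OF openin_mtop_pts, of "-1"]]
  by (fastforce simp: smooth_functions_def fun_Compl_def)

end

lemma smooth_map_preimage_open:
  assumes "smooth_manifold M" "smooth_map M N F" "openin (mtop N) W"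
  shows "openin (mtop M) {p \<in> pts M. F p \<in> W}"
  using openin_continuous_map_preimage[of "mtop M" "mtop N" F W] assms
  by (simp add: smooth_map_def topspace_mtop)

lemma smooth_map_in_pts:
  assumes "smooth_manifold M" "smooth_manifold N" "smooth_map M N F" "p \<in> pts M"
  shows "F p \<in> pts N"
  using continuous_map_image_subset_topspace[of "mtop M" "mtop N" F] assms
  by (auto simp: smooth_map_def topspace_mtop)

text \<open>Smoothness of \<open>F\<close> is given chart by chart, so near each point the composite
  is factored through a chart of \<open>N\<close> around the image point, and the pieces are glued
  by locality.\<close>

lemma smooth_on_compose:
  assumes M: "smooth_manifold M" and N: "smooth_manifold N" and F: "smooth_map M N F"
    and W: "openin (mtop N) W" and f: "smooth_on N W f"
  shows "smooth_on M {p \<in> pts M. F p \<in> W} (\<lambda>p. f (F p))"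
  unfolding smooth_on_def
proof
  fix c assume c: "c \<in> atlas M"
  show "Cinf_on (mdim M) (snd c ` (fst c \<inter> {p \<in> pts M. F p \<in> W})) (\<lambda>u. f (F (chart_inv c u)))"
  proof (rule Cinf_on_local[OF openin_chart_image[OF M c smooth_map_preimage_open[OF M F W]]])
    fix u assume "u \<in> snd c ` (fst c \<inter> {p \<in> pts M. F p \<in> W})"
    then obtain p where p: "u = snd c p" "p \<in> fst c" "p \<in> pts M" "F p \<in> W" by auto
    obtain d where d: "d \<in> atlas N" "F p \<in> fst d"
      by (rule chart_at[OF N smooth_map_in_pts[OF M N F p(3)]])
    let ?T = "snd c ` (fst c \<inter> {p \<in> pts M. F p \<in> fst d \<inter> W})"
    have dW: "openin (mtop N) (fst d \<inter> W)"
      by (rule openin_Int[OF openin_chart_domain[OF N d(1)] W])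
    have T: "openin (Euclidean_space (mdim M)) ?T"
      by (rule openin_chart_image[OF M c smooth_map_preimage_open[OF M F dW]])
    have "Cinf_on (mdim M) ?T (\<lambda>u. f (chart_inv d (snd d (F (chart_inv c u)))))"
    proof (rule Cinf_on_compose[where g="\<lambda>u. snd d (F (chart_inv c u))" and f="\<lambda>u. f (chart_inv d u)",
          OF T openin_chart_image[OF N d(1) W]])
      show "Cinf_on (mdim N) (snd d ` (fst d \<inter> W)) (\<lambda>u. f (chart_inv d u))"
        using f d(1) by (simp add: smooth_on_def)
    next
      fix j assume "j < mdim N"
      then have "Cinf_on (mdim M) (snd c ` {p \<in> fst c. F p \<in> fst d}) (\<lambda>u. snd d (F (chart_inv c u)) j)"
        using F c d(1) by (simp add: smooth_map_def)
      then show "Cinf_on (mdim M) ?T (\<lambda>u. snd d (F (chart_inv c u)) j)"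
        by (rule Cinf_on_subset) auto
    next
      fix u assume "u \<in> ?T"
      then show "snd d (F (chart_inv c u)) \<in> snd d ` (fst d \<inter> W)"
        using chart_inverse[OF M c] by auto
    qed
    then have "Cinf_on (mdim M) ?T (\<lambda>u. f (F (chart_inv c u)))"
      by (rule Cinf_on_cong[OF T, rotated]) (use chart_inverse[OF M c] chart_inverse[OF N d(1)] in auto)
    then show "\<exists>T. openin (Euclidean_space (mdim M)) T \<and> u \<in> T \<and>
        Cinf_on (mdim M) T (\<lambda>u. f (F (chart_inv c u)))"
      using T p d(2) by blast
  qed
qed

lemma smooth_at_compose:
  assumes M: "smooth_manifold M" and N: "smooth_manifold N" and F: "smooth_map M N F"
    and p: "p \<in> pts M" and f: "smooth_at N (F p) f"
  shows "smooth_at M p (\<lambda>p. f (F p))"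
proof -
  obtain W where W: "openin (mtop N) W" "F p \<in> W" "smooth_on N W f"
    using f unfolding smooth_at_def by blast
  then show ?thesis unfolding smooth_at_def
    using smooth_map_preimage_open[OF M F W(1)] smooth_on_compose[OF M N F W(1,3)] p by blast
qed

lemma pullback_fun_smooth:
  assumes M: "smooth_manifold M" and N: "smooth_manifold N" and F: "smooth_map M N F"
    and f: "f \<in> smooth_functions N"
  shows "pullback_fun M F f \<in> smooth_functions M"
proof -
  have "{p \<in> pts M. F p \<in> pts N} = pts M" using smooth_map_in_pts[OF M N F] by blast
  then have "smooth_on M (pts M) (\<lambda>p. f (F p))"
    using smooth_on_compose[OF M N F openin_mtop_pts[OF N], of f] f by (simp add: smooth_functions_def)
  then have "smooth_on M (pts M) (pullback_fun M F f)"
    by (rule smooth_on_cong[OF M openin_mtop_pts[OF M]]) (simp add: pullback_fun_def)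
  then show ?thesis by (simp add: smooth_functions_def pullback_fun_def)
qed

section \<open>Curves and their velocities\<close>

definition line_chart :: "real \<Rightarrow> nat \<Rightarrow> real"
  where "line_chart t = (\<lambda>i. if i = 0 then t else 0)"

lemma atlas_open_line: "atlas (open_submfd real_line I) = {(I, line_chart)}"
  by (simp add: open_submfd_def real_line_def line_chart_def[abs_def])

lemma pts_open_line: "pts (open_submfd real_line I) = I"
  and mdim_open_line: "mdim (open_submfd real_line I) = Suc 0"
  by (simp_all add: open_submfd_def real_line_def)

lemma line_chart_inj: "inj_on line_chart I"
  by (auto simp: inj_on_def line_chart_def fun_eq_iff)

lemma line_chart_inverse: "t \<in> I \<Longrightarrow> chart_inv (I, line_chart) (line_chart t) = t"
  using chart_inv_chart[of "(I, line_chart)" t] by (simp add: line_chart_inj)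

lemma line_chart_image: "line_chart ` W = {u \<in> Rn (Suc 0). u 0 \<in> W}"
proof -
  have "u = line_chart (u 0)" if "u \<in> Rn (Suc 0)" for u
    using that by (auto simp: line_chart_def fun_eq_iff)
  then show ?thesis by (auto simp: line_chart_def)
qed

lemma openin_line_chart_image: "openin (Euclidean_space (Suc 0)) (line_chart ` W) \<longleftrightarrow> open W"
proof
  assume "openin (Euclidean_space (Suc 0)) (line_chart ` W)"
  then have "open {t. (\<lambda>_. 0)(0 := t) \<in> line_chart ` W}"
    by (rule openin_Rn_slice) auto
  then show "open W" by (simp add: line_chart_image)
next
  assume "open W"
  then show "openin (Euclidean_space (Suc 0)) (line_chart ` W)"
    unfolding line_chart_image by (intro openin_Rn_vimage continuous_on_coordinate)
qed

lemma openin_open_line: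
  assumes "open I"
  shows "openin (mtop (open_submfd real_line I)) W \<longleftrightarrow> W \<subseteq> I \<and> open W"
proof -
  have "openin (mtop (open_submfd real_line I)) W \<longleftrightarrow> W \<subseteq> I \<and> open (I \<inter> W)"
    by (subst openin_mtop_iff)
      (auto simp: atlas_open_line pts_open_line mdim_open_line line_chart_inj openin_line_chart_image)
  then show ?thesis by (metis Int_absorb1)
qed

lemma topspace_open_line:
  assumes "open I"
  shows "topspace (mtop (open_submfd real_line I)) = I"
  using openin_open_line[OF assms] by (metis openin_subset openin_topspace order_refl subset_antisym assms)

text \<open>Translates a smooth map from an interval, itself a manifold with the single chart
  \<open>line_chart\<close>, into ordinary one-variable facts at time 0.\<close>

lemma smooth_curve:
  assumes M: "smooth_manifold M" and c: "smooth_map (open_submfd real_line I) M c"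
    and I: "open I" "0 \<in> I"
  shows "\<And>t. t \<in> I \<Longrightarrow> c t \<in> pts M"
    and "openin (mtop M) W \<Longrightarrow> c 0 \<in> W \<Longrightarrow> \<forall>\<^sub>F t in nhds 0. c t \<in> W"
    and "d \<in> atlas M \<Longrightarrow> c 0 \<in> fst d \<Longrightarrow> i < mdim M \<Longrightarrow> (\<lambda>t. snd d (c t) i) field_differentiable at 0"
proof -
  have cont: "continuous_map (mtop (open_submfd real_line I)) (mtop M) c"
    using c by (simp add: smooth_map_def)
  show "c t \<in> pts M" if "t \<in> I" for t
    using continuous_map_image_subset_topspace[OF cont] that
    by (auto simp: topspace_open_line[OF I(1)] topspace_mtop[OF M])
  have near: "\<forall>\<^sub>F t in nhds 0. c t \<in> W" if W: "openin (mtop M) W" "c 0 \<in> W" for W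
  proof -
    have "open {t \<in> I. c t \<in> W}"
      using openin_continuous_map_preimage[OF cont W(1)]
      by (simp add: openin_open_line[OF I(1)] topspace_open_line[OF I(1)])
    from eventually_nhds_in_open[OF this, of 0] show ?thesis
      using I W(2) by (auto elim: eventually_mono)
  qed
  then show "openin (mtop M) W \<Longrightarrow> c 0 \<in> W \<Longrightarrow> \<forall>\<^sub>F t in nhds 0. c t \<in> W" .
  assume d: "d \<in> atlas M" "c 0 \<in> fst d" and i: "i < mdim M"
  let ?f = "\<lambda>u. snd d (c (chart_inv (I, line_chart) u)) i"
  have "Cinf_on (Suc 0) (line_chart ` {t \<in> I. c t \<in> fst d}) ?f"
    using c d(1) i by (simp add: smooth_map_def atlas_open_line mdim_open_line)
  then have "Ck_on (Suc 0) (Suc 0) (line_chart ` {t \<in> I. c t \<in> fst d}) ?f"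
    by (simp only: Cinf_on_def)
  moreover have "line_chart 0 \<in> line_chart ` {t \<in> I. c t \<in> fst d}" using d(2) I(2) by auto
  ultimately have "((\<lambda>t. ?f ((line_chart 0)(0 := t))) has_field_derivative partial_deriv 0 ?f (line_chart 0))
      (at (line_chart 0 0))"
    using Ck_on_Suc_D(1) by blast
  moreover have "(line_chart 0)(0 := t) = line_chart t" "line_chart 0 0 = 0" for t
    by (auto simp: line_chart_def)
  ultimately have "((\<lambda>t. ?f (line_chart t)) has_field_derivative partial_deriv 0 ?f (line_chart 0)) (at 0)"
    by (simp only:)
  moreover have ev: "\<forall>\<^sub>F t in nhds 0. ?f (line_chart t) = snd d (c t) i"
    using eventually_nhds_in_open[OF I] by eventually_elim (simp add: line_chart_inverse)
  ultimately have "((\<lambda>t. snd d (c t) i) has_field_derivative partial_deriv 0 ?f (line_chart 0)) (at 0)"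
    by (simp only: DERIV_cong_ev[OF refl ev refl])
  then show "(\<lambda>t. snd d (c t) i) field_differentiable at 0"
    unfolding field_differentiable_def by blast
qed

text \<open>Exhibits a velocity as a directional derivative, a row of partial derivatives paired
  with coordinate velocities; this links tangent vectors to Jacobians.\<close>

lemma smooth_curve_chain:
  assumes M: "smooth_manifold M" and c: "smooth_map (open_submfd real_line I) M c"
    and I: "open I" "0 \<in> I" and d: "d \<in> atlas M" "c 0 \<in> fst d"
    and W: "openin (mtop M) W" "c 0 \<in> W" and f: "smooth_on M W f"
  shows "((\<lambda>t. f (c t)) has_field_derivative
    (\<Sum>i<mdim M. partial_deriv i (\<lambda>u. f (chart_inv d u)) (snd d (c 0)) * deriv (\<lambda>t. snd d (c t) i) 0)) (at 0)"
proof -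
  let ?g = "\<lambda>u. f (chart_inv d u)"
  note near = smooth_curve(2)[OF M c I openin_chart_domain[OF M d(1)] d(2)]
  have "Cinf_on (mdim M) (snd d ` (fst d \<inter> W)) ?g" using f d(1) by (simp add: smooth_on_def)
  then have g: "Ck_on (mdim M) (Suc 0) (snd d ` (fst d \<inter> W)) ?g" by (simp only: Cinf_on_def)
  have "((\<lambda>t. ?g (snd d (c t))) has_field_derivative
    (\<Sum>i<mdim M. partial_deriv i ?g (snd d (c 0)) * deriv (\<lambda>t. snd d (c t) i) 0)) (at 0)"
  proof (rule Ck_on_chain_curve[OF openin_chart_image[OF M d(1) W(1)] g])
    show "snd d (c 0) \<in> snd d ` (fst d \<inter> W)" using d W by blast
    show "((\<lambda>t. snd d (c t) i) has_real_derivative deriv (\<lambda>t. snd d (c t) i) 0) (at 0)"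
      if "i < mdim M" for i
      using smooth_curve(3)[OF M c I d that] by (simp add: DERIV_deriv_iff_field_differentiable)
    show "\<forall>\<^sub>F t in at 0. snd d (c t) \<in> Rn (mdim M)"
      using near unfolding eventually_nhds_conv_at
      by (auto elim!: eventually_mono simp: chart_image_Rn[OF M d(1), simplified])
  qed
  moreover have ev: "\<forall>\<^sub>F t in nhds 0. ?g (snd d (c t)) = f (c t)"
    using near by eventually_elim (simp add: chart_inverse[OF M d(1)])
  ultimately show ?thesis by (simp only: DERIV_cong_ev[OF refl ev refl])
qed

lemma tangentE:
  assumes "v \<in> tangent M p"
  obtains c I where "open I" "0 \<in> I" "smooth_map (open_submfd real_line I) M c" "c 0 = p" "v = velocity M c"
proof -
  obtain c e where c: "e > 0" "smooth_map (open_submfd real_line {-e<..<e}) M c" "c 0 = p" "v = velocity M c"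
    using assms by (auto simp: tangent_def)
  show thesis by (rule that[OF _ _ c(2,3,4)]) (use c(1) in auto)
qed

text \<open>Smoothness guarantees that all three values are genuine derivatives of differentiable
  functions rather than the default 0.\<close>

lemma tangent_add:
  assumes M: "smooth_manifold M" and v: "v \<in> tangent M p"
    and f: "smooth_at M p f" and g: "smooth_at M p g"
  shows "v (f + g) = v f + v g"
proof -
  obtain c I where I: "open I" "0 \<in> I" and c: "smooth_map (open_submfd real_line I) M c" "c 0 = p"
    and v: "v = velocity M c" using tangentE[OF v] .
  have "p \<in> pts M" using smooth_curve(1)[OF M c(1) I I(2)] c(2) by simp
  then obtain d where d: "d \<in> atlas M" "c 0 \<in> fst d" using chart_at[OF M] c(2) by metis
  have diff: "(\<lambda>t. f (c t)) field_differentiable at 0" if "smooth_at M p f" for f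
  proof -
    have "smooth_at M (c 0) f" using that c(2) by simp
    then obtain W where "openin (mtop M) W" "c 0 \<in> W" "smooth_on M W f"
      unfolding smooth_at_def by blast
    from smooth_curve_chain[OF M c(1) I d this] show ?thesis
      unfolding field_differentiable_def by blast
  qed
  show ?thesis unfolding v velocity_def plus_fun_def
    using diff[OF f] diff[OF g] f g smooth_at_add[OF M f g] c(2)
    by (simp add: deriv_add)
qed

text \<open>A curve in \<open>M\<close> sees a function only on \<open>pts M\<close>. This
  reconciles extension by 0, as in \<open>pullback_fun\<close>, with plain composition.\<close>

lemma tangent_cong:
  assumes M: "smooth_manifold M" and v: "v \<in> tangent M p"
    and eq: "\<And>q. q \<in> pts M \<Longrightarrow> f q = g q"
  shows "v f = v g"
proof -
  obtain c I where I: "open I" "0 \<in> I" and c: "smooth_map (open_submfd real_line I) M c" "c 0 = p"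
    and v: "v = velocity M c" using tangentE[OF v] .
  have "\<forall>\<^sub>F t in nhds 0. f (c t) = g (c t)"
    using eventually_nhds_in_open[OF I] by eventually_elim (use eq smooth_curve(1)[OF M c(1) I] in auto)
  then have "deriv (\<lambda>t. f (c t)) 0 = deriv (\<lambda>t. g (c t)) 0" by (rule deriv_cong_ev) simp
  then show ?thesis unfolding v velocity_def using smooth_at_cong[OF M, of f g] eq by simp
qed

section \<open>Submersions and circle bundles\<close>

text \<open>Realizes the j-th coordinate vector as a velocity, as needed to test surjectivity of a
  differential on coordinate directions.\<close>

lemma coordinate_curve:
  assumes M: "smooth_manifold M" and d: "d \<in> atlas M" and p: "p \<in> fst d" and j: "j < mdim M"
  obtains e where "e > 0" "smooth_map (open_submfd real_line {-e<..<e}) M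
    (\<lambda>t. chart_inv d ((snd d p)(j := snd d p j + t)))"
    "\<And>t. t \<in> {-e<..<e} \<Longrightarrow> (snd d p)(j := snd d p j + t) \<in> snd d ` fst d"
proof -
  define u where "u = snd d p"
  define g where "g t = u(j := u j + t)" for t
  have uRn: "u \<in> Rn (mdim M)" unfolding u_def by (rule chart_image_Rn[OF M d p])
  have op: "open {t. g t \<in> snd d ` (fst d \<inter> W)}" if "openin (mtop M) W" for W
  proof -
    have "open {t. u(j := t) \<in> snd d ` (fst d \<inter> W)}"
      by (rule openin_Rn_slice[OF openin_chart_image[OF M d that] j uRn])
    then have "open ((\<lambda>t. u j + t) -` {t. u(j := t) \<in> snd d ` (fst d \<inter> W)})"
      by (intro open_vimage continuous_intros)
    then show ?thesis by (simp add: g_def vimage_def)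
  qed
  have "0 \<in> {t. g t \<in> snd d ` (fst d \<inter> fst d)}" using p by (simp add: g_def u_def)
  with op[OF openin_chart_domain[OF M d]] obtain e where e: "e > 0"
    "\<And>t. \<bar>t\<bar> < e \<Longrightarrow> g t \<in> snd d ` fst d"
    unfolding open_dist by (force simp: dist_real_def)
  let ?I = "{-e<..<e}"
  let ?c = "\<lambda>t. chart_inv d (g t)"
  have gI: "g t \<in> snd d ` fst d" if "t \<in> ?I" for t using that e(2)[of t] by auto
  have cin: "?c t \<in> fst d" "snd d (?c t) = g t" if "t \<in> ?I" for t
    using gI[OF that] chart_inverse[OF M d] by auto
  \<comment> \<open>Chart injectivity turns membership of the curve in \<open>W\<close> into
    membership of a straight line in the chart image, so preimages of open sets become open
    slices.\<close>
  have iff: "?c t \<in> W \<longleftrightarrow> g t \<in> snd d ` (fst d \<inter> W)" if t: "t \<in> ?I" for t W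
  proof -
    obtain q where q: "q \<in> fst d" "g t = snd d q" using gI[OF t] by auto
    then have "q \<in> W" if "snd d q \<in> snd d ` (fst d \<inter> W)"
      using that inj_onD[OF chart_inj[OF M d]] by auto
    then show ?thesis using q chart_inverse[OF M d q(1)] by auto
  qed
  have pre: "open {t \<in> ?I. ?c t \<in> W}" if "openin (mtop M) W" for W
  proof -
    have "{t \<in> ?I. ?c t \<in> W} = ?I \<inter> {t. g t \<in> snd d ` (fst d \<inter> W)}" using iff by blast
    then show ?thesis using open_Int[OF open_greaterThanLessThan op[OF that], of "-e" e] by (simp only:)
  qed
  have I: "open ?I" by simp
  have "smooth_map (open_submfd real_line ?I) M ?c"
    unfolding smooth_map_def
  proof (intro conjI ballI allI impI)
    show "continuous_map (mtop (open_submfd real_line ?I)) (mtop M) ?c"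
      unfolding continuous_map_def topspace_open_line[OF I] openin_open_line[OF I] topspace_mtop[OF M]
      using pre chart_domain_subset[OF M d] cin by blast
  next
    fix ch d' i assume ch: "ch \<in> atlas (open_submfd real_line ?I)" and d': "d' \<in> atlas M" and i: "i < mdim M"
    have ch: "ch = (?I, line_chart)" using ch by (simp add: atlas_open_line)
    let ?S = "line_chart ` {t \<in> ?I. ?c t \<in> fst d'}"
    have S: "openin (Euclidean_space (Suc 0)) ?S"
      using pre[OF openin_chart_domain[OF M d']] by (simp only: openin_line_chart_image)
    have "Cinf_on (Suc 0) ?S (\<lambda>u. snd d' (chart_inv d (g (u 0))) i)"
    proof (rule Cinf_on_compose[where g="\<lambda>u. g (u 0)" and f="\<lambda>w. snd d' (chart_inv d w) i", OF S])
      show "openin (Euclidean_space (mdim M)) (snd d ` (fst d \<inter> fst d'))"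
        by (rule openin_chart_image[OF M d openin_chart_domain[OF M d']])
      show "Cinf_on (mdim M) (snd d ` (fst d \<inter> fst d')) (\<lambda>w. snd d' (chart_inv d w) i)"
        using chart_compatible[OF M d d'] i by (simp add: smooth_compatible_def)
      show "Cinf_on (Suc 0) ?S (\<lambda>w. g (w 0) l)" for l
      proof -
        have "Cinf_on (Suc 0) ?S (\<lambda>w. u j + w 0)" "Cinf_on (Suc 0) ?S (\<lambda>w. u l)"
          unfolding Cinf_on_def by (intro allI Ck_on_add[OF S] Ck_on_const[OF S] Ck_on_coord[OF S])+
        moreover have "(\<lambda>w :: nat \<Rightarrow> real. g (w 0) l) = (if l = j then \<lambda>w. u j + w 0 else (\<lambda>w. u l))"
          by (simp add: g_def)
        ultimately show ?thesis by presburger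
      qed
      show "g (w 0) \<in> snd d ` (fst d \<inter> fst d')" if "w \<in> ?S" for w
        using that iff by (auto simp: line_chart_def)
    qed
    then have "Cinf_on (Suc 0) ?S (\<lambda>u. snd d' (?c (chart_inv (?I, line_chart) u)) i)"
      by (rule Cinf_on_cong[OF S, rotated]) (auto simp: line_chart_inverse, simp add: line_chart_def)
    then show "Cinf_on (mdim (open_submfd real_line ?I)) (snd ch ` {t \<in> fst ch. ?c t \<in> fst d'})
        (\<lambda>u. snd d' (?c (chart_inv ch u)) i)"
      by (simp add: ch mdim_open_line)
  qed
  then show thesis using that[of e] e(1) gI unfolding g_def u_def by blast
qed

text \<open>Surjectivity on tangent spaces lifts the velocity of a coordinate curve in
  \<open>M\<close> to the velocity of a curve in \<open>X\<close>. Evaluating both on the coordinate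
  functions of \<open>d\<close> shows that the coordinate velocities of the lift form the required
  column.\<close>

lemma submersion_full_rank:
  assumes X: "smooth_manifold X" and M: "smooth_manifold M" and \<pi>: "surjective_submersion X M \<pi>"
    and c: "c \<in> atlas X" "y \<in> fst c" and d: "d \<in> atlas M" "\<pi> y \<in> fst d"
  shows "full_rank_at (mdim X) (mdim M) (\<lambda>u. snd d (\<pi> (chart_inv c u))) (snd c y)"
  unfolding full_rank_at_def
proof (intro allI impI)
  fix j assume j: "j < mdim M"
  have sm: "smooth_map X M \<pi>" using \<pi> by (simp add: surjective_submersion_def)
  have y: "y \<in> pts X" using c chart_domain_subset[OF X] by blast
  obtain e where e: "e > 0" "smooth_map (open_submfd real_line {-e<..<e}) M
      (\<lambda>t. chart_inv d ((snd d (\<pi> y))(j := snd d (\<pi> y) j + t)))"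
    "\<And>t. t \<in> {-e<..<e} \<Longrightarrow> (snd d (\<pi> y))(j := snd d (\<pi> y) j + t) \<in> snd d ` fst d"
    by (rule coordinate_curve[OF M d j]) blast
  define b where "b t = chart_inv d ((snd d (\<pi> y))(j := snd d (\<pi> y) j + t))" for t
  have b0: "b 0 = \<pi> y" using chart_inverse[OF M d] by (simp add: b_def)
  have "velocity M b \<in> tangent M (\<pi> y)"
    unfolding tangent_def using e(1,2) b0 unfolding b_def[abs_def] by blast
  then obtain v where v: "v \<in> tangent X y" "dmap M \<pi> y v = velocity M b"
    using \<pi> y unfolding surjective_submersion_def by (metis (no_types, lifting) imageE)
  obtain c' I where I: "open I" "0 \<in> I" and c': "smooth_map (open_submfd real_line I) X c'" "c' 0 = y"
    and v': "v = velocity X c'" using tangentE[OF v(1)] .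
  have "(\<Sum>l<mdim X. partial_deriv l (\<lambda>u. snd d (\<pi> (chart_inv c u)) j') (snd c y) *
      deriv (\<lambda>t. snd c (c' t) l) 0) = (if j' = j then 1 else 0)" if j': "j' < mdim M" for j'
  proof -
    let ?f = "\<lambda>q. snd d q j'"
    note f = smooth_on_chart[OF M d(1) j']
    have at: "smooth_at M (\<pi> y) ?f" unfolding smooth_at_def
      using openin_chart_domain[OF M d(1)] d(2) f by blast
    have "c' 0 \<in> fst c" "c' 0 \<in> {p \<in> pts X. \<pi> p \<in> fst d}" using c(2) c'(2) y d(2) by auto
    note chain = smooth_curve_chain[OF X c'(1) I c(1) this(1)
        smooth_map_preimage_open[OF X sm openin_chart_domain[OF M d(1)]] this(2)
        smooth_on_compose[OF X M sm openin_chart_domain[OF M d(1)] f]]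
    have "(\<Sum>l<mdim X. partial_deriv l (\<lambda>u. snd d (\<pi> (chart_inv c u)) j') (snd c y) *
        deriv (\<lambda>t. snd c (c' t) l) 0) = deriv (\<lambda>t. ?f (\<pi> (c' t))) 0"
      using DERIV_imp_deriv[OF chain] unfolding c'(2) by (rule sym)
    also have "\<dots> = dmap M \<pi> y v ?f"
      unfolding dmap_def v' velocity_def using at smooth_at_compose[OF X M sm y at] c'(2) by simp
    also have "\<dots> = deriv (\<lambda>t. ?f (b t)) 0" unfolding v(2) velocity_def using at b0 by simp
    also have "\<dots> = (if j' = j then 1 else 0)"
    proof (rule DERIV_imp_deriv)
      have near: "\<forall>\<^sub>F t in nhds 0. t \<in> {-e<..<e}"
        by (rule eventually_nhds_in_open) (use e(1) in auto)
      have ev: "\<forall>\<^sub>F t in nhds 0. ?f (b t) = snd d (\<pi> y) j' + (if j' = j then t else 0)"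
        using near
      proof eventually_elim
        case (elim t)
        then have "(snd d (\<pi> y))(j := snd d (\<pi> y) j + t) \<in> snd d ` fst d" using e(3)[of t] by simp
        then obtain q where "q \<in> fst d" "snd d q = (snd d (\<pi> y))(j := snd d (\<pi> y) j + t)" by auto
        then have "snd d (b t) = (snd d (\<pi> y))(j := snd d (\<pi> y) j + t)"
          unfolding b_def using chart_inverse[OF M d(1), of q] by metis
        then show "?f (b t) = snd d (\<pi> y) j' + (if j' = j then t else 0)" by simp
      qed
      have "((\<lambda>t. snd d (\<pi> y) j' + (if j' = j then t else 0)) has_field_derivative
          (if j' = j then 1 else 0)) (at 0)"
        by (cases "j' = j") (auto intro!: derivative_eq_intros)
      then show "((\<lambda>t. ?f (b t)) has_field_derivative (if j' = j then 1 else 0)) (at 0)"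
        by (simp only: DERIV_cong_ev[OF refl ev refl])
    qed
    finally show ?thesis .
  qed
  then show "\<exists>w. \<forall>j'<mdim M. (\<Sum>l<mdim X. partial_deriv l (\<lambda>u. snd d (\<pi> (chart_inv c u)) j') (snd c y) * w l) =
      (if j' = j then 1 else 0)"
    by (intro exI[of _ "\<lambda>l. deriv (\<lambda>t. snd c (c' t) l) 0"]) blast
qed

text \<open>With a smooth local section \<sigma> of \<pi>, locally h is the composite of h o \<pi>
  with \<sigma>.\<close>

lemma smooth_on_descend:
  assumes X: "smooth_manifold X" and M: "smooth_manifold M" and \<pi>: "surjective_submersion X M \<pi>"
    and W: "openin (mtop M) W" and h: "smooth_on X {y \<in> pts X. \<pi> y \<in> W} (\<lambda>y. h (\<pi> y))"
  shows "smooth_on M W h"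
  unfolding smooth_on_def
proof
  have sm: "smooth_map X M \<pi>" using \<pi> by (simp add: surjective_submersion_def)
  fix d assume d: "d \<in> atlas M"
  show "Cinf_on (mdim M) (snd d ` (fst d \<inter> W)) (\<lambda>u. h (chart_inv d u))"
  proof (rule Cinf_on_local[OF openin_chart_image[OF M d W]])
    fix w assume "w \<in> snd d ` (fst d \<inter> W)"
    then obtain m where m: "w = snd d m" "m \<in> fst d" "m \<in> W" by auto
    then have "m \<in> \<pi> ` pts X"
      using \<pi> chart_domain_subset[OF M d] unfolding surjective_submersion_def by auto
    then obtain y where y: "y \<in> pts X" "\<pi> y = m" by auto
    obtain c where c: "c \<in> atlas X" "y \<in> fst c" by (rule chart_at[OF X y(1)])
    have dW: "openin (mtop M) (fst d \<inter> W)" by (rule openin_Int[OF openin_chart_domain[OF M d] W])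
    let ?S = "snd c ` (fst c \<inter> {y \<in> pts X. \<pi> y \<in> fst d \<inter> W})"
    let ?F = "\<lambda>u. snd d (\<pi> (chart_inv c u))"
    have S: "openin (Euclidean_space (mdim X)) ?S"
      by (rule openin_chart_image[OF X c(1) smooth_map_preimage_open[OF X sm dW]])
    have F: "Cinf_on (mdim X) ?S (\<lambda>u. ?F u j)" if "j < mdim M" for j
    proof -
      have "Cinf_on (mdim X) (snd c ` {p \<in> fst c. \<pi> p \<in> fst d}) (\<lambda>u. ?F u j)"
        using sm c(1) d that by (simp add: smooth_map_def)
      then show ?thesis by (rule Cinf_on_subset) auto
    qed
    have yS: "snd c y \<in> ?S" using c y m by blast
    have Fy: "?F (snd c y) = w" using c y m(1) by (simp add: chart_inverse[OF X])
    have full: "full_rank_at (mdim X) (mdim M) ?F (snd c y)"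
      by (rule submersion_full_rank[OF X M \<pi> c d]) (use y m in simp)
    have Rn: "?F (snd c y) \<in> Rn (mdim M)" unfolding Fy m(1) by (rule chart_image_Rn[OF M d m(2)])
    show "\<exists>T. openin (Euclidean_space (mdim M)) T \<and> w \<in> T \<and> Cinf_on (mdim M) T (\<lambda>u. h (chart_inv d u))"
    proof (rule full_rank_local_section[where F="?F", OF S F yS full Rn])
      fix T \<sigma>
      assume T: "openin (Euclidean_space (mdim M)) T" "?F (snd c y) \<in> T"
        and \<sigma>: "\<And>l. l < mdim X \<Longrightarrow> Cinf_on (mdim M) T (\<lambda>w. \<sigma> w l)" "\<And>w. w \<in> T \<Longrightarrow> \<sigma> w \<in> ?S"
          "\<And>w j. w \<in> T \<Longrightarrow> j < mdim M \<Longrightarrow> ?F (\<sigma> w) j = w j"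
      \<comment> \<open>The section property concerns the first \<open>mdim M\<close> coordinates
        only; the others vanish on both sides, so the points agree by injectivity of the
        chart.\<close>
      have \<sigma>\<pi>: "\<pi> (chart_inv c (\<sigma> w)) = chart_inv d w" if w: "w \<in> T" for w
      proof -
        obtain z where z: "z \<in> fst c" "\<pi> z \<in> fst d" "\<sigma> w = snd c z" using \<sigma>(2)[OF w] by auto
        have "snd d (\<pi> z) \<in> Rn (mdim M)" by (rule chart_image_Rn[OF M d z(2)])
        moreover have "w \<in> Rn (mdim M)" using w openin_Rn_subset[OF T(1)] by blast
        moreover have "snd d (\<pi> z) j = w j" if "j < mdim M" for j
          using \<sigma>(3)[OF w that] z by (simp add: chart_inverse[OF X c(1)])
        ultimately have "snd d (\<pi> z) j = w j" for j by (cases "j < mdim M") auto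
        then have "snd d (\<pi> z) = w" by blast
        then show ?thesis using z chart_inverse[OF X c(1)] chart_inverse[OF M d] by metis
      qed
      have "Cinf_on (mdim X) ?S (\<lambda>u. h (\<pi> (chart_inv c u)))"
      proof (rule Cinf_on_subset)
        show "Cinf_on (mdim X) (snd c ` (fst c \<inter> {y \<in> pts X. \<pi> y \<in> W})) (\<lambda>u. h (\<pi> (chart_inv c u)))"
          using h c(1) by (simp add: smooth_on_def)
      qed auto
      then have "Cinf_on (mdim M) T (\<lambda>w. h (\<pi> (chart_inv c (\<sigma> w))))"
        by (rule Cinf_on_compose[where f="\<lambda>u. h (\<pi> (chart_inv c u))" and g=\<sigma>, OF T(1) S _ \<sigma>(1,2)])
      then have "Cinf_on (mdim M) T (\<lambda>w. h (chart_inv d w))"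
        by (rule Cinf_on_cong[OF T(1), rotated]) (simp add: \<sigma>\<pi>)
      then show "\<exists>T. openin (Euclidean_space (mdim M)) T \<and> w \<in> T \<and> Cinf_on (mdim M) T (\<lambda>u. h (chart_inv d u))"
        using T Fy by blast
    qed
  qed
qed

section \<open>Surjectivity of principal circle bundles\<close>

lemma circle_chart_cis:
  assumes "t \<in> {a - pi<..<a + pi}"
  shows "(\<lambda>i. if i = 0 then a + Arg (cis t * cis (- a)) else 0) = line_chart t"
proof -
  have "Arg (cis t * cis (- a)) = t - a"
    using assms by (intro cis_Arg_unique) (auto simp: cis_mult)
  then show ?thesis by (simp add: line_chart_def fun_eq_iff)
qed

text \<open>Continuity of an inverse trivialization says where points of the topological space go,
  so the points over \<open>V\<close> must be shown to lie in it. The set V \<times> S^1 is itself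
  open, as its image in every product chart is a product of open sets.\<close>

lemma trivial_circle_bundle_topspace:
  assumes inj: "\<And>c. c \<in> atlas Y \<Longrightarrow> inj_on (snd c) (fst c)"
    and V: "openin (mtop Y) V"
  shows "V \<times> sphere 0 1 \<subseteq> topspace (mtop (prod_mfd (open_submfd Y V) circle))"
proof (rule openin_subset)
  let ?N = "prod_mfd (open_submfd Y V) circle"
  let ?k = "mdim Y"
  \<comment> \<open>Names for the product chart and the circle chart, so that every chart of the
    product reads \<open>pc \<phi> (cc a)\<close>.\<close>
  define pc where "pc \<phi> \<psi> = (\<lambda>(p, q) i. if i < ?k then \<phi> p i else \<psi> q (i - ?k))"
    for \<phi> :: "'a \<Rightarrow> nat \<Rightarrow> real" and \<psi> :: "complex \<Rightarrow> nat \<Rightarrow> real"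
  define cc where "cc a z = (\<lambda>i::nat. if i = 0 then a + Arg (z * cis (- a)) else 0)" for a z
  have dim: "mdim ?N = Suc ?k" and pts: "pts ?N = (pts Y \<inter> V) \<times> sphere 0 1"
    by (simp_all add: prod_mfd_def open_submfd_def circle_def)
  have Nchart: "\<exists>U \<phi> a. (U, \<phi>) \<in> atlas Y \<and> c = ((U \<inter> V) \<times> cis ` {a - pi<..<a + pi}, pc \<phi> (cc a))"
    if "c \<in> atlas ?N" for c
    using that unfolding prod_mfd_def open_submfd_def circle_def mfd.simps
    by (auto simp: pc_def cc_def[abs_def])
  have cis: "cc a (cis t) = line_chart t" if "t \<in> {a - pi<..<a + pi}" for a t
    unfolding cc_def by (rule circle_chart_cis[OF that])
  \<comment> \<open>The base point fills the coordinates below \<open>?k\<close>, the angle is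
    coordinate \<open>?k\<close>, and nothing lies beyond; injectivity and the shape of the chart
    image both follow from this.\<close>
  have chart: "(\<lambda>i. if i < ?k then pc \<phi> (cc a) (p, cis t) i else 0) = \<phi> p \<and> pc \<phi> (cc a) (p, cis t) ?k = t \<and>
      (\<forall>i>?k. pc \<phi> (cc a) (p, cis t) i = 0)"
    if "(U, \<phi>) \<in> atlas Y" "p \<in> U \<inter> V" "t \<in> {a - pi<..<a + pi}" for U \<phi> a p t
  proof -
    have "openin (Euclidean_space ?k) (\<phi> ` (U \<inter> V))"
      using openin_mtop_iff[of Y V] inj V that(1) by fastforce
    then have "\<phi> p \<in> Rn ?k" using openin_Rn_subset that(2) by blast
    then show ?thesis by (auto simp: pc_def cis[OF that(3)] line_chart_def)
  qed
  have Ninj: "inj_on (snd c) (fst c)" if c: "c \<in> atlas ?N" for c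
  proof -
    obtain U \<phi> a where c: "(U, \<phi>) \<in> atlas Y" "c = ((U \<inter> V) \<times> cis ` {a - pi<..<a + pi}, pc \<phi> (cc a))"
      using Nchart[OF c] by blast
    have "inj_on \<phi> U" using inj[OF c(1)] by simp
    show ?thesis
    proof (rule inj_onI)
      fix z z' assume z: "z \<in> fst c" "z' \<in> fst c" "snd c z = snd c z'"
      then obtain p t p' t' where eq: "z = (p, cis t)" "z' = (p', cis t')"
        and p: "p \<in> U \<inter> V" "p' \<in> U \<inter> V" and t: "t \<in> {a - pi<..<a + pi}" "t' \<in> {a - pi<..<a + pi}"
        using c(2) by auto
      note 1 = chart[OF c(1) p(1) t(1)] and 2 = chart[OF c(1) p(2) t(2)]
      have pc: "pc \<phi> (cc a) (p, cis t) = pc \<phi> (cc a) (p', cis t')" using z(3) c(2) eq by simp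
      have "\<phi> p = \<phi> p'" using conjunct1[OF 1] unfolding pc conjunct1[OF 2] by (rule sym)
      moreover have "t = t'" using conjunct1[OF conjunct2[OF 1]] conjunct1[OF conjunct2[OF 2]] unfolding pc by simp
      ultimately have "p = p'" "t = t'" using \<open>inj_on \<phi> U\<close> p by (auto simp: inj_on_def)
      then show "z = z'" using eq by simp
    qed
  qed
  have mtopN: "openin (mtop ?N) W \<longleftrightarrow> W \<subseteq> pts ?N \<and>
      (\<forall>c\<in>atlas ?N. openin (Euclidean_space (mdim ?N)) (snd c ` (fst c \<inter> W)))" for W
    by (rule openin_mtop_iff[OF Ninj])
  show "openin (mtop ?N) (V \<times> sphere 0 1)"
    unfolding mtopN pts dim
  proof (intro conjI ballI)
    show "V \<times> sphere 0 1 \<subseteq> (pts Y \<inter> V) \<times> sphere 0 1"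
      using openin_mtop_iff[of Y V] inj V by blast
  next
    fix c assume "c \<in> atlas ?N"
    then obtain U \<phi> a where c: "(U, \<phi>) \<in> atlas Y" "c = ((U \<inter> V) \<times> cis ` {a - pi<..<a + pi}, pc \<phi> (cc a))"
      using Nchart by blast
    let ?r = "\<lambda>u i. if i < ?k then u i else (0::real)"
    \<comment> \<open>The chart image as an explicit product of the base chart image and an interval
      of angles; both factors are preimages of open sets.\<close>
    let ?A = "{u \<in> Rn (Suc ?k). ?r u \<in> \<phi> ` (U \<inter> V)} \<inter> {u \<in> Rn (Suc ?k). u ?k \<in> {a - pi<..<a + pi}}"
    have op: "openin (Euclidean_space ?k) (\<phi> ` (U \<inter> V))"
      using openin_mtop_iff[of Y V] inj V c(1) by fastforce
    have "openin (Euclidean_space (Suc ?k)) ?A"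
    proof (intro openin_Int)
      show "openin (Euclidean_space (Suc ?k)) {u \<in> Rn (Suc ?k). ?r u \<in> \<phi> ` (U \<inter> V)}"
        by (rule openin_Rn_preimage_map[OF openin_Rn_Rn op]) (auto intro: continuous_on_coordinate)
      show "openin (Euclidean_space (Suc ?k)) {u \<in> Rn (Suc ?k). u ?k \<in> {a - pi<..<a + pi}}"
        by (intro openin_Rn_vimage continuous_on_coordinate) auto
    qed
    moreover have "snd c ` (fst c \<inter> V \<times> sphere 0 1) = ?A"
    proof (intro equalityI subsetI)
      fix u assume "u \<in> snd c ` (fst c \<inter> V \<times> sphere 0 1)"
      then obtain p t where "p \<in> U \<inter> V" "t \<in> {a - pi<..<a + pi}" "u = pc \<phi> (cc a) (p, cis t)"
        using c(2) by auto
      then show "u \<in> ?A" using chart[OF c(1), of p t a] by (auto simp: Suc_le_eq)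
    next
      fix u assume u: "u \<in> ?A"
      then obtain p where p: "p \<in> U \<inter> V" "?r u = \<phi> p" by auto
      have t: "u ?k \<in> {a - pi<..<a + pi}" using u by blast
      have "u i = pc \<phi> (cc a) (p, cis (u ?k)) i" for i
      proof -
        note ch = chart[OF c(1) p(1) t]
        consider "i < ?k" | "i = ?k" | "i > ?k" by linarith
        then show ?thesis
        proof cases
          case 1
          then have "u i = \<phi> p i" using fun_cong[OF p(2), of i] by simp
          then show ?thesis using 1 by (simp add: pc_def)
        qed (use ch u in auto)
      qed
      then have "u = snd c (p, cis (u ?k))" unfolding c(2) snd_conv by (rule ext)
      moreover have "(p, cis (u ?k)) \<in> fst c \<inter> V \<times> sphere 0 1" using c(2) p(1) t by auto
      ultimately show "u \<in> snd c ` (fst c \<inter> V \<times> sphere 0 1)" by (rule image_eqI)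
    qed
    ultimately show "openin (Euclidean_space (Suc ?k)) (snd c ` (fst c \<inter> V \<times> sphere 0 1))" by simp
  qed
qed

text \<open>The inverse trivialization at (y, 1) is the preimage: the inverse equation places it
  over \<open>y\<close>, and continuity makes it a point of \<open>P\<close>. The circle coordinate
  1 is an arbitrary choice.\<close>

lemma principal_circle_bundle_surj:
  assumes P: "smooth_manifold P" and inj: "\<And>c. c \<in> atlas Y \<Longrightarrow> inj_on (snd c) (fst c)"
    and pcb: "principal_circle_bundle P Y pr act" and y: "y \<in> pts Y"
  shows "\<exists>p\<in>pts P. pr p = y"
proof -
  obtain V \<theta> where V: "openin (mtop Y) V" "y \<in> V"
    and diff: "diffeomorphism (open_submfd P {p \<in> pts P. pr p \<in> V}) (prod_mfd (open_submfd Y V) circle)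
      (\<lambda>p. (pr p, \<theta> p))"
    using pcb y unfolding principal_circle_bundle_def by blast
  let ?N = "prod_mfd (open_submfd Y V) circle"
  let ?Q = "open_submfd P {p \<in> pts P. pr p \<in> V}"
  obtain G where G: "smooth_map ?N ?Q G" "\<And>q. q \<in> pts ?N \<Longrightarrow> (pr (G q), \<theta> (G q)) = q"
    using diff unfolding diffeomorphism_def by blast
  have "(y, 1) \<in> topspace (mtop ?N)"
    using trivial_circle_bundle_topspace[OF inj V(1)] V(2) by auto
  then have "G (y, 1) \<in> topspace (mtop ?Q)"
    using G(1) continuous_map_image_subset_topspace unfolding smooth_map_def by blast
  moreover have "topspace (mtop ?Q) \<subseteq> pts ?Q"
  proof -
    have "inj_on (snd c) (fst c)" if "c \<in> atlas ?Q" for c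
      using that chart_inj[OF P] by (fastforce simp: open_submfd_def intro: inj_on_subset)
    from openin_mtop_iff[OF this] show ?thesis using openin_topspace by blast
  qed
  ultimately have "G (y, 1) \<in> pts P" by (auto simp: open_submfd_def)
  moreover have "(y, 1) \<in> pts ?N" using y V(2) by (simp add: prod_mfd_def open_submfd_def circle_def)
  then have "pr (G (y, 1)) = y" using G(2) by blast
  ultimately show ?thesis by blast
qed

section \<open>Gerbes\<close>

lemma vfields_tangent: "v \<in> vfields M \<Longrightarrow> p \<in> pts M \<Longrightarrow> v p \<in> tangent M p"
  and vfields_outside: "v \<in> vfields M \<Longrightarrow> p \<notin> pts M \<Longrightarrow> v p = 0"
  by (auto simp: vfields_def vfields_along_def)

lemma lie_deriv_smooth:
  assumes M: "smooth_manifold M" and v: "v \<in> vfields M" and f: "f \<in> smooth_functions M"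
  shows "lie_deriv v f \<in> smooth_functions M"
proof -
  have "smooth_on M {q \<in> pts M. q \<in> pts M} (\<lambda>q. v q f)"
    using v f openin_mtop_pts[OF M] unfolding vfields_def vfields_along_def smooth_functions_def by blast
  then show ?thesis using vfields_outside[OF v] by (simp add: smooth_functions_def lie_deriv_def)
qed

lemma form0_fun_contract2: "form0_fun (contract z (contract x \<omega>)) = (\<lambda>p. \<omega> p [x p, z p])"
  by (simp add: form0_fun_def contract_def)

lemma two_form_smooth:
  assumes "\<omega> \<in> forms M 2" "x \<in> vfields M" "z \<in> vfields M"
  shows "form0_fun (contract z (contract x \<omega>)) \<in> smooth_functions M"
proof -
  have "\<forall>xs. length xs = 2 \<and> set xs \<subseteq> vfields M \<longrightarrow> (\<lambda>p. \<omega> p (map (\<lambda>x. x p) xs)) \<in> smooth_functions M"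
    using assms(1) by (simp add: forms_def)
  from this[rule_format, of "[x, z]"] show ?thesis
    using assms(2,3) by (simp add: form0_fun_contract2)
qed

text \<open>For operators on functions the chain rule is mere substitution; smoothness of \<pi>
  ensures that the inner \<open>dmap\<close> does not fall into its default case.\<close>

lemma dmap_compose:
  assumes X: "smooth_manifold X" and M: "smooth_manifold M" and \<pi>: "smooth_map X M \<pi>"
    and y: "s q \<in> pts X"
  shows "dmap M \<pi> (s q) (dmap X s q v) = dmap M (\<lambda>q. \<pi> (s q)) q v"
  using smooth_at_compose[OF X M \<pi> y] by (auto simp: dmap_def fun_eq_iff)

context
  fixes \<G> :: "('m, 'x, 'p) gerbe"
  assumes gerbe: "bundle_gerbe \<G>"
begin

lemma gerbe_manifolds: "smooth_manifold (gM \<G>)" "smooth_manifold (gX \<G>)" "smooth_manifold (gP \<G>)"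
  and gerbe_submersion: "surjective_submersion (gX \<G>) (gM \<G>) (gproj \<G>)"
  and gerbe_smooth_proj: "smooth_map (gX \<G>) (gM \<G>) (gproj \<G>)"
  and gerbe_arrs: "arrs (ggpd \<G>) = pts (gP \<G>)" "objs (ggpd \<G>) = pts (gX \<G>)"
  using gerbe by (simp_all add: bundle_gerbe_def Let_def lie_groupoid_def surjective_submersion_def)

text \<open>A functor over the identity into the submersion groupoid has no freedom: its value on an
  arrow is the pair of target and source, which must then lie in one fibre.\<close>

lemma gerbe_src_tgt:
  assumes "q \<in> pts (gP \<G>)"
  shows "src (ggpd \<G>) q \<in> pts (gX \<G>)" "tgt (ggpd \<G>) q \<in> pts (gX \<G>)"
    "gproj \<G> (src (ggpd \<G>) q) = gproj \<G> (tgt (ggpd \<G>) q)"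
    "gmor \<G> q = (tgt (ggpd \<G>) q, src (ggpd \<G>) q)"
proof -
  have "gpd_functor (ggpd \<G>) (submersion_gpd (gX \<G>) (gproj \<G>)) (gmor \<G>) (\<lambda>y. y)"
    using gerbe unfolding bundle_gerbe_def Let_def by blast
  then have "gmor \<G> q \<in> {(x, y). x \<in> pts (gX \<G>) \<and> y \<in> pts (gX \<G>) \<and> gproj \<G> x = gproj \<G> y}"
    "snd (gmor \<G> q) = src (ggpd \<G>) q" "fst (gmor \<G> q) = tgt (ggpd \<G>) q"
    using assms by (simp_all add: gpd_functor_def submersion_gpd_def gerbe_arrs)
  then show "src (ggpd \<G>) q \<in> pts (gX \<G>)" "tgt (ggpd \<G>) q \<in> pts (gX \<G>)"
    "gproj \<G> (src (ggpd \<G>) q) = gproj \<G> (tgt (ggpd \<G>) q)"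
    "gmor \<G> q = (tgt (ggpd \<G>) q, src (ggpd \<G>) q)"
    by (auto simp: prod_eq_iff)
qed

lemma gerbe_arrow:
  assumes "y \<in> pts (gX \<G>)" "y' \<in> pts (gX \<G>)" "gproj \<G> y = gproj \<G> y'"
  obtains q where "q \<in> pts (gP \<G>)" "src (ggpd \<G>) q = y" "tgt (ggpd \<G>) q = y'"
proof -
  let ?Y = "fibre_product (gX \<G>) (gX \<G>) (gM \<G>) (gproj \<G>) (gproj \<G>)"
  have pcb: "principal_circle_bundle (gP \<G>) ?Y (gmor \<G>) (gact \<G>)"
    using gerbe unfolding bundle_gerbe_def Let_def by blast
  \<comment> \<open>Charts of the fibre product restrict charts of a maximal atlas, which are
    injective by definition.\<close>
  have "inj_on (snd c) (fst c)" if "c \<in> atlas ?Y" for c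
    using that by (auto simp: fibre_product_def submfd_def maximal_atlas_def intro: inj_on_subset)
  moreover have "(y', y) \<in> pts ?Y" using assms by (simp add: fibre_product_def submfd_def)
  ultimately obtain q where "q \<in> pts (gP \<G>)" "gmor \<G> q = (y', y)"
    using principal_circle_bundle_surj[OF gerbe_manifolds(3) _ pcb] by blast
  then show thesis using that gerbe_src_tgt(4) by auto
qed

text \<open>For an arrow \<open>q\<close> from \<open>y\<close> to \<open>y'\<close>,
  multiplicativity makes \<open>x y\<close> and \<open>x y'\<close> the images of the single vector
  \<open>p q\<close> under ds and dt, and \<pi> o s = \<pi> o t on \<open>P\<close>.\<close>

lemma multiplicative_vfield_projects:
  assumes "(x, p) \<in> multiplicative_vfields (gP \<G>) (gX \<G>) (ggpd \<G>)"
    and "y \<in> pts (gX \<G>)" "y' \<in> pts (gX \<G>)" "gproj \<G> y = gproj \<G> y'"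
  shows "dmap (gM \<G>) (gproj \<G>) y (x y) = dmap (gM \<G>) (gproj \<G>) y' (x y')"
proof -
  let ?s = "src (ggpd \<G>)" and ?t = "tgt (ggpd \<G>)" and ?\<pi> = "gproj \<G>"
  obtain q where q: "q \<in> pts (gP \<G>)" and y: "?s q = y" "?t q = y'"
    by (rule gerbe_arrow[OF assms(2-4)])
  have xp: "x (?s q) = dmap (gX \<G>) ?s q (p q)" "x (?t q) = dmap (gX \<G>) ?t q (p q)"
    and p: "p q \<in> tangent (gP \<G>) q"
    using assms(1) q vfields_tangent[of p "gP \<G>" q]
    by (auto simp: multiplicative_vfields_def gpd_functor_def tangent_gpd_def gerbe_arrs)
  note comp = dmap_compose[OF gerbe_manifolds(2,1) gerbe_smooth_proj]
  have "dmap (gM \<G>) ?\<pi> (?s q) (x (?s q)) = dmap (gM \<G>) (\<lambda>q. ?\<pi> (?s q)) q (p q)"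
    unfolding xp by (rule comp[where s="?s"]) (rule gerbe_src_tgt[OF q])
  also have "\<dots> = dmap (gM \<G>) (\<lambda>q. ?\<pi> (?t q)) q (p q)"
  proof
    fix f
    \<comment> \<open>The two composites agree on \<open>P\<close> only, which suffices for a
      tangent vector.\<close>
    have "p q (\<lambda>q. f (?\<pi> (?s q))) = p q (\<lambda>q. f (?\<pi> (?t q)))"
      by (rule tangent_cong[OF gerbe_manifolds(3) p]) (simp add: gerbe_src_tgt(3))
    then show "dmap (gM \<G>) (\<lambda>q. ?\<pi> (?s q)) q (p q) f = dmap (gM \<G>) (\<lambda>q. ?\<pi> (?t q)) q (p q) f"
      by (simp add: dmap_def gerbe_src_tgt(3)[OF q])
  qed
  also have "\<dots> = dmap (gM \<G>) ?\<pi> (?t q) (x (?t q))"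
    unfolding xp by (rule comp[where s="?t", symmetric]) (rule gerbe_src_tgt[OF q])
  finally show ?thesis unfolding y .
qed

text \<open>Establishes that the definite description \<open>projected_vfield\<close> denotes: a
  smooth projection exists and, \<pi> being surjective, is unique.\<close>

lemma projected_vfield:
  assumes xp: "(x, p) \<in> multiplicative_vfields (gP \<G>) (gX \<G>) (ggpd \<G>)"
  shows "projected_vfield \<G> x \<in> vfields (gM \<G>)"
    and "y \<in> pts (gX \<G>) \<Longrightarrow> dmap (gM \<G>) (gproj \<G>) y (x y) = projected_vfield \<G> x (gproj \<G> y)"
proof -
  let ?M = "gM \<G>" and ?X = "gX \<G>" and ?\<pi> = "gproj \<G>"
  note mf = gerbe_manifolds
  have x: "x \<in> vfields ?X" using xp by (simp add: multiplicative_vfields_def)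
  have surj: "?\<pi> ` pts ?X = pts ?M"
    and dsurj: "\<And>y. y \<in> pts ?X \<Longrightarrow> dmap ?M ?\<pi> y ` tangent ?X y = tangent ?M (?\<pi> y)"
    using gerbe_submersion by (auto simp: surjective_submersion_def)
  \<comment> \<open>A set-theoretic section with no smoothness; independence of the point chosen in
    the fibre makes the resulting field canonical.\<close>
  define lift where "lift m = (SOME y. y \<in> pts ?X \<and> ?\<pi> y = m)" for m
  have lift: "lift m \<in> pts ?X" "?\<pi> (lift m) = m" if "m \<in> pts ?M" for m
  proof -
    have "m \<in> ?\<pi> ` pts ?X" using that surj by simp
    then have "\<exists>y. y \<in> pts ?X \<and> ?\<pi> y = m" by blast
    from someI_ex[OF this] show "lift m \<in> pts ?X" "?\<pi> (lift m) = m" unfolding lift_def by blast+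
  qed
  define x' where "x' m = (if m \<in> pts ?M then dmap ?M ?\<pi> (lift m) (x (lift m)) else 0)" for m
  have x': "dmap ?M ?\<pi> y (x y) = x' (?\<pi> y)" if "y \<in> pts ?X" for y
  proof -
    have m: "?\<pi> y \<in> pts ?M" using that surj by blast
    show ?thesis
      using multiplicative_vfield_projects[OF xp that lift(1)[OF m]] lift(2)[OF m] m by (simp add: x'_def)
  qed
  have "x' \<in> vfields ?M"
    unfolding vfields_def vfields_along_def
  proof (intro CollectI conjI ballI allI impI)
    fix m assume m: "m \<in> pts ?M"
    then show "x' m \<in> tangent ?M m"
      using dsurj[OF lift(1)[OF m]] vfields_tangent[OF x lift(1)[OF m]] lift(2)[OF m] x'[OF lift(1)[OF m]]
      by (metis imageI)
  next
    fix W f assume Wf: "openin (mtop ?M) W \<and> smooth_on ?M W f"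
    let ?V = "{y \<in> pts ?X. ?\<pi> y \<in> W}"
    have V: "openin (mtop ?X) ?V" by (rule smooth_map_preimage_open[OF mf(2) gerbe_smooth_proj]) (use Wf in simp)
    \<comment> \<open>Smoothness is tested upstairs: the function \<open>x' f\<close> pulls back to
      x(f o \<pi>), which is smooth on \<open>X\<close> and descends along the submersion.\<close>
    have "smooth_on ?X ?V (\<lambda>y. f (?\<pi> y))"
      by (rule smooth_on_compose[OF mf(2,1) gerbe_smooth_proj]) (use Wf in simp_all)
    then have "smooth_on ?X {q \<in> pts ?X. q \<in> ?V} (\<lambda>y. x y (\<lambda>y. f (?\<pi> y)))"
      using x V unfolding vfields_def vfields_along_def by blast
    then have "smooth_on ?X ?V (\<lambda>y. x y (\<lambda>y. f (?\<pi> y)))" by simp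
    moreover have "x y (\<lambda>y. f (?\<pi> y)) = x' (?\<pi> y) f" if "y \<in> ?V" for y
    proof -
      have "smooth_at ?M (?\<pi> y) f" using that Wf unfolding smooth_at_def by blast
      then show ?thesis using x'[of y, symmetric] that by (simp add: dmap_def)
    qed
    ultimately have "smooth_on ?X ?V (\<lambda>y. x' (?\<pi> y) f)"
      by (rule smooth_on_cong[OF mf(2) V])
    then have "smooth_on ?M W (\<lambda>m. x' m f)"
      using smooth_on_descend[OF mf(2,1) gerbe_submersion, of W "\<lambda>m. x' m f"] Wf by blast
    then show "smooth_on ?M {q \<in> pts ?M. q \<in> W} (\<lambda>m. x' m f)"
      by (rule smooth_on_subset[OF mf(1)]) auto
  qed (simp add: x'_def)
  moreover have "z = x'" if z: "z \<in> vfields ?M" "\<forall>y\<in>pts ?X. dmap ?M ?\<pi> y (x y) = z (?\<pi> y)" for z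
  proof
    fix m
    show "z m = x' m"
    proof (cases "m \<in> pts ?M")
      case True
      then show ?thesis using z(2) x'[OF lift(1)[OF True]] lift[OF True] by metis
    qed (simp add: vfields_outside[OF z(1)] x'_def)
  qed
  ultimately have "projected_vfield \<G> x = x'"
    unfolding projected_vfield_def using x' by (intro the_equality) auto
  then show "projected_vfield \<G> x \<in> vfields ?M"
    "y \<in> pts ?X \<Longrightarrow> dmap ?M ?\<pi> y (x y) = projected_vfield \<G> x (?\<pi> y)"
    using \<open>x' \<in> vfields ?M\<close> x' by auto
qed

text \<open>Smoothness of \<open>f\<close> keeps \<open>dmap\<close> away from its default, and the
  extension by 0 in \<open>pullback_fun\<close> is invisible to \<open>x y\<close>.\<close>

lemma vfield_pullback_fun:
  assumes xp: "(x, p) \<in> multiplicative_vfields (gP \<G>) (gX \<G>) (ggpd \<G>)"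
    and f: "f \<in> smooth_functions (gM \<G>)" and y: "y \<in> pts (gX \<G>)"
  shows "x y (pullback_fun (gX \<G>) (gproj \<G>) f) = projected_vfield \<G> x (gproj \<G> y) f"
proof -
  have x: "x y \<in> tangent (gX \<G>) y"
    using xp y vfields_tangent by (auto simp: multiplicative_vfields_def)
  have "smooth_at (gM \<G>) (gproj \<G> y) f"
    by (rule smooth_functions_smooth_at[OF gerbe_manifolds(1) f])
      (rule smooth_map_in_pts[OF gerbe_manifolds(2,1) gerbe_smooth_proj y])
  then have "projected_vfield \<G> x (gproj \<G> y) f = x y (\<lambda>q. f (gproj \<G> q))"
    by (simp add: projected_vfield(2)[OF xp y, symmetric] dmap_def)
  also have "\<dots> = x y (pullback_fun (gX \<G>) (gproj \<G>) f)"
    by (rule tangent_cong[OF gerbe_manifolds(2) x]) (simp add: pullback_fun_def)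
  finally show ?thesis by (rule sym)
qed

lemma simplicial_diff_pullback_fun: "simplicial_diff_fun \<G> (pullback_fun (gX \<G>) (gproj \<G>) f) = 0"
  by (auto simp: simplicial_diff_fun_def pullback_fun_def fun_eq_iff gerbe_src_tgt)

end

lemma simplicial_diff_fun_add: "simplicial_diff_fun \<G> (g + h) = simplicial_diff_fun \<G> g + simplicial_diff_fun \<G> h"
  by (auto simp: simplicial_diff_fun_def pullback_fun_def fun_eq_iff)

section \<open>Vector space records, direct sums and quotients\<close>

lemma subspace_module_simps [simp]:
  "carrier (subspace_module S) = S" "\<zero>\<^bsub>subspace_module S\<^esub> = 0"
  "add (subspace_module S) = (+)" "smult (subspace_module S) = (*\<^sub>R)"
  by (simp_all add: subspace_module_def mk_space_def)

text \<open>The inverse in a record is described inside its carrier, so it is ordinary negation once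
  -a is known to lie there.\<close>

lemma subspace_module_a_inv:
  assumes "a \<in> S" "- a \<in> S"
  shows "\<ominus>\<^bsub>subspace_module S\<^esub> a = - a"
  unfolding a_inv_def m_inv_def
  by (rule the_equality) (use assms in \<open>auto simp: eq_neg_iff_add_eq_0 add.commute\<close>)

lemma subspace_module_minus:
  assumes "b \<in> S" "- b \<in> S"
  shows "a \<ominus>\<^bsub>subspace_module S\<^esub> b = a - b"
  by (simp add: a_minus_def subspace_module_a_inv[OF assms])

lemma direct_sum_subspace_simps [simp]:
  "carrier (direct_sum A B) = carrier A \<times> carrier B"
  "\<zero>\<^bsub>direct_sum A B\<^esub> = (\<zero>\<^bsub>A\<^esub>, \<zero>\<^bsub>B\<^esub>)"
  by (simp_all add: direct_sum_def mk_space_def)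

lemma direct_sum_add:
  "add A = (+) \<Longrightarrow> add B = (+) \<Longrightarrow> add (direct_sum A B) = (+)"
  by (simp add: direct_sum_def mk_space_def fun_eq_iff split: prod.splits)

lemma direct_sum_smult:
  "smult A = (*\<^sub>R) \<Longrightarrow> smult B = (*\<^sub>R) \<Longrightarrow> smult (direct_sum A B) = (*\<^sub>R)"
  by (simp add: direct_sum_def mk_space_def fun_eq_iff split: prod.splits)

lemma pullback_fun_add: "pullback_fun X F (f + g) = pullback_fun X F f + pullback_fun X F g"
  and pullback_fun_scaleR: "pullback_fun X F (r *\<^sub>R f) = r *\<^sub>R pullback_fun X F f"
  and pullback_fun_uminus: "pullback_fun X F (- f) = - pullback_fun X F f"
  and pullback_fun_zero: "pullback_fun X F 0 = 0"
  by (auto simp: pullback_fun_def scaleR_fun_def fun_eq_iff)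

lemma a_r_coset_plus:
  assumes "add F = (+)"
  shows "K +>\<^bsub>F\<^esub> a = (\<lambda>k. k + a) ` K"
  by (auto simp: a_r_coset_def r_coset_def assms)

lemma quotient_space_carrier: "carrier (quotient_space A K) = (\<lambda>a. K +>\<^bsub>A\<^esub> a) ` carrier A"
  by (auto simp: quotient_space_def mk_space_def A_RCOSETS_def RCOSETS_def a_r_coset_def)

lemma quotient_space_add:
  assumes "add A = (+)"
  shows "S \<oplus>\<^bsub>quotient_space A K\<^esub> T = {s + t |s t. s \<in> S \<and> t \<in> T}"
  by (auto simp: quotient_space_def mk_space_def set_add_def set_mult_def assms)

text \<open>The summand from \<open>K\<close> matters for r = 0, where bare scaling would shrink a
  coset to a point.\<close>

lemma quotient_space_smult:
  assumes "add A = (+)" "smult A = (*\<^sub>R)"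
  shows "r \<odot>\<^bsub>quotient_space A K\<^esub> S = {k + r *\<^sub>R s |k s. k \<in> K \<and> s \<in> S}"
  by (auto simp: quotient_space_def mk_space_def a_r_coset_plus[OF assms(1)] assms(2))

lemma the_elem_image_const:
  assumes "S \<noteq> {}" "\<And>s. s \<in> S \<Longrightarrow> f s = b"
  shows "the_elem (f ` S) = b"
proof -
  have "f ` S = {b}" using assms by auto
  then show ?thesis by simp
qed

theorem proposition3p10:
  fixes \<G> :: "('m, 'x, 'p) gerbe"
    and \<gamma> :: "'p form" and B B' :: "'x form" and H H' \<tau> :: "'m form"
  assumes "bundle_gerbe \<G>"
    and "gerbe_connection \<G> \<gamma>"
    and "\<tau> \<in> forms (gM \<G>) 2"
    and "curving \<G> \<gamma> B"
    and "three_curvature \<G> B H"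
    and "B' = B + pullback (gX \<G>) (gM \<G>) (gproj \<G>) \<tau>"
    and "H' = H + ext_deriv (gM \<G>) 2 \<tau>"
  shows "\<exists>\<Phi>. butterfly_iso (gerbe_lie2 \<G>) (atiyah (gM \<G>) H')
           (butterfly_compose (gerbe_lie2 \<G>) (atiyah (gM \<G>) H) (atiyah (gM \<G>) H')
              (gerbe_butterfly \<G> \<gamma> B)
              (butterfly_of_morphism (atiyah (gM \<G>) H) (atiyah (gM \<G>) H') (id_shift \<tau>)))
           (gerbe_butterfly \<G> \<gamma> B') \<Phi>"
proof -
  note gerbe = assms(1)
  let ?M = "gM \<G>" and ?X = "gX \<G>" and ?P = "gP \<G>"
  note mf = gerbe_manifolds[OF gerbe]
  let ?SF = "smooth_functions ?M"
  define pb where "pb = pullback_fun ?X (gproj \<G>)"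
  define mult where "mult = multiplicative_vfields ?P ?X (ggpd \<G>)"
  define E where "E = gerbe_butterfly \<G> \<gamma> B"
  define E' where "E' = butterfly_of_morphism (atiyah ?M H) (atiyah ?M H') (id_shift \<tau>)"
  define E2 where "E2 = gerbe_butterfly \<G> \<gamma> B'"
  define F where "F = butterfly_fibre_product E E'"
  define K where "K = (\<lambda>w. (blambda E w, bkappa E' w)) ` carrier (deg1 (atiyah ?M H))"
  define C where "C = butterfly_compose (gerbe_lie2 \<G>) (atiyah ?M H) (atiyah ?M H') E E'"
  have C_simps: "bspace C = quotient_space F K"
    "bbr C = (\<lambda>S T. \<Union>(e, e')\<in>S. \<Union>(d, d')\<in>T. K +>\<^bsub>F\<^esub> (bbr E e d, bbr E' e' d'))"
    "bkappa C = (\<lambda>v. K +>\<^bsub>F\<^esub> (bkappa E v, \<zero>\<^bsub>bspace E'\<^esub>))"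
    "blambda C = (\<lambda>u. K +>\<^bsub>F\<^esub> (\<zero>\<^bsub>bspace E\<^esub>, blambda E' u))"
    "bsigma C = (\<lambda>S. the_elem ((\<lambda>(e, e'). bsigma E e) ` S))"
    "brho C = (\<lambda>S. the_elem ((\<lambda>(e, e'). brho E' e') ` S))"
    by (simp_all add: C_def butterfly_compose_def Let_def F_def K_def)

  have bbr_C: "bbr C S T =
      (\<Union>e\<in>S. \<Union>d\<in>T. K +>\<^bsub>F\<^esub> (bbr E (fst e) (fst d), bbr E' (snd e) (snd d)))" for S T
    by (simp add: C_simps case_prod_beta)

  have pb_add: "pb (f + g) = pb f + pb g" and pb_scale: "pb (r *\<^sub>R f) = r *\<^sub>R pb f"
    and pb_minus: "pb (- f) = - pb f" and pb_zero: "pb 0 = 0" for f g r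
    by (simp_all add: pb_def pullback_fun_add pullback_fun_scaleR pullback_fun_uminus pullback_fun_zero)
  have pb_smooth: "pb f \<in> smooth_functions ?X" if "f \<in> ?SF" for f
    unfolding pb_def by (rule pullback_fun_smooth[OF mf(2,1) gerbe_smooth_proj[OF gerbe] that])
  have pb_diff: "simplicial_diff_fun \<G> (pb f) = 0" for f
    unfolding pb_def by (rule simplicial_diff_pullback_fun[OF gerbe])
  note SF_uminus = smooth_functions_uminus[OF mf(1)]
  have SF_diff: "a - b \<in> ?SF" if "a \<in> ?SF" "b \<in> ?SF" for a b
    using smooth_functions_add[OF mf(1) that(1) SF_uminus[OF that(2)]] by simp

  \<comment> \<open>Dropping \<open>v\<close> loses nothing on the fibre product, where it is the
    projection of \<open>x\<close>.\<close>
  define \<phi> where "\<phi> = (\<lambda>((x, p, g), (f, v :: 'm vfield)). (x :: 'x vfield, p :: 'p vfield, g + pb f))"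
  have \<phi>_add: "\<phi> (a + b) = \<phi> a + \<phi> b" and \<phi>_scale: "\<phi> (r *\<^sub>R a) = r *\<^sub>R \<phi> a" for a b r
    by (auto simp: \<phi>_def pb_add pb_scale algebra_simps split: prod.splits)

  \<comment> \<open>The minus sign is that of \<kappa> for the butterfly of a morphism, here with
    identity degree-1 part; the 0 is the Atiyah differential.\<close>
  have K_eq: "K = (\<lambda>w. ((0, 0, pb w), (- w, 0))) ` ?SF"
    unfolding K_def
    by (intro image_cong)
      (auto simp: E_def E'_def gerbe_butterfly_def butterfly_of_morphism_def atiyah_def id_shift_def
        Let_def pb_def subspace_module_a_inv SF_uminus)
  have \<phi>_K: "\<phi> k = 0" if "k \<in> K" for k
    using that by (auto simp: K_eq \<phi>_def pb_minus zero_prod_def)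
  have K0: "0 \<in> K"
    unfolding K_eq using smooth_functions_zero[OF mf(1)]
    by (intro image_eqI[of _ _ 0]) (auto simp: pb_zero zero_prod_def)

  have add_F: "add F = (+)" and smult_F: "smult F = (*\<^sub>R)"
    by (simp_all add: F_def butterfly_fibre_product_def E_def E'_def gerbe_butterfly_def
        butterfly_of_morphism_def atiyah_def Let_def direct_sum_add direct_sum_smult)
  have F_iff: "((x, p, g), (f, v)) \<in> carrier F \<longleftrightarrow> (x, p) \<in> mult \<and> g \<in> smooth_functions ?X \<and>
      simplicial_diff_fun \<G> g = form0_fun (contract p \<gamma>) \<and> f \<in> ?SF \<and> v \<in> vfields ?M \<and>
      projected_vfield \<G> x = v" for x p g f v
    by (auto simp: F_def butterfly_fibre_product_def E_def E'_def gerbe_butterfly_def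
        butterfly_of_morphism_def atiyah_def Let_def mult_def)
  have E2_iff: "(x, p, g) \<in> carrier (bspace E2) \<longleftrightarrow> (x, p) \<in> mult \<and> g \<in> smooth_functions ?X \<and>
      simplicial_diff_fun \<G> g = form0_fun (contract p \<gamma>)" for x p g
    by (simp add: E2_def gerbe_butterfly_def Let_def mult_def)
  have add_E2: "add (bspace E2) = (+)" "smult (bspace E2) = (*\<^sub>R)"
    by (simp_all add: E2_def gerbe_butterfly_def Let_def)

  have coset: "K +>\<^bsub>F\<^esub> a = (\<lambda>k. k + a) ` K" for a by (rule a_r_coset_plus[OF add_F])
  have coset_self: "a \<in> K +>\<^bsub>F\<^esub> a" for a
    unfolding coset using K0 by (intro image_eqI[of _ _ 0]) auto
  have \<phi>_coset: "\<phi> s = \<phi> a" if "s \<in> K +>\<^bsub>F\<^esub> a" for s a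
    using that \<phi>_K by (auto simp: coset \<phi>_add)
  \<comment> \<open>The bracket on the quotient ranges over all representatives, so each of them
    must satisfy the constraints of the fibre product; pullbacks from \<open>M\<close> are killed by
    \<delta> and do not disturb these.\<close>
  have coset_F: "s \<in> carrier F" if s: "s \<in> K +>\<^bsub>F\<^esub> a" and a: "a \<in> carrier F" for s a
  proof -
    obtain w where w: "w \<in> ?SF" "s = ((0, 0, pb w), (- w, 0)) + a"
      using s unfolding coset unfolding K_eq by auto
    obtain x p g f v where a_eq: "a = ((x, p, g), (f, v))" by (cases a) auto
    show ?thesis using a w(1) unfolding w(2) a_eq
      by (simp add: F_iff simplicial_diff_fun_add pb_diff SF_diff
          smooth_functions_add[OF mf(2)] pb_smooth)
  qed

  \<comment> \<open>No representative is chosen: each compatibility below reduces to \<phi> being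
    constant on the set that represents the result.\<close>
  define \<Phi> where "\<Phi> S = the_elem (\<phi> ` S)" for S
  have \<Phi>I: "\<Phi> S = b" if "S \<noteq> {}" "\<And>s. s \<in> S \<Longrightarrow> \<phi> s = b" for S b
    unfolding \<Phi>_def by (rule the_elem_image_const[OF that])
  have \<Phi>_coset: "\<Phi> (K +>\<^bsub>F\<^esub> a) = \<phi> a" for a
    by (rule \<Phi>I) (use coset_self \<phi>_coset in blast)+

  have \<phi>_bracket: "\<phi> (bbr E (fst s) (fst t), bbr E' (snd s) (snd t)) = bbr E2 (\<phi> s) (\<phi> t)"
    if st: "s \<in> carrier F" "t \<in> carrier F" for s t
  proof -
    obtain x p g f v where s: "s = ((x, p, g), (f, v))" by (cases s) auto
    obtain z r h f' v' where t: "t = ((z, r, h), (f', v'))" by (cases t) auto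
    have xp: "(x, p) \<in> mult" "g \<in> smooth_functions ?X" "f \<in> ?SF" "v \<in> vfields ?M" "projected_vfield \<G> x = v"
      and zr: "(z, r) \<in> mult" "h \<in> smooth_functions ?X" "f' \<in> ?SF" "v' \<in> vfields ?M" "projected_vfield \<G> z = v'"
      using st unfolding s t F_iff by auto
    have x: "x \<in> vfields ?X" and z: "z \<in> vfields ?X"
      using xp(1) zr(1) by (auto simp: mult_def multiplicative_vfields_def)
    let ?\<tau> = "form0_fun (contract v' (contract v \<tau>))"
    have \<tau>: "?\<tau> \<in> ?SF" "- ?\<tau> \<in> ?SF"
      using two_form_smooth[OF assms(3) xp(4) zr(4)] SF_uminus by auto
    have L: "lie_deriv v' f \<in> ?SF" "- lie_deriv v' f \<in> ?SF"
      using lie_deriv_smooth[OF mf(1) zr(4) xp(3)] SF_uminus by auto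
    \<comment> \<open>The Atiyah differential is zero, so the term [\<partial>w, w'] of the morphism
      butterfly is differentiation along the zero field.\<close>
    have "lie_deriv 0 f' = 0" by (auto simp: lie_deriv_def fun_eq_iff)
    then have br': "bbr E' (f, v) (f', v') =
        (lie_deriv v f' - lie_deriv v' f - ?\<tau>, lie_bracket ?M v v')"
      using \<tau> L
      by (simp add: E'_def butterfly_of_morphism_def atiyah_def id_shift_def Let_def
          subspace_module_minus zero_fun_def[symmetric])
    have "lie_deriv x h - lie_deriv z g - form0_fun (contract z (contract x B)) +
        pb (lie_deriv v f' - lie_deriv v' f - ?\<tau>) =
      lie_deriv x (h + pb f') - lie_deriv z (g + pb f) - form0_fun (contract z (contract x B'))" (is "?lhs = ?rhs")
    proof
      fix y
      show "?lhs y = ?rhs y"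
      proof (cases "y \<in> pts ?X")
        \<comment> \<open>Off \<open>X\<close> the vector fields and pullbacks vanish by convention,
          and \<open>B'\<close> coincides with \<open>B\<close>.\<close>
        case False
        then show ?thesis
          by (simp add: lie_deriv_def vfields_outside[OF x] vfields_outside[OF z] form0_fun_contract2
              pb_def pullback_fun_def assms(6) pullback_def)
      next
        case True
        note tx = vfields_tangent[OF x True] and tz = vfields_tangent[OF z True]
        note sm = smooth_functions_smooth_at[OF mf(2) _ True]
        have "x y (h + pb f') = x y h + v (gproj \<G> y) f'"
          using tangent_add[OF mf(2) tx sm[OF zr(2)] sm[OF pb_smooth[OF zr(3)]]]
            vfield_pullback_fun[OF gerbe xp(1)[unfolded mult_def] zr(3) True] xp(5) by (simp add: pb_def)
        moreover have "z y (g + pb f) = z y g + v' (gproj \<G> y) f"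
          using tangent_add[OF mf(2) tz sm[OF xp(2)] sm[OF pb_smooth[OF xp(3)]]]
            vfield_pullback_fun[OF gerbe zr(1)[unfolded mult_def] xp(3) True] zr(5) by (simp add: pb_def)
        \<comment> \<open>Pulling back evaluates \<tau> on d\<pi>(x y) and d\<pi>(z y), which are
          the values of \<open>v\<close> and \<open>v'\<close> at \<pi>(y); this is the \<tau>-term
          of the bracket in the morphism butterfly.\<close>
        moreover have "B' y [x y, z y] = B y [x y, z y] + \<tau> (gproj \<G> y) [v (gproj \<G> y), v' (gproj \<G> y)]"
          using True tx tz projected_vfield(2)[OF gerbe xp(1)[unfolded mult_def] True]
            projected_vfield(2)[OF gerbe zr(1)[unfolded mult_def] True] xp(5) zr(5)
          by (simp add: assms(6) pullback_def)
        ultimately show ?thesis using True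
          by (simp add: lie_deriv_def form0_fun_contract2 pb_def pullback_fun_def)
      qed
    qed
    then show ?thesis
      unfolding s t fst_conv snd_conv br'
      by (simp add: \<phi>_def E_def E2_def gerbe_butterfly_def Let_def)
  qed

  have "butterfly_iso (gerbe_lie2 \<G>) (atiyah ?M H') C E2 \<Phi>"
    unfolding butterfly_iso_def Let_def C_simps(1) quotient_space_carrier add_E2
  proof (intro conjI ballI allI)
    show "bij_betw \<Phi> ((\<lambda>a. K +>\<^bsub>F\<^esub> a) ` carrier F) (carrier (bspace E2))"
      unfolding bij_betw_def
    proof
      show "inj_on \<Phi> ((\<lambda>a. K +>\<^bsub>F\<^esub> a) ` carrier F)"
      proof (rule inj_onI)
        fix S T assume "S \<in> (\<lambda>a. K +>\<^bsub>F\<^esub> a) ` carrier F" "T \<in> (\<lambda>a. K +>\<^bsub>F\<^esub> a) ` carrier F"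
          and eq: "\<Phi> S = \<Phi> T"
        then obtain s t where s: "s \<in> carrier F" "S = K +>\<^bsub>F\<^esub> s" and t: "t \<in> carrier F" "T = K +>\<^bsub>F\<^esub> t"
          by auto
        obtain x p g f v where s_eq: "s = ((x, p, g), (f, v))" by (cases s) auto
        obtain z r h f' v' where t_eq: "t = ((z, r, h), (f', v'))" by (cases t) auto
        have f: "f \<in> ?SF" "f' \<in> ?SF" using s(1) t(1) unfolding s_eq t_eq F_iff by auto
        have "\<phi> s = \<phi> t" using eq unfolding s(2) t(2) \<Phi>_coset .
        then have 1: "x = z" "p = r" "g + pb f = h + pb f'" by (auto simp: s_eq t_eq \<phi>_def)
        have 2: "v = v'" using s(1) t(1) 1 unfolding s_eq t_eq F_iff by auto
        let ?k = "\<lambda>w. ((0 :: 'x vfield, 0 :: 'p vfield, pb w), (- w, 0 :: 'm vfield))"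
        have pb_diff: "pb (a - b) = pb a - pb b" for a b
          using pb_add[of a "- b"] pb_minus[of b] by simp
        have g: "g = h + pb (f' - f)" using 1(3) by (simp add: pb_diff algebra_simps)
        \<comment> \<open>Equal images force \<open>s\<close> and \<open>t\<close> to differ by the
          element of \<open>K\<close> with w = f' - f; translation by it maps \<open>K\<close> onto
          itself, so the cosets coincide.\<close>
        have st: "s = ?k (f' - f) + t" unfolding s_eq t_eq using 1(1,2) 2 g by (simp add: add.commute)
        have k_add: "?k w + ?k w' = ?k (w + w')" for w w' by (simp add: pb_add)
        have eq: "?k w + s = ?k (w + (f' - f)) + t" "?k w + t = ?k (w - (f' - f)) + s" for w
          unfolding st add.assoc[symmetric] k_add by simp_all
        have SF: "w + (f' - f) \<in> ?SF" "w - (f' - f) \<in> ?SF" if "w \<in> ?SF" for w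
          using smooth_functions_add[OF mf(1) that SF_diff[OF f(2,1)]] SF_diff[OF that SF_diff[OF f(2,1)]] by auto
        show "S = T"
          unfolding s(2) t(2) coset unfolding K_eq image_image
          by (intro equalityI image_subsetI) (use eq SF in blast)+
      qed
      show "\<Phi> ` (\<lambda>a. K +>\<^bsub>F\<^esub> a) ` carrier F = carrier (bspace E2)"
      proof (intro equalityI subsetI)
        fix b assume "b \<in> \<Phi> ` (\<lambda>a. K +>\<^bsub>F\<^esub> a) ` carrier F"
        then obtain x p g f v where a: "((x, p, g), (f, v)) \<in> carrier F" and b: "b = \<phi> ((x, p, g), (f, v))"
          by (auto simp: \<Phi>_coset)
        then show "b \<in> carrier (bspace E2)"
          unfolding b \<phi>_def prod.case E2_iff
          using a by (simp add: F_iff simplicial_diff_fun_add pb_diff smooth_functions_add[OF mf(2)] pb_smooth)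
      next
        fix b assume b: "b \<in> carrier (bspace E2)"
        obtain x p g where b_eq: "b = (x, p, g)" by (cases b) auto
        \<comment> \<open>The preimage takes f = 0; its last entry is admissible because the
          projection is a smooth vector field on \<open>M\<close>.\<close>
        have "((x, p, g), (0, projected_vfield \<G> x)) \<in> carrier F"
          using b smooth_functions_zero[OF mf(1)] projected_vfield(1)[OF gerbe]
          unfolding b_eq E2_iff F_iff mult_def by blast
        moreover have "\<phi> ((x, p, g), (0, projected_vfield \<G> x)) = b" by (simp add: \<phi>_def b_eq pb_zero)
        ultimately show "b \<in> \<Phi> ` (\<lambda>a. K +>\<^bsub>F\<^esub> a) ` carrier F" using \<Phi>_coset by (metis image_eqI)
      qed
    qed
  next
    fix S T assume "S \<in> (\<lambda>a. K +>\<^bsub>F\<^esub> a) ` carrier F" "T \<in> (\<lambda>a. K +>\<^bsub>F\<^esub> a) ` carrier F"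
    then obtain s t where s: "s \<in> carrier F" "S = K +>\<^bsub>F\<^esub> s" and t: "t \<in> carrier F" "T = K +>\<^bsub>F\<^esub> t"
      by auto
    note ne = coset_self[of s] coset_self[of t]
    have "\<Phi> (S \<oplus>\<^bsub>quotient_space F K\<^esub> T) = \<phi> s + \<phi> t"
      unfolding quotient_space_add[OF add_F] s(2) t(2)
    proof (rule \<Phi>I)
      fix q assume "q \<in> {a + b |a b. a \<in> K +>\<^bsub>F\<^esub> s \<and> b \<in> K +>\<^bsub>F\<^esub> t}"
      then obtain a b where "a \<in> K +>\<^bsub>F\<^esub> s" "b \<in> K +>\<^bsub>F\<^esub> t" "q = a + b" by blast
      then show "\<phi> q = \<phi> s + \<phi> t" using \<phi>_coset[of a s] \<phi>_coset[of b t] by (simp add: \<phi>_add)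
    qed (use ne in blast)
    then show "\<Phi> (S \<oplus>\<^bsub>quotient_space F K\<^esub> T) = \<Phi> S + \<Phi> T" unfolding s(2) t(2) \<Phi>_coset .
    \<comment> \<open>\<open>bbr C S T\<close> is a union of cosets over all pairs of
      representatives. By \<open>\<phi>_bracket\<close> each is sent to the bracket of the images,
      and these images do not depend on the representatives.\<close>
    have "\<Phi> (bbr C S T) = bbr E2 (\<phi> s) (\<phi> t)"
    proof (rule \<Phi>I)
      show "bbr C S T \<noteq> {}" using ne coset_self unfolding bbr_C s(2) t(2) by blast
      fix q assume "q \<in> bbr C S T"
      then obtain e d where ed: "e \<in> S" "d \<in> T"
        "q \<in> K +>\<^bsub>F\<^esub> (bbr E (fst e) (fst d), bbr E' (snd e) (snd d))"
        unfolding bbr_C by blast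
      have "\<phi> q = bbr E2 (\<phi> e) (\<phi> d)"
        using \<phi>_coset[OF ed(3)] \<phi>_bracket[of e d] coset_F[of e s] coset_F[of d t] s t ed(1,2) by simp
      then show "\<phi> q = bbr E2 (\<phi> s) (\<phi> t)" using \<phi>_coset[of e s] \<phi>_coset[of d t] ed(1,2) s(2) t(2) by simp
    qed
    then show "\<Phi> (bbr C S T) = bbr E2 (\<Phi> S) (\<Phi> T)" unfolding s(2) t(2) \<Phi>_coset .
  next
    fix r S assume "S \<in> (\<lambda>a. K +>\<^bsub>F\<^esub> a) ` carrier F"
    then obtain s where s: "s \<in> carrier F" "S = K +>\<^bsub>F\<^esub> s" by auto
    have "\<Phi> (r \<odot>\<^bsub>quotient_space F K\<^esub> S) = r *\<^sub>R \<phi> s"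
      unfolding quotient_space_smult[OF add_F smult_F] s(2)
    proof (rule \<Phi>I)
      fix q assume "q \<in> {k + r *\<^sub>R a |k a. k \<in> K \<and> a \<in> K +>\<^bsub>F\<^esub> s}"
      then obtain k a where "k \<in> K" "a \<in> K +>\<^bsub>F\<^esub> s" "q = k + r *\<^sub>R a" by blast
      then show "\<phi> q = r *\<^sub>R \<phi> s" using \<phi>_coset[of a s] \<phi>_K[of k] by (simp add: \<phi>_add \<phi>_scale)
    qed (use coset_self K0 in blast)
    then show "\<Phi> (r \<odot>\<^bsub>quotient_space F K\<^esub> S) = r *\<^sub>R \<Phi> S" unfolding s(2) \<Phi>_coset .
  next
    fix v
    show "\<Phi> (bkappa C v) = bkappa E2 v"
      unfolding C_simps \<Phi>_coset
      by (simp add: \<phi>_def E_def E'_def E2_def gerbe_butterfly_def butterfly_of_morphism_def atiyah_def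
          Let_def pb_zero)
  next
    fix w
    show "\<Phi> (blambda C w) = blambda E2 w"
      unfolding C_simps \<Phi>_coset
      by (simp add: \<phi>_def E_def E'_def E2_def gerbe_butterfly_def butterfly_of_morphism_def atiyah_def
          Let_def pb_def zero_prod_def)
  next
    fix S assume "S \<in> (\<lambda>a. K +>\<^bsub>F\<^esub> a) ` carrier F"
    then obtain s where s: "s \<in> carrier F" "S = K +>\<^bsub>F\<^esub> s" by auto
    obtain x p g f v where s_eq: "s = ((x, p, g), (f, v))" by (cases s) auto
    have v: "projected_vfield \<G> x = v" using s(1) unfolding s_eq F_iff by blast
    have \<Phi>S: "\<Phi> S = (x, p, g + pb f)" unfolding s(2) \<Phi>_coset by (simp add: \<phi>_def s_eq)
    \<comment> \<open>Elements of \<open>K\<close> have zero vector field components, so \<sigma>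
      and \<rho> are constant on a coset; \<rho> returns \<open>v\<close> itself since the Atiyah
      differential vanishes.\<close>
    have "bsigma C S = (x, p)"
      unfolding C_simps s(2) s_eq coset unfolding K_eq
      by (rule the_elem_image_const)
        (use smooth_functions_zero[OF mf(1)] in \<open>auto simp: E_def gerbe_butterfly_def Let_def\<close>)
    then show "bsigma E2 (\<Phi> S) = bsigma C S"
      unfolding \<Phi>S by (simp add: E2_def gerbe_butterfly_def Let_def)
    have "brho C S = v"
      unfolding C_simps s(2) s_eq coset unfolding K_eq
      by (rule the_elem_image_const)
        (use smooth_functions_zero[OF mf(1)] in
          \<open>auto simp: E'_def butterfly_of_morphism_def atiyah_def id_shift_def Let_def zero_fun_def[symmetric]\<close>)
    then show "brho E2 (\<Phi> S) = brho C S"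
      unfolding \<Phi>S by (simp add: E2_def gerbe_butterfly_def Let_def v)
  qed
  then show ?thesis unfolding C_def E_def E'_def E2_def by blast
qed

end
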